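(* Let $L$ be a pseudo-Finsler metric defined on $A\subseteq\mathrm{T}M$, $X\in\mathfrak{X}(M_A)$ an anisotropic vector field, $V\in\mathfrak{X}^A(U)$ an $A$-admissible field with $U\subseteq M$ open, $T\in\mathcal{T}^1_1(M_A)$, and $\overline{D}\subseteq U$ a domain with $\partial D$ smooth up to a subset of $0$ $(n-1)$-dimensional measure on $M$ (a regularity under which Stokes' theorem can be applied on $\overline D$) and $\mathrm{Supp}(X_V)\cap\overline{D}$ compact. Let $\nabla$ be the Chern anisotropic connection of $L$. Assume: (i) $\mathrm{div}(T)_V=0$; (ii) either $T^\flat_V(-,\nabla^V_{-}X)$ is antisymmetric, or $T^\flat_V$ is symmetric and $(\mathfrak{l}^{\mathrm{H}}_Xg)_V=0$; (iii) $C^{\mathfrak m}(\mathrm{D}_{T(X)}V)+\mathrm{trace}\left\{\dot\partial_{\mathrm{D}V}(T(X))\right\}=0$ (evaluated at $V$). Then $$\int_{\partial D}\imath_{T_V(X_V)}(d\mathrm{Vol}_V)=0.$$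
   Context: $M$ is a connected oriented smooth manifold of dimension $n\ge2$, $\pi\colon\mathrm{T}M\to M$ is the projection, and $A\subseteq\mathrm{T}M\setminus\mathbf{0}$ is open with $\pi(A)=M$ and conic ($\lambda v\in A$ for $v\in A$, $\lambda>0$). Coordinates $x^i$ on $M$ induce coordinates $(x^i,y^i)$ on $\mathrm{T}M$; $\partial_i=\partial/\partial x^i$, $\dot\partial_i=\partial/\partial y^i$. An anisotropic tensor field $T\in\mathcal{T}^r_s(M_A)$ assigns smoothly to each $v\in A$ an $r$-contravariant $s$-covariant tensor $T_v$ on $\mathrm{T}_{\pi(v)}M$; $\mathfrak{X}(M_A)=\mathcal{T}^1_0(M_A)$, and $\Omega_s(M_A)$ denotes the alternating elements of $\mathcal{T}^0_s(M_A)$. For $U\subseteq M$ open, $\mathfrak{X}^A(U)$ is the set of vector fields $V$ on $U$ with $V_p\in A$ for all $p\in U$ ($A$-admissible fields); then $T_V$ is the ordinary tensor field $p\mapsto T_{V_p}$ on $U$. The vertical derivative along $w\in\mathrm{T}_{\pi(v)}M$ is $(\dot\partial_wT)_v=\lim_{t\to0}(T_{v+tw}-T_v)/t$. A pseudo-Finsler metric on $A$ is a smooth positively $2$-homogeneous function $L\colon A\to\mathbb{R}$ whose fundamental tensor $g_{ij}=\frac12\dot\partial_i\dot\partial_jL$ is nondegenerate at each $v\in A$. Its Cartan tensor is $C_{ijk}=\frac12\dot\partial_kg_{ij}$ (indices raised with $g$) and its mean Cartan tensor is $C^{\mathfrak m}(X)=g^{ik}C_{ijk}X^j$. The metric nonlinear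 connection $\mathrm{H}A$ of $L$ is the horizontal subbundle of $\mathrm{T}A$ spanned by $\delta_i=\partial_i-N^j_i\dot\partial_j$ with $N^i_j=\gamma^i_{jk}y^k-C^i_{jk}\gamma^k_{ab}y^ay^b$, $\gamma^i_{jk}=\frac12g^{ic}(\partial_kg_{cj}+\partial_jg_{ck}-\partial_cg_{jk})$; its nonlinear covariant derivative is $\mathrm{D}_YV=Y^j\left(\frac{\partial V^i}{\partial x^j}+N^i_j(V)\right)\partial_i$. Here $\mathrm{D}_{T(X)}V$ means $\mathrm{D}_{T_V(X_V)}V$, and $\mathrm{trace}\{\dot\partial_{\mathrm{D}V}(T(X))\}$ is the trace of the endomorphism field $Y\mapsto(\dot\partial_{\mathrm{D}_YV}(T(X)))_V$. The metric volume form is $d\mathrm{Vol}=\sqrt{|\det g_{ab}(x,y)|}\,dx^1\wedge\dots\wedge dx^n\in\Omega_n(M_A)$ in positively oriented coordinates. The Chern anisotropic connection $\nabla$ of $L$ has Christoffel symbols $\Gamma^i_{jk}=\frac12 g^{il}(\delta_kg_{lj}+\delta_jg_{lk}-\delta_lg_{jk})$ and acts on anisotropic tensors by $\nabla_{k}T^{i_1\dots i_r}_{j_1\dots j_s}=\delta_{k}T^{i_1\dots i_r}_{j_1\dots j_s}+\sum_\mu\Gamma^{i_\mu}_{kl}T^{i_1\dots l\dots i_r}_{j_1\dots j_s}-\sum_\nu\Gamma^l_{kj_\nu}T^{i_1\dots i_r}_{j_1\dots l\dots j_s}$; $\nabla^V_YX=(\nabla_YX)_V$. $T\in\mathcal{T}^1_1(M_A)$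 is regarded as an endomorphism, $T(X)^i=T^i_jX^j$; $T^\flat(X,Y):=g(X,T(Y))$; its divergence is $\mathrm{div}(T)\in\Omega_1(M_A)$, $\mathrm{div}(T)_j=\nabla_iT^i_j$. The anisotropic Lie bracket with $X\in\mathfrak{X}(M_A)$, $\mathfrak{l}^{\mathrm{H}}_X$, is the unique tensor derivation of anisotropic tensors ($\mathbb{R}$-linear, type-preserving, Leibniz for tensor products, commuting with contractions) with $\mathfrak{l}^{\mathrm{H}}_Xf=X^k\delta_kf$ for smooth functions $f$ on $A$ and $\mathfrak{l}^{\mathrm{H}}_XY=(X^j\delta_jY^i-Y^j\delta_jX^i)\partial_i$ for $Y\in\mathfrak{X}(M_A)$. A domain $\overline{D}$ is a nonempty connected set which coincides with the closure of its interior $D$; its boundary is $\partial D$. A subset of $M$ has $0$ $m$-dimensional measure if its intersection with any embedded $m$-dimensional submanifold $\sigma\subseteq M$ has measure $0$ in $\sigma$. Integrals over $\partial D$ are taken over its smooth part with the orientation induced as boundary of $D$. That Stokes' theorem can be applied on $\overline D$ means: $\int_Dd\eta=\int_{\partial D}\eta$ for every smooth $(n-1)$-form $\eta$ on $U$ with $\mathrm{Supp}(\eta)\cap\overline D$ compact. The interior product is $\imath_X\omega=\omega(X,-,\dots,-)$. *)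

theory Defs
  imports "HOL-Analysis.Analysis"
begin

section \<open>Smooth functions on open sets\<close>

text \<open>Only meant for open \<open>S\<close>: the derivatives are taken at \<open>x\<close>, not within \<open>S\<close>.\<close>

primrec C_on :: "nat \<Rightarrow> 'a::real_normed_vector set \<Rightarrow> ('a \<Rightarrow> 'b::real_normed_vector) \<Rightarrow> bool" where
  "C_on 0 S f \<longleftrightarrow> continuous_on S f"
| "C_on (Suc k) S f \<longleftrightarrow> (\<forall>x\<in>S. f differentiable (at x)) \<and>
     (\<forall>w. C_on k S (\<lambda>x. frechet_derivative f (at x) w))"

definition smooth_on :: "'a::real_normed_vector set \<Rightarrow> ('a \<Rightarrow> 'b::real_normed_vector) \<Rightarrow> bool" where
  "smooth_on S f \<longleftrightarrow> (\<forall>k. C_on k S f)"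

section \<open>Oriented smooth manifolds\<close>

text \<open>The manifold is a whole type \<open>'m\<close>, whose topology is Hausdorff and second countable by its
  classes. Its oriented smooth structure is the maximal atlas \<open>M\<close> of positively oriented charts, so
  a chart in \<open>M\<close> is a system of positively oriented coordinates. The index type \<open>'n\<close> is finite and
  linearly ordered, \<open>n = CARD('n)\<close>; the order is what \<open>dx\<^sup>1 \<and> \<dots> \<and> dx\<^sup>n\<close> refers to.
  Only the values of a chart map on the chart domain matter.\<close>

datatype ('m, 'n::finite) chart = Chart (cdom: "'m set") (cmap: "'m \<Rightarrow> real^'n")

definition crange :: "('m, 'n::finite) chart \<Rightarrow> (real^'n) set" where
  "crange c = cmap c ` cdom c"

definition cinv :: "('m, 'n::finite) chart \<Rightarrow> real^'n \<Rightarrow> 'm" where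
  "cinv c = inv_into (cdom c) (cmap c)"

definition is_chart :: "('m::topological_space, 'n::finite) chart \<Rightarrow> bool" where
  "is_chart c \<longleftrightarrow> open (cdom c) \<and> open (crange c) \<and>
     homeomorphism (cdom c) (crange c) (cmap c) (cinv c)"

text \<open>\<open>jac c d p i k\<close> is the derivative of the \<open>i\<close>-th coordinate of \<open>d\<close> with respect to the \<open>k\<close>-th
  coordinate of \<open>c\<close>, at \<open>p\<close>.\<close>

definition jac :: "('m, 'n::finite) chart \<Rightarrow> ('m, 'n) chart \<Rightarrow> 'm \<Rightarrow> 'n \<Rightarrow> 'n \<Rightarrow> real" where
  "jac c d p i k = frechet_derivative (cmap d \<circ> cinv c) (at (cmap c p)) (axis k 1) $ i"

definition oriented_compatible :: "('m, 'n::finite) chart \<Rightarrow> ('m, 'n) chart \<Rightarrow> bool" where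
  "oriented_compatible c d \<longleftrightarrow>
     smooth_on (cmap c ` (cdom c \<inter> cdom d)) (cmap d \<circ> cinv c) \<and>
     (\<forall>p\<in>cdom c \<inter> cdom d. det (\<chi> i k. jac c d p i k) > 0)"

definition oriented_smooth_structure ::
    "('m::{t2_space,second_countable_topology}, 'n::finite) chart set \<Rightarrow> bool" where
  "oriented_smooth_structure M \<longleftrightarrow>
     (\<forall>c\<in>M. is_chart c) \<and> (\<Union>c\<in>M. cdom c) = UNIV \<and>
     (\<forall>c\<in>M. \<forall>d\<in>M. oriented_compatible c d) \<and>
     (\<forall>c. is_chart c \<and> (\<forall>d\<in>M. oriented_compatible c d \<and> oriented_compatible d c) \<longrightarrow> c \<in> M)"

section \<open>Tensors\<close>

text \<open>An \<open>r\<close>-contravariant \<open>s\<close>-covariant tensor at \<open>p\<close> is given by its components in all charts around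
  \<open>p\<close>, subject to the transformation law; \<open>\<tau> c is js\<close> is the component in the chart \<open>c\<close> with upper
  indices \<open>is\<close> and lower indices \<open>js\<close>. All other values are \<open>0\<close>, so that equality of tensors is
  equality of functions. Tangent vectors are the tensors of type \<open>(1,0)\<close>.\<close>

type_synonym ('m, 'n) tensor = "('m, 'n) chart \<Rightarrow> 'n list \<Rightarrow> 'n list \<Rightarrow> real"

definition tensors :: "('m, 'n::finite) chart set \<Rightarrow> nat \<Rightarrow> nat \<Rightarrow> 'm \<Rightarrow> ('m, 'n) tensor set" where
  "tensors M r s p = {\<tau>.
     (\<forall>c is js. \<not> (c \<in> M \<and> p \<in> cdom c \<and> length is = r \<and> length js = s) \<longrightarrow> \<tau> c is js = 0) \<and>
     (\<forall>c\<in>M. \<forall>d\<in>M. \<forall>is js. p \<in> cdom c \<and> p \<in> cdom d \<and> length is = r \<and> length js = s \<longrightarrow>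
        \<tau> d is js = (\<Sum>ks | length ks = r. \<Sum>ls | length ls = s.
          (\<Prod>a<r. jac c d p (is ! a) (ks ! a)) * (\<Prod>b<s. jac d c p (ls ! b) (js ! b)) * \<tau> c ks ls))}"

definition tzero :: "('m, 'n) tensor" where
  "tzero = (\<lambda>c is js. 0)"

definition tadd :: "('m, 'n) tensor \<Rightarrow> ('m, 'n) tensor \<Rightarrow> ('m, 'n) tensor" where
  "tadd \<sigma> \<tau> = (\<lambda>c is js. \<sigma> c is js + \<tau> c is js)"

definition tscale :: "real \<Rightarrow> ('m, 'n) tensor \<Rightarrow> ('m, 'n) tensor" where
  "tscale a \<tau> = (\<lambda>c is js. a * \<tau> c is js)"

text \<open>The tensor product of \<open>\<sigma>\<close>, of type \<open>(r,s)\<close>, with \<open>\<tau>\<close>.\<close>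

definition tprod :: "nat \<Rightarrow> nat \<Rightarrow> ('m, 'n) tensor \<Rightarrow> ('m, 'n) tensor \<Rightarrow> ('m, 'n) tensor" where
  "tprod r s \<sigma> \<tau> = (\<lambda>c is js. \<sigma> c (take r is) (take s js) * \<tau> c (drop r is) (drop s js))"

text \<open>The contraction of the upper index at position \<open>a\<close> with the lower index at position \<open>b\<close>.\<close>

definition contract :: "nat \<Rightarrow> nat \<Rightarrow> ('m, 'n::finite) tensor \<Rightarrow> ('m, 'n) tensor" where
  "contract a b \<tau> = (\<lambda>c is js.
     \<Sum>k\<in>UNIV. \<tau> c (take a is @ k # drop a is) (take b js @ k # drop b js))"

text \<open>\<open>T(X)\<^sup>i = T\<^sup>i\<^sub>j X\<^sup>j\<close>\<close>

definition tapply :: "('m, 'n::finite) tensor \<Rightarrow> ('m, 'n) tensor \<Rightarrow> ('m, 'n) tensor" where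
  "tapply \<tau> \<xi> = (\<lambda>c is js. \<Sum>j\<in>UNIV. \<tau> c is [j] * \<xi> c [j] js)"

definition tensor_field_on ::
    "('m, 'n::finite) chart set \<Rightarrow> nat \<Rightarrow> nat \<Rightarrow> 'm set \<Rightarrow> ('m \<Rightarrow> ('m, 'n) tensor) \<Rightarrow> bool" where
  "tensor_field_on M r s U T \<longleftrightarrow> (\<forall>p\<in>U. T p \<in> tensors M r s p) \<and>
     (\<forall>c\<in>M. \<forall>is js. length is = r \<and> length js = s \<longrightarrow>
        smooth_on (cmap c ` (U \<inter> cdom c)) (\<lambda>x. T (cinv c x) c is js))"

section \<open>The tangent bundle and anisotropic tensor fields\<close>

type_synonym ('m, 'n) tpoint = "'m \<times> ('m, 'n) tensor"

definition TM :: "('m, 'n::finite) chart set \<Rightarrow> ('m, 'n) tpoint set" where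
  "TM M = {(p, \<xi>). \<xi> \<in> tensors M 1 0 p}"

text \<open>The coordinates \<open>(x, y)\<close> on the tangent bundle induced by the chart \<open>c\<close>, and their inverse.\<close>

definition tdom :: "('m, 'n::finite) chart set \<Rightarrow> ('m, 'n) chart \<Rightarrow> ('m, 'n) tpoint set" where
  "tdom M c = {v \<in> TM M. fst v \<in> cdom c}"

definition tcoord :: "('m, 'n::finite) chart \<Rightarrow> ('m, 'n) tpoint \<Rightarrow> (real^'n) \<times> (real^'n)" where
  "tcoord c v = (cmap c (fst v), \<chi> i. snd v c [i] [])"

definition tinv ::
    "('m, 'n::finite) chart set \<Rightarrow> ('m, 'n) chart \<Rightarrow> (real^'n) \<times> (real^'n) \<Rightarrow> ('m, 'n) tpoint" where
  "tinv M c = inv_into (tdom M c) (tcoord c)"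

definition conic_domain :: "('m, 'n::finite) chart set \<Rightarrow> ('m, 'n) tpoint set \<Rightarrow> bool" where
  "conic_domain M A \<longleftrightarrow> A \<subseteq> {v \<in> TM M. snd v \<noteq> tzero} \<and>
     (\<forall>c\<in>M. open (tcoord c ` (A \<inter> tdom M c))) \<and> fst ` A = UNIV \<and>
     (\<forall>p \<xi>. \<forall>t>0. (p, \<xi>) \<in> A \<longrightarrow> (p, tscale t \<xi>) \<in> A)"

text \<open>Anisotropic tensor fields are normalised to be zero outside \<open>A\<close>.\<close>

definition aniso_tensors ::
    "('m, 'n::finite) chart set \<Rightarrow> ('m, 'n) tpoint set \<Rightarrow> nat \<Rightarrow> nat
      \<Rightarrow> (('m, 'n) tpoint \<Rightarrow> ('m, 'n) tensor) set" where
  "aniso_tensors M A r s = {T.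
     (\<forall>v\<in>A. T v \<in> tensors M r s (fst v)) \<and> (\<forall>v. v \<notin> A \<longrightarrow> T v = tzero) \<and>
     (\<forall>c\<in>M. \<forall>is js. length is = r \<and> length js = s \<longrightarrow>
        smooth_on (tcoord c ` (A \<inter> tdom M c)) (\<lambda>z. T (tinv M c z) c is js))}"

text \<open>\<open>T\<^sub>V\<close>\<close>

definition along ::
    "(('m, 'n) tpoint \<Rightarrow> ('m, 'n) tensor) \<Rightarrow> ('m \<Rightarrow> ('m, 'n) tensor) \<Rightarrow> 'm \<Rightarrow> ('m, 'n) tensor" where
  "along T V p = T (p, V p)"

definition admissible_fields ::
    "('m, 'n::finite) chart set \<Rightarrow> ('m, 'n) tpoint set \<Rightarrow> 'm set \<Rightarrow> ('m \<Rightarrow> ('m, 'n) tensor) set" where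
  "admissible_fields M A U = {V. tensor_field_on M 1 0 U V \<and> (\<forall>p\<in>U. (p, V p) \<in> A)}"

text \<open>The vertical derivative \<open>(\<partial>\<^sup>\<cdot>\<^sub>w T)\<^sub>v\<close>, componentwise.\<close>

definition vertical_deriv ::
    "(('m, 'n) tpoint \<Rightarrow> ('m, 'n) tensor) \<Rightarrow> ('m, 'n) tpoint \<Rightarrow> ('m, 'n) tensor \<Rightarrow> ('m, 'n) tensor" where
  "vertical_deriv T v w = (\<lambda>c is js.
     Lim (at 0) (\<lambda>t::real. (T (fst v, tadd (snd v) (tscale t w)) c is js - T v c is js) / t))"

section \<open>Coordinate expressions of a pseudo-Finsler metric\<close>

text \<open>In what follows \<open>z = (x, y)\<close> are the coordinates of a vector in the chart \<open>c\<close>, and an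
  anisotropic object is expressed through \<open>tinv M c\<close>.\<close>

definition dx :: "'n::finite \<Rightarrow> ((real^'n) \<times> (real^'n) \<Rightarrow> real) \<Rightarrow> (real^'n) \<times> (real^'n) \<Rightarrow> real" where
  "dx k f z = frechet_derivative f (at z) (axis k 1, 0)"

definition dy :: "'n::finite \<Rightarrow> ((real^'n) \<times> (real^'n) \<Rightarrow> real) \<Rightarrow> (real^'n) \<times> (real^'n) \<Rightarrow> real" where
  "dy k f z = frechet_derivative f (at z) (0, axis k 1)"

context
  fixes M :: "('m, 'n::finite) chart set"
    and L :: "('m, 'n) tpoint \<Rightarrow> real"
    and c :: "('m, 'n) chart"
begin

definition g_comp :: "'n \<Rightarrow> 'n \<Rightarrow> (real^'n) \<times> (real^'n) \<Rightarrow> real" where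
  "g_comp i j z = 1/2 * dy i (dy j (\<lambda>z. L (tinv M c z))) z"

definition g_mat :: "(real^'n) \<times> (real^'n) \<Rightarrow> real^'n^'n" where
  "g_mat z = (\<chi> i j. g_comp i j z)"

definition g_inv :: "'n \<Rightarrow> 'n \<Rightarrow> (real^'n) \<times> (real^'n) \<Rightarrow> real" where
  "g_inv i j z = matrix_inv (g_mat z) $ i $ j"

definition cartan :: "'n \<Rightarrow> 'n \<Rightarrow> 'n \<Rightarrow> (real^'n) \<times> (real^'n) \<Rightarrow> real" where
  "cartan i j k z = 1/2 * dy k (g_comp i j) z"

definition cartan_up :: "'n \<Rightarrow> 'n \<Rightarrow> 'n \<Rightarrow> (real^'n) \<times> (real^'n) \<Rightarrow> real" where
  "cartan_up i j k z = (\<Sum>l\<in>UNIV. g_inv i l z * cartan l j k z)"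

definition mean_cartan :: "'n \<Rightarrow> (real^'n) \<times> (real^'n) \<Rightarrow> real" where
  "mean_cartan j z = (\<Sum>i\<in>UNIV. \<Sum>k\<in>UNIV. g_inv i k z * cartan i j k z)"

definition formal_christoffel :: "'n \<Rightarrow> 'n \<Rightarrow> 'n \<Rightarrow> (real^'n) \<times> (real^'n) \<Rightarrow> real" where
  "formal_christoffel i j k z = 1/2 * (\<Sum>l\<in>UNIV. g_inv i l z *
     (dx k (g_comp l j) z + dx j (g_comp l k) z - dx l (g_comp j k) z))"

text \<open>The coefficient \<open>N\<^sup>i\<^sub>j\<close> of the metric nonlinear connection.\<close>

definition nonlin :: "'n \<Rightarrow> 'n \<Rightarrow> (real^'n) \<times> (real^'n) \<Rightarrow> real" where
  "nonlin i j z = (\<Sum>k\<in>UNIV. formal_christoffel i j k z * snd z $ k)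
     - (\<Sum>k\<in>UNIV. \<Sum>a\<in>UNIV. \<Sum>b\<in>UNIV.
          cartan_up i j k z * formal_christoffel k a b z * snd z $ a * snd z $ b)"

definition \<delta> :: "'n \<Rightarrow> ((real^'n) \<times> (real^'n) \<Rightarrow> real) \<Rightarrow> (real^'n) \<times> (real^'n) \<Rightarrow> real" where
  "\<delta> k f z = dx k f z - (\<Sum>j\<in>UNIV. nonlin j k z * dy j f z)"

definition chern :: "'n \<Rightarrow> 'n \<Rightarrow> 'n \<Rightarrow> (real^'n) \<times> (real^'n) \<Rightarrow> real" where
  "chern i j k z = 1/2 * (\<Sum>l\<in>UNIV. g_inv i l z *
     (\<delta> k (g_comp l j) z + \<delta> j (g_comp l k) z - \<delta> l (g_comp j k) z))"

text \<open>The component \<open>(\<nabla>\<^sub>k T)\<close> with upper indices \<open>is\<close> and lower indices \<open>js\<close>, for the Chern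
  connection.\<close>

definition covd ::
    "'n \<Rightarrow> (('m, 'n) tpoint \<Rightarrow> ('m, 'n) tensor) \<Rightarrow> 'n list \<Rightarrow> 'n list \<Rightarrow> (real^'n) \<times> (real^'n) \<Rightarrow> real"
  where
  "covd k T is js z = \<delta> k (\<lambda>z. T (tinv M c z) c is js) z
     + (\<Sum>a<length is. \<Sum>l\<in>UNIV. chern (is ! a) k l z * T (tinv M c z) c (is[a := l]) js)
     - (\<Sum>b<length js. \<Sum>l\<in>UNIV. chern l k (js ! b) z * T (tinv M c z) c is (js[b := l]))"

definition div_comp ::
    "(('m, 'n) tpoint \<Rightarrow> ('m, 'n) tensor) \<Rightarrow> 'n \<Rightarrow> (real^'n) \<times> (real^'n) \<Rightarrow> real" where
  "div_comp T j z = (\<Sum>i\<in>UNIV. covd i T [i] [j] z)"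

text \<open>The components \<open>T\<^sup>\<flat>(\<partial>\<^sub>i, \<partial>\<^sub>j)\<close> and \<open>T\<^sup>\<flat>(\<partial>\<^sub>i, \<nabla>\<^bsub>\<partial>j\<^esub>X)\<close>.\<close>

definition flat_comp ::
    "(('m, 'n) tpoint \<Rightarrow> ('m, 'n) tensor) \<Rightarrow> 'n \<Rightarrow> 'n \<Rightarrow> (real^'n) \<times> (real^'n) \<Rightarrow> real" where
  "flat_comp T i j z = (\<Sum>k\<in>UNIV. g_comp i k z * T (tinv M c z) c [k] [j])"

definition flat_covd_comp ::
    "(('m, 'n) tpoint \<Rightarrow> ('m, 'n) tensor) \<Rightarrow> (('m, 'n) tpoint \<Rightarrow> ('m, 'n) tensor)
      \<Rightarrow> 'n \<Rightarrow> 'n \<Rightarrow> (real^'n) \<times> (real^'n) \<Rightarrow> real" where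
  "flat_covd_comp T X i j z = (\<Sum>l\<in>UNIV. flat_comp T i l z * covd j X [l] [] z)"

text \<open>The nonlinear covariant derivative \<open>D\<^sub>Y V\<close> at \<open>p\<close>: the tangent vector at \<open>p\<close> with components
  \<open>Y\<^sup>j (\<partial>\<^sub>j V\<^sup>i + N\<^sup>i\<^sub>j(V))\<close> in the chart \<open>c\<close>.\<close>

definition nonlin_covd ::
    "('m, 'n) tensor \<Rightarrow> ('m \<Rightarrow> ('m, 'n) tensor) \<Rightarrow> 'm \<Rightarrow> ('m, 'n) tensor" where
  "nonlin_covd Y V p = snd (tinv M c (cmap c p, \<chi> i. \<Sum>j\<in>UNIV. Y c [j] [] *
     (frechet_derivative (\<lambda>x. V (cinv c x) c [i] []) (at (cmap c p)) (axis j 1)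
      + nonlin i j (tcoord c (p, V p)))))"

definition coord_vector :: "'n \<Rightarrow> 'm \<Rightarrow> ('m, 'n) tensor" where
  "coord_vector i p = snd (tinv M c (cmap c p, axis i 1))"

text \<open>\<open>C\<^sup>m(D\<^bsub>Z\<^esub>V) + trace (Y \<mapsto> (\<partial>\<^sup>\<cdot>\<^bsub>D\<^sub>YV\<^esub> Z)\<^sub>V)\<close> at \<open>p\<close>, for an anisotropic vector field \<open>Z\<close>.\<close>

definition vertical_term ::
    "(('m, 'n) tpoint \<Rightarrow> ('m, 'n) tensor) \<Rightarrow> ('m \<Rightarrow> ('m, 'n) tensor) \<Rightarrow> 'm \<Rightarrow> real" where
  "vertical_term Z V p =
     (\<Sum>j\<in>UNIV. mean_cartan j (tcoord c (p, V p)) * nonlin_covd (along Z V p) V p c [j] [])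
     + (\<Sum>i\<in>UNIV. vertical_deriv Z (p, V p) (nonlin_covd (coord_vector i p) V p) c [i] [])"

end

definition pseudo_finsler ::
    "('m, 'n::finite) chart set \<Rightarrow> ('m, 'n) tpoint set \<Rightarrow> (('m, 'n) tpoint \<Rightarrow> real) \<Rightarrow> bool" where
  "pseudo_finsler M A L \<longleftrightarrow>
     (\<forall>c\<in>M. smooth_on (tcoord c ` (A \<inter> tdom M c)) (\<lambda>z. L (tinv M c z))) \<and>
     (\<forall>p \<xi>. \<forall>t>0. (p, \<xi>) \<in> A \<longrightarrow> L (p, tscale t \<xi>) = t\<^sup>2 * L (p, \<xi>)) \<and>
     (\<forall>c\<in>M. \<forall>v\<in>A \<inter> tdom M c. det (g_mat M L c (tcoord c v)) \<noteq> 0)"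

definition fund_tensor ::
    "('m, 'n::finite) chart set \<Rightarrow> ('m, 'n) tpoint set \<Rightarrow> (('m, 'n) tpoint \<Rightarrow> real)
      \<Rightarrow> ('m, 'n) tpoint \<Rightarrow> ('m, 'n) tensor" where
  "fund_tensor M A L v = (\<lambda>c is js.
     if v \<in> A \<and> c \<in> M \<and> fst v \<in> cdom c \<and> is = [] \<and> length js = 2
     then g_comp M L c (js ! 0) (js ! 1) (tcoord c v) else 0)"

section \<open>The anisotropic Lie bracket\<close>

definition tensor_derivation ::
    "('m, 'n::finite) chart set \<Rightarrow> ('m, 'n) tpoint set
      \<Rightarrow> ((('m, 'n) tpoint \<Rightarrow> ('m, 'n) tensor) \<Rightarrow> ('m, 'n) tpoint \<Rightarrow> ('m, 'n) tensor) \<Rightarrow> bool" where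
  "tensor_derivation M A \<D> \<longleftrightarrow>
     (\<forall>r s. \<forall>T\<in>aniso_tensors M A r s. \<D> T \<in> aniso_tensors M A r s) \<and>
     (\<forall>r s. \<forall>S\<in>aniso_tensors M A r s. \<forall>T\<in>aniso_tensors M A r s. \<forall>a b.
        \<D> (\<lambda>v. tadd (tscale a (S v)) (tscale b (T v)))
          = (\<lambda>v. tadd (tscale a (\<D> S v)) (tscale b (\<D> T v)))) \<and>
     (\<forall>r s r' s'. \<forall>S\<in>aniso_tensors M A r s. \<forall>T\<in>aniso_tensors M A r' s'.
        \<D> (\<lambda>v. tprod r s (S v) (T v))
          = (\<lambda>v. tadd (tprod r s (\<D> S v) (T v)) (tprod r s (S v) (\<D> T v)))) \<and>
     (\<forall>r s. \<forall>T\<in>aniso_tensors M A (Suc r) (Suc s). \<forall>a\<le>r. \<forall>b\<le>s.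
        \<D> (\<lambda>v. contract a b (T v)) = (\<lambda>v. contract a b (\<D> T v)))"

definition is_lie_bracket ::
    "('m, 'n::finite) chart set \<Rightarrow> ('m, 'n) tpoint set \<Rightarrow> (('m, 'n) tpoint \<Rightarrow> real)
      \<Rightarrow> (('m, 'n) tpoint \<Rightarrow> ('m, 'n) tensor)
      \<Rightarrow> ((('m, 'n) tpoint \<Rightarrow> ('m, 'n) tensor) \<Rightarrow> ('m, 'n) tpoint \<Rightarrow> ('m, 'n) tensor) \<Rightarrow> bool" where
  "is_lie_bracket M A L X \<D> \<longleftrightarrow> tensor_derivation M A \<D> \<and>
     (\<forall>f\<in>aniso_tensors M A 0 0. \<forall>c\<in>M. \<forall>v\<in>A \<inter> tdom M c.
        \<D> f v c [] [] = (\<Sum>k\<in>UNIV. X v c [k] [] *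
          \<delta> M L c k (\<lambda>z. f (tinv M c z) c [] []) (tcoord c v))) \<and>
     (\<forall>Y\<in>aniso_tensors M A 1 0. \<forall>c\<in>M. \<forall>v\<in>A \<inter> tdom M c. \<forall>i.
        \<D> Y v c [i] [] = (\<Sum>j\<in>UNIV.
          X v c [j] [] * \<delta> M L c j (\<lambda>z. Y (tinv M c z) c [i] []) (tcoord c v)
          - Y v c [j] [] * \<delta> M L c j (\<lambda>z. X (tinv M c z) c [i] []) (tcoord c v)))"

section \<open>Differential forms\<close>

definition form_on ::
    "('m, 'n::finite) chart set \<Rightarrow> nat \<Rightarrow> 'm set \<Rightarrow> ('m \<Rightarrow> ('m, 'n) tensor) \<Rightarrow> bool" where
  "form_on M s U \<eta> \<longleftrightarrow> tensor_field_on M 0 s U \<eta> \<and>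
     (\<forall>p\<in>U. \<forall>c js a b. length js = s \<and> a < b \<and> b < s \<longrightarrow>
        \<eta> p c [] (js[a := js ! b, b := js ! a]) = - \<eta> p c [] js)"

definition interior_product :: "('m, 'n::finite) tensor \<Rightarrow> ('m, 'n) tensor \<Rightarrow> ('m, 'n) tensor" where
  "interior_product \<xi> \<omega> = (\<lambda>c is js. \<Sum>i\<in>UNIV. \<xi> c [i] [] * \<omega> c is (i # js))"

definition ext_deriv ::
    "('m, 'n::finite) chart set \<Rightarrow> ('m \<Rightarrow> ('m, 'n) tensor) \<Rightarrow> 'm \<Rightarrow> ('m, 'n) tensor" where
  "ext_deriv M \<eta> p = (\<lambda>c is js.
     if c \<in> M \<and> p \<in> cdom c \<and> is = [] then
       (\<Sum>a<length js. (-1) ^ a * frechet_derivative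
          (\<lambda>x. \<eta> (cinv c x) c [] (take a js @ drop (Suc a) js)) (at (cmap c p)) (axis (js ! a) 1))
     else 0)"

text \<open>\<open>(dx\<^sup>1 \<and> \<dots> \<and> dx\<^sup>n)\<close> evaluated on the coordinate vectors with the indices \<open>js\<close>, \<open>length js = n\<close>: the
  determinant of the matrix with these coordinate vectors as columns. Here \<open>card {..<j}\<close> is the
  position of \<open>j\<close> in the linear order of the indices, counted from \<open>0\<close>.\<close>

definition coord_volume :: "'n::{finite,linorder} list \<Rightarrow> real" where
  "coord_volume js = det (\<chi> i j. if i = js ! card {..<j} then 1 else 0)"

text \<open>As \<open>M\<close> contains only positively oriented charts, the components of \<open>dVol\<close> in all of them have
  this form.\<close>

definition metric_volume ::
    "('m, 'n::{finite,linorder}) chart set \<Rightarrow> ('m, 'n) tpoint set \<Rightarrow> (('m, 'n) tpoint \<Rightarrow> real)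
      \<Rightarrow> ('m, 'n) tpoint \<Rightarrow> ('m, 'n) tensor" where
  "metric_volume M A L v = (\<lambda>c is js.
     if v \<in> A \<and> c \<in> M \<and> fst v \<in> cdom c \<and> is = [] \<and> length js = CARD('n)
     then sqrt \<bar>det (g_mat M L c (tcoord c v))\<bar> * coord_volume js else 0)"

section \<open>Submanifolds, smooth boundary points and integration\<close>

text \<open>The indices in increasing order: coordinates are numbered by their position in this list.\<close>

definition indices :: "'n::{finite,linorder} list" where
  "indices = sorted_list_of_set UNIV"

text \<open>\<open>c\<close> flattens the \<open>m\<close>-dimensional \<open>\<sigma>\<close> to the vanishing of the first \<open>n - m\<close> coordinates.\<close>

definition slice_chart ::
    "('m, 'n::{finite,linorder}) chart set \<Rightarrow> nat \<Rightarrow> 'm set \<Rightarrow> ('m, 'n) chart \<Rightarrow> bool" where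
  "slice_chart M m \<sigma> c \<longleftrightarrow> c \<in> M \<and>
     \<sigma> \<inter> cdom c = {q \<in> cdom c. \<forall>i\<in>set (take (CARD('n) - m) indices). cmap c q $ i = 0}"

definition embedded_submanifold ::
    "('m, 'n::{finite,linorder}) chart set \<Rightarrow> nat \<Rightarrow> 'm set \<Rightarrow> bool" where
  "embedded_submanifold M m \<sigma> \<longleftrightarrow> m \<le> CARD('n) \<and> (\<forall>p\<in>\<sigma>. \<exists>c. slice_chart M m \<sigma> c \<and> p \<in> cdom c)"

text \<open>The last \<open>m\<close> coordinates, the Lebesgue measure in them, and the inclusion of \<open>\<real>\<^sup>m\<close>.\<close>

definition last_indices :: "nat \<Rightarrow> 'n::{finite,linorder} set" where
  "last_indices m = set (drop (CARD('n) - m) (indices :: 'n list))"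

definition slice_measure :: "nat \<Rightarrow> ('n::{finite,linorder} \<Rightarrow> real) measure" where
  "slice_measure m = (\<Pi>\<^sub>M i\<in>last_indices m. lborel)"

definition slice_point :: "nat \<Rightarrow> ('n::{finite,linorder} \<Rightarrow> real) \<Rightarrow> (real, 'n) vec" where
  "slice_point m f = (\<chi> i. if i \<in> last_indices m then f i else 0)"

definition zero_dim_measure ::
    "('m, 'n::{finite,linorder}) chart set \<Rightarrow> nat \<Rightarrow> 'm set \<Rightarrow> bool" where
  "zero_dim_measure M m E \<longleftrightarrow>
     (\<forall>\<sigma> c. embedded_submanifold M m \<sigma> \<and> slice_chart M m \<sigma> c \<longrightarrow>
        {f \<in> space (slice_measure m). slice_point m f \<in> cmap c ` (E \<inter> \<sigma> \<inter> cdom c)}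
          \<in> null_sets (completion (slice_measure m)))"

definition smooth_boundary_part ::
    "('m::topological_space, 'n::{finite,linorder}) chart set \<Rightarrow> 'm set \<Rightarrow> 'm set" where
  "smooth_boundary_part M Dbar =
     {p \<in> frontier Dbar. \<exists>c. slice_chart M (CARD('n) - 1) (frontier Dbar) c \<and> p \<in> cdom c}"

text \<open>A positively oriented chart in which the domain is the half-space where the first coordinate is
  nonpositive. There the first coordinate vector points outwards, so the remaining ones, in order,
  are a positive basis for the orientation induced on the boundary.\<close>

definition boundary_chart ::
    "('m, 'n::{finite,linorder}) chart set \<Rightarrow> 'm set \<Rightarrow> ('m, 'n) chart \<Rightarrow> bool" where
  "boundary_chart M Dbar c \<longleftrightarrow> c \<in> M \<and>
     Dbar \<inter> cdom c = {q \<in> cdom c. cmap c q $ (hd indices) \<le> 0}"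

text \<open>Integrals of forms are computed, as Lebesgue integrals, over a countable Borel partition into
  pieces each contained in a chart; by the change of variables formula the value depends
  neither on the partition nor on the charts.\<close>

definition has_form_integral ::
    "('m::topological_space, 'n::{finite,linorder}) chart set \<Rightarrow> ('m \<Rightarrow> ('m, 'n) tensor) \<Rightarrow> 'm set
      \<Rightarrow> real \<Rightarrow> bool" where
  "has_form_integral M \<omega> S I \<longleftrightarrow> (\<exists>B :: nat \<Rightarrow> 'm set. \<exists>\<kappa> :: nat \<Rightarrow> ('m, 'n) chart.
     disjoint_family B \<and> (\<Union>k. B k) = S \<and>
     (\<forall>k. B k \<in> sets borel \<and> \<kappa> k \<in> M \<and> B k \<subseteq> cdom (\<kappa> k) \<and>
        set_integrable lborel (cmap (\<kappa> k) ` B k) (\<lambda>x. \<omega> (cinv (\<kappa> k) x) (\<kappa> k) [] indices)) \<and>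
     summable (\<lambda>k. LINT x:cmap (\<kappa> k) ` B k|lborel. \<bar>\<omega> (cinv (\<kappa> k) x) (\<kappa> k) [] indices\<bar>) \<and>
     (\<lambda>k. LINT x:cmap (\<kappa> k) ` B k|lborel. \<omega> (cinv (\<kappa> k) x) (\<kappa> k) [] indices) sums I)"

definition has_boundary_integral ::
    "('m::topological_space, 'n::{finite,linorder}) chart set \<Rightarrow> ('m \<Rightarrow> ('m, 'n) tensor) \<Rightarrow> 'm set
      \<Rightarrow> real \<Rightarrow> bool" where
  "has_boundary_integral M \<eta> Dbar I \<longleftrightarrow> (\<exists>B :: nat \<Rightarrow> 'm set. \<exists>\<kappa> :: nat \<Rightarrow> ('m, 'n) chart.
     let m = CARD('n) - 1;
         P = (\<lambda>k. {f \<in> space (slice_measure m). slice_point m f \<in> cmap (\<kappa> k) ` B k});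
         h = (\<lambda>k f. \<eta> (cinv (\<kappa> k) (slice_point m f)) (\<kappa> k) [] (tl indices))
     in disjoint_family B \<and> (\<Union>k. B k) = smooth_boundary_part M Dbar \<and>
        (\<forall>k. B k \<in> sets borel \<and> boundary_chart M Dbar (\<kappa> k) \<and> B k \<subseteq> cdom (\<kappa> k) \<and>
           set_integrable (slice_measure m) (P k) (h k)) \<and>
        summable (\<lambda>k. LINT f:P k|slice_measure m. \<bar>h k f\<bar>) \<and>
        (\<lambda>k. LINT f:P k|slice_measure m. h k f) sums I)"

definition is_domain :: "'m::topological_space set \<Rightarrow> bool" where
  "is_domain Dbar \<longleftrightarrow> Dbar \<noteq> {} \<and> connected Dbar \<and> Dbar = closure (interior Dbar)"

definition supp_on :: "'m::topological_space set \<Rightarrow> ('m \<Rightarrow> ('m, 'n) tensor) \<Rightarrow> 'm set" where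
  "supp_on U \<eta> = U \<inter> closure {p \<in> U. \<eta> p \<noteq> tzero}"

text \<open>\<open>\<integral>\<^sub>D d\<eta> = \<integral>\<^bsub>\<partial>D\<^esub> \<eta>\<close>, both integrals existing.\<close>

definition stokes_applicable ::
    "('m::topological_space, 'n::{finite,linorder}) chart set \<Rightarrow> 'm set \<Rightarrow> 'm set \<Rightarrow> bool" where
  "stokes_applicable M U Dbar \<longleftrightarrow>
     (\<forall>\<eta>. form_on M (CARD('n) - 1) U \<eta> \<and> compact (supp_on U \<eta> \<inter> Dbar) \<longrightarrow>
        (\<exists>I. has_form_integral M (ext_deriv M \<eta>) (interior Dbar) I \<and>
             has_boundary_integral M \<eta> Dbar I))"

end

theory Submission
  imports Defs
begin

text \<open>Write \<open>Z = T(X)\<close> and let \<open>\<eta> = \<iota>\<^bsub>Z\<^esub> dVol\<close> along \<open>V\<close>. In coordinates \<open>d\<eta>\<close> is the coordinate divergence of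
  \<open>\<surd>\<bar>det g\<bar> Z\<close> along the section \<open>V\<close>. Splitting the derivative along \<open>V\<close> into its horizontal part and the vertical part
  in the direction \<open>DV\<close>, and differentiating the determinant, this equals \<open>\<surd>\<bar>det g\<bar>\<close> times
  \<open>\<nabla>\<^sub>i Z\<^sup>i\<close> plus the expression in (iii). Moreover \<open>\<nabla>\<^sub>i Z\<^sup>i = div(T)\<^sub>j X\<^sup>j + T\<^sup>i\<^sub>j \<nabla>\<^sub>i X\<^sup>j\<close>, where the first
  term vanishes by (i) and the second is the contraction of a symmetric with an antisymmetric tensor by (ii): in the
  second case of (ii) the Chern connection is torsion-free and horizontally metric, so the vanishing of the bracket
  derivative of \<open>g\<close> is Killing's equation for \<open>X\<close>. Hence \<open>d\<eta> = 0\<close> and Stokes' theorem gives the claim.\<close>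

section \<open>Smooth functions\<close>

text \<open>The expression in (iii) comes from restricting to \<open>V\<close>: for a function F of
  (x,y), the derivative of F(x, V(x)) in \<open>x^i\<close> is \<open>\<delta>_i F\<close> plus
  \<open>(D_i V)^k\<close> times the k-th vertical derivative, both taken at \<open>V\<close>. For
  sqrt |det g| the 1/2 of the root matches the 1/2 in the Christoffel symbols and in the Cartan
  tensor: the horizontal part is the Christoffel trace, and the vertical part is the mean Cartan
  tensor because third vertical derivatives of \<open>L\<close> commute. The signature of g is
  arbitrary, so everything is done for |det g|. The delicate point is the bracket. It is given by
  axioms, with values prescribed on functions and vector fields only, and the axioms speak of fields
  defined on all of \<open>A\<close>. Its value on g is recovered by applying it to the function
  g(E_a, E_b), where E_a is a coordinate field times a bump function; hence bump functions,
  compatibility of components in all charts and tensoriality of g have to be established. The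
  derivatives of the bump function cancel in the comparison.\<close>

lemma frechet_derivative_cong_open:
  assumes "open S" "x \<in> S" "\<And>y. y \<in> S \<Longrightarrow> f y = g y" "f differentiable (at x)"
  shows "g differentiable (at x)" "frechet_derivative g (at x) = frechet_derivative f (at x)"
proof -
  have "(f has_derivative frechet_derivative f (at x)) (at x)"
    using assms(4) frechet_derivative_works by blast
  then have d: "(g has_derivative frechet_derivative f (at x)) (at x)"
    using has_derivative_transform_within_open[of f _ x UNIV S g] assms(1-3) by auto
  show "g differentiable (at x)" using d differentiableI by blast
  show "frechet_derivative g (at x) = frechet_derivative f (at x)"
    using frechet_derivative_at[OF d] by simp
qed

lemma C_on_cong:
  assumes "open S" "\<And>x. x \<in> S \<Longrightarrow> f x = g x" "C_on k S f"
  shows "C_on k S g"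
  using assms(2,3)
proof (induction k arbitrary: f g)
  case 0
  then show ?case by (simp cong: continuous_on_cong)
next
  case (Suc k)
  have "C_on k S (\<lambda>x. frechet_derivative g (at x) w)" for w
  proof (rule Suc.IH)
    show "C_on k S (\<lambda>x. frechet_derivative f (at x) w)" using Suc.prems by simp
    show "frechet_derivative f (at x) w = frechet_derivative g (at x) w" if "x \<in> S" for x
      using frechet_derivative_cong_open(2)[OF assms(1) that, of f g] Suc.prems that by simp
  qed
  moreover have "g differentiable (at x)" if "x \<in> S" for x
    using frechet_derivative_cong_open(1)[OF assms(1) that, of f g] Suc.prems that by simp
  ultimately show ?case by simp
qed

lemma C_on_SucD: "C_on (Suc k) S f \<Longrightarrow> C_on k S f"
proof (induction k arbitrary: f)
  case 0
  then show ?case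
    by (auto intro!: continuous_at_imp_continuous_on differentiable_imp_continuous_within)
qed simp

lemma C_on_subset: "C_on k S f \<Longrightarrow> T \<subseteq> S \<Longrightarrow> C_on k T f"
  by (induction k arbitrary: f) (auto intro: continuous_on_subset)

text \<open>Lets the cut-off fields be treated separately near the support of the bump function and
  away from it.\<close>

lemma C_on_local:
  assumes "\<And>x. x \<in> S \<Longrightarrow> \<exists>T. open T \<and> x \<in> T \<and> C_on k T f"
  shows "C_on k S f"
  using assms
proof (induction k arbitrary: f)
  case 0
  then show ?case
    by (auto intro!: continuous_at_imp_continuous_on) (meson continuous_on_eq_continuous_at)
next
  case (Suc k)
  have "f differentiable (at x)" if "x \<in> S" for x
    using Suc.prems[OF that] by auto
  moreover have "C_on k S (\<lambda>x. frechet_derivative f (at x) w)" for w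
  proof (rule Suc.IH)
    fix x assume "x \<in> S"
    then obtain T where "open T" "x \<in> T" "C_on (Suc k) T f" using Suc.prems by blast
    then show "\<exists>T. open T \<and> x \<in> T \<and> C_on k T (\<lambda>x. frechet_derivative f (at x) w)" by auto
  qed
  ultimately show ?case by simp
qed

text \<open>\<open>frechet_derivative\<close> is defined by choice; uniqueness of the derivative
  allows any explicit formula in its place on the open set. The closure properties below are
  inductions through this rule.\<close>

lemma C_on_SucI:
  assumes "open S" "\<And>x. x \<in> S \<Longrightarrow> (f has_derivative f' x) (at x)" "\<And>w. C_on k S (\<lambda>x. f' x w)"
  shows "C_on (Suc k) S f"
proof -
  have "C_on k S (\<lambda>x. frechet_derivative f (at x) w)" for w
    by (rule C_on_cong[OF assms(1) _ assms(3)[of w]]) (metis assms(2) frechet_derivative_at)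
  with assms(2) show ?thesis by (auto intro: differentiableI)
qed

lemma C_on_Suc_has_derivative:
  "C_on (Suc k) S f \<Longrightarrow> x \<in> S \<Longrightarrow> (f has_derivative frechet_derivative f (at x)) (at x)"
  by (auto simp: frechet_derivative_works)

lemma C_on_const: "C_on k S (\<lambda>x. c)"
  by (induction k arbitrary: c) auto

lemma C_on_bounded_linear_compose:
  assumes "bounded_linear h" "open S" "C_on k S f"
  shows "C_on k S (\<lambda>x. h (f x))"
  using assms(3)
proof (induction k arbitrary: f)
  case 0
  then show ?case using assms(1) bounded_linear.continuous_on by auto
next
  case (Suc k)
  show ?case
  proof (rule C_on_SucI[OF assms(2)])
    show "((\<lambda>x. h (f x)) has_derivative (\<lambda>w. h (frechet_derivative f (at x) w))) (at x)"
      if "x \<in> S" for x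
      by (rule bounded_linear.has_derivative[OF assms(1) C_on_Suc_has_derivative[OF Suc.prems that]])
    show "C_on k S (\<lambda>x. h (frechet_derivative f (at x) w))" for w
      using Suc by simp
  qed
qed

lemma C_on_ident: "open S \<Longrightarrow> C_on k S (\<lambda>x. x)"
  by (cases k) (auto simp: C_on_const)

lemma C_on_bounded_linear: "bounded_linear h \<Longrightarrow> open S \<Longrightarrow> C_on k S h"
  by (rule C_on_bounded_linear_compose[OF _ _ C_on_ident])

lemma C_on_add:
  assumes "open S" "C_on k S f" "C_on k S g"
  shows "C_on k S (\<lambda>x. f x + g x)"
  using assms(2,3)
proof (induction k arbitrary: f g)
  case 0
  then show ?case by (simp add: continuous_on_add)
next
  case (Suc k)
  show ?case
  proof (rule C_on_SucI[OF assms(1)])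
    show "((\<lambda>x. f x + g x) has_derivative
        (\<lambda>w. frechet_derivative f (at x) w + frechet_derivative g (at x) w)) (at x)" if "x \<in> S" for x
      using Suc.prems that by (intro has_derivative_add C_on_Suc_has_derivative) auto
    show "C_on k S (\<lambda>x. frechet_derivative f (at x) w + frechet_derivative g (at x) w)" for w
      using Suc by simp
  qed
qed

lemma C_on_sum:
  assumes "open S" "\<And>i. i \<in> I \<Longrightarrow> C_on k S (f i)"
  shows "C_on k S (\<lambda>x. \<Sum>i\<in>I. f i x)"
  using assms(2)
  by (induction I rule: infinite_finite_induct) (auto intro!: C_on_const C_on_add assms(1))

lemma C_on_scaleR:
  fixes f :: "'a::real_normed_vector \<Rightarrow> real" and g :: "'a \<Rightarrow> 'b::real_normed_vector"
  assumes "open S" "C_on k S f" "C_on k S g"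
  shows "C_on k S (\<lambda>x. f x *\<^sub>R g x)"
  using assms(2,3)
proof (induction k arbitrary: f g)
  case 0
  then show ?case by (simp add: continuous_on_scaleR)
next
  case (Suc k)
  show ?case
  proof (rule C_on_SucI[OF assms(1)])
    show "((\<lambda>x. f x *\<^sub>R g x) has_derivative
        (\<lambda>w. f x *\<^sub>R frechet_derivative g (at x) w + frechet_derivative f (at x) w *\<^sub>R g x)) (at x)"
      if "x \<in> S" for x
      using Suc.prems that by (intro has_derivative_scaleR C_on_Suc_has_derivative) auto
    \<comment> \<open>The product rule pairs each factor with the derivative of the other, so the
      undifferentiated factor first has to be lowered from order \<open>Suc k\<close> to
      \<open>k\<close>.\<close>
    show "C_on k S (\<lambda>x. f x *\<^sub>R frechet_derivative g (at x) w + frechet_derivative f (at x) w *\<^sub>R g x)" for w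
      using Suc.prems C_on_SucD[OF Suc.prems(1)] C_on_SucD[OF Suc.prems(2)]
      by (intro C_on_add[OF assms(1)] Suc.IH) auto
  qed
qed

lemma C_on_mult:
  fixes f g :: "'a::real_normed_vector \<Rightarrow> real"
  shows "open S \<Longrightarrow> C_on k S f \<Longrightarrow> C_on k S g \<Longrightarrow> C_on k S (\<lambda>x. f x * g x)"
  using C_on_scaleR[of S k f g] by simp

lemma C_on_prod:
  fixes f :: "'i \<Rightarrow> 'a::real_normed_vector \<Rightarrow> real"
  assumes "open S" "\<And>i. i \<in> I \<Longrightarrow> C_on k S (f i)"
  shows "C_on k S (\<lambda>x. \<Prod>i\<in>I. f i x)"
  using assms(2)
  by (induction I rule: infinite_finite_induct) (auto intro!: C_on_const C_on_mult assms(1))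

lemma C_on_det:
  fixes f :: "'a::real_normed_vector \<Rightarrow> real^'n^'n"
  assumes "open S" "\<And>i j. C_on k S (\<lambda>x. f x $ i $ j)"
  shows "C_on k S (\<lambda>x. det (f x))"
  unfolding det_def by (intro C_on_sum C_on_mult C_on_prod C_on_const assms)

text \<open>The derivative of \<open>f \<circ> g\<close> is expanded along a basis, since \<open>C_on\<close> only speaks of derivatives in
  fixed directions.\<close>

lemma C_on_compose:
  fixes g :: "'a::real_normed_vector \<Rightarrow> 'b::euclidean_space"
  assumes "open S" "open T" "\<And>x. x \<in> S \<Longrightarrow> g x \<in> T" "C_on k T f" "C_on k S g"
  shows "C_on k S (\<lambda>x. f (g x))"
  using assms(4,5)
proof (induction k arbitrary: f)
  case 0
  then show ?case using assms(3) by (auto intro: continuous_on_compose2)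
next
  case (Suc k)
  show ?case
  proof (rule C_on_SucI[OF assms(1)])
    fix x assume x: "x \<in> S"
    have f: "(f has_derivative frechet_derivative f (at (g x))) (at (g x))"
      using Suc.prems(1) assms(3) x by (intro C_on_Suc_has_derivative) auto
    have g: "(g has_derivative frechet_derivative g (at x)) (at x)"
      using Suc.prems(2) x by (intro C_on_Suc_has_derivative) auto
    have "((\<lambda>x. f (g x)) has_derivative (\<lambda>w. frechet_derivative f (at (g x)) (frechet_derivative g (at x) w))) (at x)"
      by (rule has_derivative_compose[OF g f])
    moreover have "frechet_derivative f (at (g x)) (frechet_derivative g (at x) w) =
        (\<Sum>b\<in>Basis. (frechet_derivative g (at x) w \<bullet> b) *\<^sub>R frechet_derivative f (at (g x)) b)" for w
    proof -
      have l: "linear (frechet_derivative f (at (g x)))"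
        using f has_derivative_linear by blast
      show ?thesis
        by (subst euclidean_representation[of "frechet_derivative g (at x) w", symmetric])
          (simp add: linear_sum[OF l] linear_scale[OF l] del: euclidean_representation)
    qed
    ultimately show "((\<lambda>x. f (g x)) has_derivative (\<lambda>w. \<Sum>b\<in>Basis.
        (frechet_derivative g (at x) w \<bullet> b) *\<^sub>R frechet_derivative f (at (g x)) b)) (at x)"
      by simp
  next
    show "C_on k S (\<lambda>x. \<Sum>b\<in>Basis. (frechet_derivative g (at x) w \<bullet> b) *\<^sub>R frechet_derivative f (at (g x)) b)" for w
      using Suc.prems C_on_SucD[OF Suc.prems(2)]
      by (intro C_on_sum C_on_scaleR assms(1)
          C_on_bounded_linear_compose[OF bounded_linear_inner_left] Suc.IH) auto
  qed
qed

lemma C_on_Pair: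
  assumes "open S" "C_on k S f" "C_on k S g"
  shows "C_on k S (\<lambda>x. (f x, g x))"
proof -
  have "C_on k S (\<lambda>x. (f x, 0) + (0, g x))"
    using assms by (intro C_on_add C_on_bounded_linear_compose[where h = "\<lambda>u. (u, 0)"]
        C_on_bounded_linear_compose[where h = "\<lambda>u. (0, u)"])
      (auto intro!: bounded_linear_Pair bounded_linear_ident bounded_linear_zero)
  then show ?thesis by simp
qed

lemma C_on_vec:
  fixes f :: "'a::real_normed_vector \<Rightarrow> real^'n"
  assumes "open S" "\<And>i. C_on k S (\<lambda>x. f x $ i)"
  shows "C_on k S f"
proof -
  have "C_on k S (\<lambda>x. \<Sum>i\<in>UNIV. f x $ i *\<^sub>R axis i (1::real))"
    by (intro C_on_sum C_on_scaleR C_on_const assms)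
  moreover have "(\<Sum>i\<in>UNIV. f x $ i *\<^sub>R axis i (1::real)) = f x" for x
    by (simp add: vec_eq_iff axis_def if_distrib sum.delta cong: if_cong)
  ultimately show ?thesis by simp
qed

text \<open>The induction runs over all exponents at once: differentiation lowers the exponent by
  one and multiplies by a constant.\<close>

lemma C_on_powr: "C_on k {0<..} (\<lambda>t::real. t powr a)"
proof (induction k arbitrary: a)
  case 0
  show ?case by (auto intro!: continuous_intros)
next
  case (Suc k)
  show ?case
  proof (rule C_on_SucI)
    show "((\<lambda>t. t powr a) has_derivative (\<lambda>w. (a * t powr (a - 1)) * w)) (at t)" if "t \<in> {0<..}" for t :: real
      using has_real_derivative_powr[of t a] that by (simp add: has_field_derivative_def)
    show "C_on k {0<..} (\<lambda>t. (a * t powr (a - 1)) * w)" for w :: real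
      by (intro C_on_mult C_on_const Suc) auto
  qed auto
qed

text \<open>As the fourth root of the square, sqrt |d| is a power of a positive number for either
  sign of \<open>d\<close>, so its smoothness can be shown uniformly in the signature of the
  metric.\<close>

lemma sqrt_abs_eq_powr: "sqrt \<bar>d\<bar> = (d * d) powr (1/4)" if "d \<noteq> 0" for d :: real
proof -
  have "(d * d) powr (1/4) = (\<bar>d\<bar> powr 2) powr (1/4)"
    by (simp add: power2_eq_square[symmetric])
  also have "\<dots> = \<bar>d\<bar> powr (1/2)" by (subst powr_powr) simp
  finally show ?thesis by (simp add: powr_half_sqrt)
qed

lemma C_on_sqrt_abs:
  fixes f :: "'a::real_normed_vector \<Rightarrow> real"
  assumes "open S" "C_on k S f" "\<And>x. x \<in> S \<Longrightarrow> f x \<noteq> 0"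
  shows "C_on k S (\<lambda>x. sqrt \<bar>f x\<bar>)"
proof (rule C_on_cong[OF assms(1)])
  show "C_on k S (\<lambda>x. (f x * f x) powr (1/4))"
    by (rule C_on_compose[OF assms(1) open_greaterThan _ C_on_powr C_on_mult[OF assms(1,2,2)]])
      (use assms(3) in \<open>auto simp: zero_less_mult_iff linorder_neq_iff\<close>)
  show "(f x * f x) powr (1/4) = sqrt \<bar>f x\<bar>" if "x \<in> S" for x
    using sqrt_abs_eq_powr[of "f x"] assms(3)[OF that] by simp
qed

lemma smooth_onD: "smooth_on S f \<Longrightarrow> C_on k S f"
  by (simp add: smooth_on_def)

lemma smooth_on_has_derivative:
  "smooth_on S f \<Longrightarrow> x \<in> S \<Longrightarrow> (f has_derivative frechet_derivative f (at x)) (at x)"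
  using C_on_Suc_has_derivative smooth_onD by blast

lemma smooth_on_frechet_derivative:
  "smooth_on S f \<Longrightarrow> smooth_on S (\<lambda>x. frechet_derivative f (at x) w)"
  unfolding smooth_on_def using C_on.simps(2) by blast

lemma smooth_on_cong:
  "open S \<Longrightarrow> smooth_on S f \<Longrightarrow> (\<And>x. x \<in> S \<Longrightarrow> f x = g x) \<Longrightarrow> smooth_on S g"
  unfolding smooth_on_def by (meson C_on_cong)

lemma smooth_on_subset: "smooth_on S f \<Longrightarrow> T \<subseteq> S \<Longrightarrow> smooth_on T f"
  unfolding smooth_on_def by (meson C_on_subset)

lemma smooth_on_local:
  "(\<And>x. x \<in> S \<Longrightarrow> \<exists>T. open T \<and> x \<in> T \<and> smooth_on T f) \<Longrightarrow> smooth_on S f"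
  unfolding smooth_on_def by (meson C_on_local)

lemma smooth_on_const: "smooth_on S (\<lambda>x. c)"
  by (simp add: smooth_on_def C_on_const)

lemma smooth_on_sum:
  "open S \<Longrightarrow> (\<And>i. i \<in> I \<Longrightarrow> smooth_on S (f i)) \<Longrightarrow> smooth_on S (\<lambda>x. \<Sum>i\<in>I. f i x)"
  by (simp add: smooth_on_def C_on_sum)

lemma smooth_on_mult:
  fixes f g :: "'a::real_normed_vector \<Rightarrow> real"
  shows "open S \<Longrightarrow> smooth_on S f \<Longrightarrow> smooth_on S g \<Longrightarrow> smooth_on S (\<lambda>x. f x * g x)"
  by (simp add: smooth_on_def C_on_mult)

lemma smooth_on_compose:
  fixes g :: "'a::real_normed_vector \<Rightarrow> 'b::euclidean_space"
  shows "open S \<Longrightarrow> open T \<Longrightarrow> (\<And>x. x \<in> S \<Longrightarrow> g x \<in> T) \<Longrightarrow> smooth_on T f \<Longrightarrow> smooth_on S g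
    \<Longrightarrow> smooth_on S (\<lambda>x. f (g x))"
  unfolding smooth_on_def using C_on_compose by blast

lemma smooth_on_bounded_linear_compose:
  "bounded_linear h \<Longrightarrow> open S \<Longrightarrow> smooth_on S f \<Longrightarrow> smooth_on S (\<lambda>x. h (f x))"
  unfolding smooth_on_def using C_on_bounded_linear_compose by blast

lemma smooth_on_bounded_linear: "bounded_linear h \<Longrightarrow> open S \<Longrightarrow> smooth_on S h"
  unfolding smooth_on_def using C_on_bounded_linear by blast

lemma smooth_on_Pair:
  "open S \<Longrightarrow> smooth_on S f \<Longrightarrow> smooth_on S g \<Longrightarrow> smooth_on S (\<lambda>x. (f x, g x))"
  by (simp add: smooth_on_def C_on_Pair)

lemma smooth_on_vec:
  fixes f :: "'a::real_normed_vector \<Rightarrow> real^'n"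
  shows "open S \<Longrightarrow> (\<And>i. smooth_on S (\<lambda>x. f x $ i)) \<Longrightarrow> smooth_on S f"
  by (simp add: smooth_on_def C_on_vec)

lemma smooth_on_sqrt_abs_det:
  fixes f :: "'a::real_normed_vector \<Rightarrow> real^'n^'n"
  assumes "open S" "\<And>i j. smooth_on S (\<lambda>x. f x $ i $ j)" "\<And>x. x \<in> S \<Longrightarrow> det (f x) \<noteq> 0"
  shows "smooth_on S (\<lambda>x. sqrt \<bar>det (f x)\<bar>)"
  unfolding smooth_on_def
  using assms by (intro allI C_on_sqrt_abs C_on_det) (auto simp: smooth_on_def)

subsection \<open>Symmetry of second derivatives\<close>

text \<open>Two applications of the mean value theorem express the quotient as the mixed derivative
  at an intermediate point of the parallelogram spanned by \<open>h *\<^sub>R u\<close> and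
  \<open>h *\<^sub>R v\<close>, and this derivative is continuous.\<close>

lemma second_difference_tendsto:
  fixes f :: "'a::real_normed_vector \<Rightarrow> real"
  assumes S: "open S" "x \<in> S" and f: "C_on 2 S f"
  shows "((\<lambda>h. (f (x + h *\<^sub>R u + h *\<^sub>R v) - f (x + h *\<^sub>R u) - f (x + h *\<^sub>R v) + f x) / h\<^sup>2)
    \<longlongrightarrow> frechet_derivative (\<lambda>y. frechet_derivative f (at y) u) (at x) v) (at_right 0)"
proof (rule tendstoI)
  define F where "F y = frechet_derivative f (at y) u" for y
  define G where "G y = frechet_derivative F (at y) v" for y
  fix e :: real assume e: "e > 0"
  have f1: "C_on 1 S F" and f2: "C_on 0 S G"
    using f by (simp_all add: numeral_2_eq_2 F_def[abs_def] G_def[abs_def])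
  have "continuous (at x) G"
    using f2 S by (simp add: continuous_on_eq_continuous_at)
  then obtain r where r: "r > 0" "\<And>y. dist y x < r \<Longrightarrow> dist (G y) (G x) < e"
    using tendstoD[OF _ e, of G "G x" "at x"] e by (auto simp: isCont_def eventually_at) (metis dist_self)
  obtain r' where r': "r' > 0" "ball x r' \<subseteq> S"
    using S open_contains_ball by blast
  \<comment> \<open>For \<open>s\<close> and \<open>t\<close> below \<open>q\<close> the point x + s
    u + t v stays in the ball inside \<open>S\<close> and in the ball on which \<open>G\<close> is
    within \<open>e\<close> of \<open>G x\<close>; the summand 1 keeps the denominator positive when
    u = v = 0.\<close>
  define q where "q = min r r' / (norm u + norm v + 1)"
  have q: "q > 0" using r r' by (simp add: q_def add_nonneg_pos)
  have near: "dist (x + s *\<^sub>R u + t *\<^sub>R v) x < min r r'" if "0 \<le> s" "s < q" "0 \<le> t" "t < q" for s t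
  proof -
    have "dist (x + s *\<^sub>R u + t *\<^sub>R v) x = norm (s *\<^sub>R u + t *\<^sub>R v)" by (simp add: dist_norm algebra_simps)
    also have "\<dots> \<le> s * norm u + t * norm v"
      using norm_triangle_ineq[of "s *\<^sub>R u" "t *\<^sub>R v"] that by simp
    also have "\<dots> \<le> q * norm u + q * norm v"
      using that by (intro add_mono mult_right_mono) auto
    also have "\<dots> < q * (norm u + norm v + 1)" using q by (simp add: algebra_simps)
    also have "\<dots> = min r r'"
      using add_nonneg_pos[of "norm u + norm v" 1] by (simp add: q_def)
    finally show ?thesis .
  qed
  have inS: "x + s *\<^sub>R u + t *\<^sub>R v \<in> S" if "0 \<le> s" "s < q" "0 \<le> t" "t < q" for s t
    using near[OF that] r' by (auto simp: dist_commute subset_iff)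
  have fd: "((\<lambda>s. f (x + s *\<^sub>R u + t *\<^sub>R v)) has_derivative (\<lambda>k. k * F (x + s *\<^sub>R u + t *\<^sub>R v))) (at s)"
    if "0 \<le> s" "s < q" "0 \<le> t" "t < q" for s t
  proof -
    have *: "(f has_derivative frechet_derivative f (at (x + s *\<^sub>R u + t *\<^sub>R v))) (at (x + s *\<^sub>R u + t *\<^sub>R v))"
      by (rule C_on_Suc_has_derivative[OF f[unfolded numeral_2_eq_2] inS[OF that]])
    moreover have "((\<lambda>s. x + s *\<^sub>R u + t *\<^sub>R v) has_derivative (\<lambda>k. k *\<^sub>R u)) (at s)"
      by (auto intro!: derivative_eq_intros)
    ultimately have "((\<lambda>s. f (x + s *\<^sub>R u + t *\<^sub>R v)) has_derivative
        (\<lambda>k. frechet_derivative f (at (x + s *\<^sub>R u + t *\<^sub>R v)) (k *\<^sub>R u))) (at s)"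
      using has_derivative_compose[where g = f] by blast
    then show ?thesis
      using linear_scale[OF has_derivative_linear[OF *]] by (simp add: F_def)
  qed
  have Fd: "((\<lambda>t. F (x + s *\<^sub>R u + t *\<^sub>R v)) has_derivative (\<lambda>k. k * G (x + s *\<^sub>R u + t *\<^sub>R v))) (at t)"
    if "0 \<le> s" "s < q" "0 \<le> t" "t < q" for s t
  proof -
    have *: "(F has_derivative frechet_derivative F (at (x + s *\<^sub>R u + t *\<^sub>R v))) (at (x + s *\<^sub>R u + t *\<^sub>R v))"
      by (rule C_on_Suc_has_derivative[OF f1[unfolded One_nat_def] inS[OF that]])
    moreover have "((\<lambda>t. x + s *\<^sub>R u + t *\<^sub>R v) has_derivative (\<lambda>k. k *\<^sub>R v)) (at t)"
      by (auto intro!: derivative_eq_intros)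
    ultimately have "((\<lambda>t. F (x + s *\<^sub>R u + t *\<^sub>R v)) has_derivative
        (\<lambda>k. frechet_derivative F (at (x + s *\<^sub>R u + t *\<^sub>R v)) (k *\<^sub>R v))) (at t)"
      using has_derivative_compose[where g = F] by blast
    then show ?thesis
      using linear_scale[OF has_derivative_linear[OF *]] by (simp add: G_def)
  qed
  have main: "dist ((f (x + h *\<^sub>R u + h *\<^sub>R v) - f (x + h *\<^sub>R u) - f (x + h *\<^sub>R v) + f x) / h\<^sup>2) (G x) < e"
    if h: "0 < h" "h < q" for h
  proof -
    \<comment> \<open>Mean value theorem in \<open>s\<close> for the increment in direction
      \<open>v\<close>. The terms with factor 0 are written out so that \<open>fd\<close> applies
      both with t = h and with t = 0.\<close>
    have "\<exists>s\<in>{0<..<h}. (f (x + h *\<^sub>R u + h *\<^sub>R v) - f (x + h *\<^sub>R u + 0 *\<^sub>R v))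
        - (f (x + 0 *\<^sub>R u + h *\<^sub>R v) - f (x + 0 *\<^sub>R u + 0 *\<^sub>R v))
        = (h - 0) * F (x + s *\<^sub>R u + h *\<^sub>R v) - (h - 0) * F (x + s *\<^sub>R u + 0 *\<^sub>R v)"
      using h by (intro mvt_simple[where f = "\<lambda>s. f (x + s *\<^sub>R u + h *\<^sub>R v) - f (x + s *\<^sub>R u + 0 *\<^sub>R v)"]
          has_derivative_diff has_derivative_at_withinI[OF fd]) auto
    then obtain s where s: "0 < s" "s < h"
      "f (x + h *\<^sub>R u + h *\<^sub>R v) - f (x + h *\<^sub>R u) - f (x + h *\<^sub>R v) + f x
        = h * (F (x + s *\<^sub>R u + h *\<^sub>R v) - F (x + s *\<^sub>R u + 0 *\<^sub>R v))"
      by (auto simp: algebra_simps)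
    have "\<exists>t\<in>{0<..<h}. F (x + s *\<^sub>R u + h *\<^sub>R v) - F (x + s *\<^sub>R u + 0 *\<^sub>R v)
        = (h - 0) * G (x + s *\<^sub>R u + t *\<^sub>R v)"
      using h s by (intro mvt_simple[where f = "\<lambda>t. F (x + s *\<^sub>R u + t *\<^sub>R v)"]
          has_derivative_at_withinI[OF Fd]) auto
    then obtain t where t: "0 < t" "t < h"
      "F (x + s *\<^sub>R u + h *\<^sub>R v) - F (x + s *\<^sub>R u + 0 *\<^sub>R v) = h * G (x + s *\<^sub>R u + t *\<^sub>R v)"
      by auto
    have "(f (x + h *\<^sub>R u + h *\<^sub>R v) - f (x + h *\<^sub>R u) - f (x + h *\<^sub>R v) + f x) / h\<^sup>2
        = G (x + s *\<^sub>R u + t *\<^sub>R v)"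
      using s(3) t(3) h by (simp add: power2_eq_square)
    moreover have "dist (x + s *\<^sub>R u + t *\<^sub>R v) x < r"
      using near[of s t] s t h by simp
    ultimately show ?thesis using r(2) by simp
  qed
  have "\<forall>\<^sub>F h in at_right 0. h < q \<and> 0 < h"
    using q by (auto simp: eventually_at_right_field)
  then show "\<forall>\<^sub>F h in at_right 0. dist ((f (x + h *\<^sub>R u + h *\<^sub>R v) - f (x + h *\<^sub>R u) - f (x + h *\<^sub>R v) + f x) / h\<^sup>2)
      (frechet_derivative (\<lambda>y. frechet_derivative f (at y) u) (at x) v) < e"
    by (rule eventually_mono) (use main in \<open>auto simp: G_def F_def[abs_def]\<close>)
qed

text \<open>The second difference quotient does not change when \<open>u\<close> and
  \<open>v\<close> are exchanged, and its limit is unique.\<close>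

lemma second_derivative_symmetric:
  fixes f :: "'a::real_normed_vector \<Rightarrow> real"
  assumes "open S" "x \<in> S" "C_on 2 S f"
  shows "frechet_derivative (\<lambda>y. frechet_derivative f (at y) u) (at x) v
    = frechet_derivative (\<lambda>y. frechet_derivative f (at y) v) (at x) u"
proof -
  have eq: "(\<lambda>h. (f (x + h *\<^sub>R u + h *\<^sub>R v) - f (x + h *\<^sub>R u) - f (x + h *\<^sub>R v) + f x) / h\<^sup>2)
    = (\<lambda>h. (f (x + h *\<^sub>R v + h *\<^sub>R u) - f (x + h *\<^sub>R v) - f (x + h *\<^sub>R u) + f x) / h\<^sup>2)"
    by (simp add: algebra_simps)
  show ?thesis
    by (rule tendsto_unique[OF trivial_limit_at_right_real second_difference_tendsto[OF assms]])
      (subst eq, rule second_difference_tendsto[OF assms])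
qed

subsection \<open>A smooth bump function\<close>

text \<open>\<open>flat n t = t\<^sup>-\<^sup>n exp (-1/t)\<close> for \<open>t > 0\<close>: the family is closed under differentiation up to linear
  combinations, and every member vanishes at \<open>0\<close> to first order.\<close>

definition flat :: "nat \<Rightarrow> real \<Rightarrow> real" where
  "flat n t = (if t \<le> 0 then 0 else (1 / t) ^ n * exp (- 1 / t))"

text \<open>On the right, substituting 1/t for t turns this into the decay of
  \<open>t ^ n / exp t\<close> at infinity.\<close>

lemma flat_tendsto_0: "(flat n \<longlongrightarrow> 0) (at 0)"
proof (rule filterlim_split_at)
  show "(flat n \<longlongrightarrow> 0) (at_left 0)"
    by (rule tendsto_eventually) (auto simp: flat_def eventually_at_filter)
  have "((\<lambda>t::real. t ^ n / exp t) \<longlongrightarrow> 0) at_top" using tendsto_power_div_exp_0 .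
  then have "((\<lambda>t. (inverse t) ^ n / exp (inverse t)) \<longlongrightarrow> (0::real)) (at_right 0)"
    using filterlim_compose filterlim_inverse_at_top_right by blast
  then show "(flat n \<longlongrightarrow> 0) (at_right 0)"
    by (rule Lim_transform_eventually)
      (auto simp: flat_def eventually_at_filter inverse_eq_divide exp_minus field_simps)
qed

lemma flat_has_derivative:
  "(flat n has_real_derivative flat (n + 2) t - n * flat (n + 1) t) (at t)"
proof -
  consider "t < 0" | "t = 0" | "t > 0" by linarith
  then show ?thesis
  proof cases
    case 1
    have "((\<lambda>t. 0) has_real_derivative 0) (at t)" by simp
    then have "(flat n has_real_derivative 0) (at t)"
      by (rule has_field_derivative_transform_within_open[where S = "{..<0}"]) (use 1 in \<open>auto simp: flat_def\<close>)
    then show ?thesis using 1 by (simp add: flat_def)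
  next
    case 2
    \<comment> \<open>At the origin the difference quotient of \<open>flat n\<close> is
      \<open>flat (Suc n)\<close>, which tends to 0.\<close>
    have "((\<lambda>h. flat n h / h) \<longlongrightarrow> 0) (at 0)"
      using flat_tendsto_0[of "Suc n"]
      by (rule Lim_transform_eventually) (auto simp: flat_def eventually_at_filter field_simps)
    then show ?thesis using 2 by (simp add: DERIV_def flat_def)
  next
    case 3
    have "((\<lambda>t. (1 / t) ^ n) has_real_derivative of_nat n * ((- 1 / t\<^sup>2) * (1 / t) ^ (n - Suc 0))) (at t)"
      using 3 by (intro DERIV_power) (auto intro!: derivative_eq_intros simp: power2_eq_square)
    moreover have "of_nat n * ((- 1 / t\<^sup>2) * (1 / t) ^ (n - Suc 0)) = - of_nat n * (1 / t) ^ (n + 1)"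
      by (cases n) (simp_all add: power2_eq_square divide_inverse algebra_simps)
    moreover have "((\<lambda>t. exp (- 1 / t)) has_real_derivative exp (- 1 / t) * (1 / t)\<^sup>2) (at t)"
      using 3 by (auto intro!: derivative_eq_intros simp: power2_eq_square)
    ultimately have "((\<lambda>t. (1 / t) ^ n * exp (- 1 / t)) has_real_derivative
        (1 / t) ^ n * (exp (- 1 / t) * (1 / t)\<^sup>2) + (- of_nat n * (1 / t) ^ (n + 1)) * exp (- 1 / t)) (at t)"
      by (intro DERIV_mult') simp_all
    moreover have "(1 / t) ^ n * (exp (- 1 / t) * (1 / t)\<^sup>2) + (- of_nat n * (1 / t) ^ (n + 1)) * exp (- 1 / t)
        = flat (n + 2) t - n * flat (n + 1) t"
      using 3 by (simp add: flat_def power_add power2_eq_square mult_ac)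
    ultimately have "((\<lambda>t. (1 / t) ^ n * exp (- 1 / t)) has_real_derivative flat (n + 2) t - n * flat (n + 1) t) (at t)"
      by simp
    then show ?thesis
      by (rule has_field_derivative_transform_within_open[where S = "{0<..}"]) (use 3 in \<open>auto simp: flat_def\<close>)
  qed
qed

lemma C_on_flat: "C_on k UNIV (flat n)"
proof (induction k arbitrary: n)
  case 0
  show ?case
    using flat_has_derivative by (auto intro!: continuous_at_imp_continuous_on DERIV_isCont)
next
  case (Suc k)
  show ?case
  proof (rule C_on_SucI)
    show "(flat n has_derivative (\<lambda>w. (flat (n + 2) t + (- n) * flat (n + 1) t) * w)) (at t)" for t
      using flat_has_derivative[of n t] by (simp add: has_field_derivative_def)
    show "C_on k UNIV (\<lambda>t. (flat (n + 2) t + (- n) * flat (n + 1) t) * w)" for w :: real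
      by (intro C_on_mult C_on_add C_on_const Suc) auto
  qed auto
qed

lemma smooth_bump:
  fixes a :: "real^'n"
  assumes "r > 0"
  obtains f :: "real^'n \<Rightarrow> real" where "smooth_on UNIV f" "f a \<noteq> 0" "\<And>x. x \<notin> cball a r \<Longrightarrow> f x = 0"
proof
  \<comment> \<open>The argument of \<open>flat 0\<close> is r^2 - |x - a|^2, positive exactly in
    the open ball of radius \<open>r\<close>; it is spelled out in sums and products of coordinates,
    the operations covered by the closure rules.\<close>
  let ?f = "\<lambda>x::real^'n. flat 0 (r\<^sup>2 + (- 1) * (\<Sum>i\<in>UNIV. (x $ i + (- a $ i)) * (x $ i + (- a $ i))))"
  have sq: "(\<Sum>i\<in>UNIV. (x $ i + (- a $ i)) * (x $ i + (- a $ i))) = (dist a x)\<^sup>2" for x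
  proof -
    have "(dist a x)\<^sup>2 = (\<Sum>i\<in>UNIV. (a $ i - x $ i)\<^sup>2)"
      by (simp add: dist_norm norm_vec_def L2_set_def real_sqrt_pow2 sum_nonneg)
    also have "\<dots> = (\<Sum>i\<in>UNIV. (x $ i + (- a $ i)) * (x $ i + (- a $ i)))"
      by (rule sum.cong) (simp_all add: power2_eq_square algebra_simps)
    finally show ?thesis by simp
  qed
  have nth: "C_on k UNIV (\<lambda>x::real^'n. x $ i + (- a $ i))" for k i
    by (rule C_on_add[OF open_UNIV C_on_bounded_linear[OF bounded_linear_vec_nth open_UNIV] C_on_const])
  have "C_on k UNIV (\<lambda>x. r\<^sup>2 + (- 1) * (\<Sum>i\<in>UNIV. (x $ i + (- a $ i)) * (x $ i + (- a $ i))))" for k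
    by (rule C_on_add[OF open_UNIV C_on_const C_on_mult[OF open_UNIV C_on_const
          C_on_sum[OF open_UNIV C_on_mult[OF open_UNIV nth nth]]]])
  then have "C_on k UNIV ?f" for k
    by (rule C_on_compose[OF open_UNIV open_UNIV UNIV_I C_on_flat])
  then show "smooth_on UNIV ?f" by (simp add: smooth_on_def)
  show "?f a \<noteq> 0" using assms by (simp add: flat_def)
  show "?f x = 0" if "x \<notin> cball a r" for x
    unfolding sq using that assms by (simp add: flat_def abs_le_square_iff[symmetric])
qed

subsection \<open>The derivative of the determinant\<close>

lemma matrix_inv:
  fixes A :: "real^'n^'n"
  assumes "det A \<noteq> 0"
  shows "matrix_inv A ** A = mat 1" "A ** matrix_inv A = mat 1"
proof -
  have "\<exists>B. A ** B = mat 1 \<and> B ** A = mat 1"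
    using assms by (simp add: invertible_det_nz[symmetric] invertible_def)
  then have "A ** matrix_inv A = mat 1 \<and> matrix_inv A ** A = mat 1"
    unfolding matrix_inv_def by (rule someI_ex)
  then show "matrix_inv A ** A = mat 1" "A ** matrix_inv A = mat 1" by auto
qed

text \<open>Cramer's rule for rows: \<open>b\<close> is the combination of the rows of
  \<open>A\<close> with coefficients \<open>b v* matrix_inv A\<close>, and only the coefficient at
  row \<open>i\<close> survives in the determinant.\<close>

lemma det_replace_row:
  fixes A :: "real^'n^'n"
  assumes "det A \<noteq> 0"
  shows "det (\<chi> r. if r = i then b else A $ r) = (\<Sum>j\<in>UNIV. b $ j * matrix_inv A $ j $ i) * det A"
proof -
  define y where "y = b v* matrix_inv A"
  have "y v* A = b"
    by (simp add: y_def vector_matrix_mul_assoc matrix_inv(1)[OF assms])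
  then have "(\<Sum>k\<in>UNIV. y $ k *s row k A) = b"
    by (simp add: vec_eq_iff vector_matrix_mult_def row_def mult.commute)
  then have "det (\<chi> r. if r = i then b else A $ r) = y $ i * det A"
    using cramer_lemma_transpose[of i y A] by (simp add: row_def vec_nth_inverse cong: if_cong)
  then show ?thesis by (simp add: y_def vector_matrix_mult_def mult.commute)
qed

text \<open>Jacobi's formula. The product rule on the permutation sum gives determinants in which
  one row is replaced by its derivative, and Cramer's rule evaluates each of them.\<close>

lemma has_derivative_det:
  fixes G :: "'a::real_normed_vector \<Rightarrow> real^'n^'n"
  assumes "\<And>i j. ((\<lambda>x. G x $ i $ j) has_derivative G' i j) (at a)" "det (G a) \<noteq> 0"
  shows "((\<lambda>x. det (G x)) has_derivative
    (\<lambda>w. det (G a) * (\<Sum>i\<in>UNIV. \<Sum>j\<in>UNIV. matrix_inv (G a) $ j $ i * G' i j w))) (at a)"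
proof -
  have "((\<lambda>x. det (G x)) has_derivative (\<lambda>w. \<Sum>p | p permutes UNIV. of_int (sign p) *
      (\<Sum>i\<in>UNIV. G' i (p i) w * (\<Prod>j\<in>UNIV - {i}. G a $ j $ p j)))) (at a)"
    unfolding det_def
    by (intro has_derivative_sum has_derivative_mult_right has_derivative_prod assms)
  moreover have "(\<Sum>p | p permutes UNIV. of_int (sign p) *
      (\<Sum>i\<in>UNIV. G' i (p i) w * (\<Prod>j\<in>UNIV - {i}. G a $ j $ p j)))
    = det (G a) * (\<Sum>i\<in>UNIV. \<Sum>j\<in>UNIV. matrix_inv (G a) $ j $ i * G' i j w)" (is "?l = ?r") for w
  proof -
    have "?l = (\<Sum>i\<in>UNIV. det (\<chi> r. if r = i then (\<chi> j. G' i j w) else G a $ r))"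
    proof -
      have "(\<Prod>j\<in>UNIV. (if j = i then (\<chi> j. G' i j w) else G a $ j) $ p j)
          = G' i (p i) w * (\<Prod>j\<in>UNIV - {i}. G a $ j $ p j)" for i p
        by (subst prod.remove[of _ i]) (auto intro!: prod.cong)
      then show ?thesis
        unfolding det_def sum_distrib_left by (subst sum.swap) (simp add: sum_distrib_left)
    qed
    also have "\<dots> = ?r"
      by (simp add: det_replace_row[OF assms(2)] sum_distrib_left mult_ac)
    finally show ?thesis .
  qed
  ultimately show ?thesis by simp
qed

text \<open>The derivative sgn(d) / (2 sqrt |d|) of the root meets the factor d of Jacobi's formula;
  since d sgn(d) = |d|, the factor sqrt |d| / 2 remains.\<close>

lemma has_derivative_sqrt_abs_det:
  fixes G :: "'a::real_normed_vector \<Rightarrow> real^'n^'n"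
  assumes "\<And>i j. ((\<lambda>x. G x $ i $ j) has_derivative G' i j) (at a)" "det (G a) \<noteq> 0"
  shows "((\<lambda>x. sqrt \<bar>det (G x)\<bar>) has_derivative
    (\<lambda>w. sqrt \<bar>det (G a)\<bar> * (1/2 * (\<Sum>i\<in>UNIV. \<Sum>j\<in>UNIV. matrix_inv (G a) $ j $ i * G' i j w)))) (at a)"
proof -
  have "((\<lambda>t. sqrt \<bar>t\<bar>) has_real_derivative sgn (det (G a)) * (inverse (sqrt \<bar>det (G a)\<bar>) / 2)) (at (det (G a)))"
  proof (cases "det (G a) > 0")
    case True
    have "(sqrt has_real_derivative inverse (sqrt (det (G a))) / 2) (at (det (G a)))"
      using DERIV_real_sqrt[OF True] .
    then have "((\<lambda>t. sqrt \<bar>t\<bar>) has_real_derivative inverse (sqrt (det (G a))) / 2) (at (det (G a)))"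
      by (rule has_field_derivative_transform_within_open[where S = "{0<..}"]) (use True in auto)
    then show ?thesis using True by simp
  next
    case False
    then have "((\<lambda>t. sqrt (- t)) has_real_derivative - (inverse (sqrt (- det (G a))) / 2)) (at (det (G a)))"
      using assms(2) by (auto intro!: derivative_eq_intros)
    then have "((\<lambda>t. sqrt \<bar>t\<bar>) has_real_derivative - (inverse (sqrt (- det (G a))) / 2)) (at (det (G a)))"
      by (rule has_field_derivative_transform_within_open[where S = "{..<0}"]) (use False assms(2) in auto)
    then show ?thesis using False assms(2) by simp
  qed
  then have "((\<lambda>x. sqrt \<bar>det (G x)\<bar>) has_derivative (\<lambda>w. sgn (det (G a)) * (inverse (sqrt \<bar>det (G a)\<bar>) / 2) *
     (det (G a) * (\<Sum>i\<in>UNIV. \<Sum>j\<in>UNIV. matrix_inv (G a) $ j $ i * G' i j w)))) (at a)"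
    unfolding has_field_derivative_def by (rule has_derivative_compose[OF has_derivative_det[OF assms]])
  moreover have eq: "sgn d * (inverse (sqrt \<bar>d\<bar>) / 2) * (d * s) = sqrt \<bar>d\<bar> * (1/2 * s)" if "d \<noteq> 0" for d s :: real
  proof -
    have "d * sgn d * inverse (sqrt \<bar>d\<bar>) = sqrt \<bar>d\<bar>"
      using that by (metis abs_ge_zero abs_sgn divide_inverse real_div_sqrt)
    then have "(d * sgn d * inverse (sqrt \<bar>d\<bar>)) * (1/2 * s) = sqrt \<bar>d\<bar> * (1/2 * s)"
      by (rule arg_cong)
    then show ?thesis by (simp add: mult_ac)
  qed
  ultimately show ?thesis by (simp only: eq[OF assms(2)])
qed

section \<open>Charts and Jacobians\<close>

lemma is_chartD:
  assumes "is_chart c"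
  shows "open (cdom c)" "open (crange c)" "continuous_on (cdom c) (cmap c)" "continuous_on (crange c) (cinv c)"
    and "\<And>p. p \<in> cdom c \<Longrightarrow> cmap c p \<in> crange c" "\<And>p. p \<in> cdom c \<Longrightarrow> cinv c (cmap c p) = p"
    and "\<And>x. x \<in> crange c \<Longrightarrow> cinv c x \<in> cdom c" "\<And>x. x \<in> crange c \<Longrightarrow> cmap c (cinv c x) = x"
  using assms by (auto simp: is_chart_def homeomorphism_def)

lemma cmap_image_eq:
  assumes "is_chart c"
  shows "cmap c ` (W \<inter> cdom c) = {x \<in> crange c. cinv c x \<in> W}"
  using is_chartD(5-8)[OF assms] by (force simp: crange_def)

lemma open_cmap_image:
  assumes "is_chart c" "open W"
  shows "open (cmap c ` (W \<inter> cdom c))"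
proof -
  have "open (crange c \<inter> cinv c -` W)"
    using is_chartD(2,4)[OF assms(1)] assms(2) by (simp add: continuous_on_open_vimage Int_commute)
  then show ?thesis unfolding cmap_image_eq[OF assms(1)] by (simp add: vimage_def Int_def)
qed

context
  fixes M :: "('m::{t2_space,second_countable_topology}, 'n::finite) chart set"
  assumes M: "oriented_smooth_structure M"
begin

lemma chart: "c \<in> M \<Longrightarrow> is_chart c"
  using M unfolding oriented_smooth_structure_def by blast

lemma open_overlap: "c \<in> M \<Longrightarrow> d \<in> M \<Longrightarrow> open (cmap c ` (cdom c \<inter> cdom d))"
  using open_cmap_image[OF chart is_chartD(1)[OF chart], of c d] by (simp add: Int_commute)

lemma transition_smooth: "c \<in> M \<Longrightarrow> d \<in> M \<Longrightarrow> smooth_on (cmap c ` (cdom c \<inter> cdom d)) (cmap d \<circ> cinv c)"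
  using M unfolding oriented_smooth_structure_def oriented_compatible_def by blast

lemma det_jac_pos: "c \<in> M \<Longrightarrow> d \<in> M \<Longrightarrow> p \<in> cdom c \<Longrightarrow> p \<in> cdom d \<Longrightarrow> det (\<chi> i k. jac c d p i k) > 0"
  using M unfolding oriented_smooth_structure_def oriented_compatible_def by blast

lemma transition_has_derivative:
  assumes "c \<in> M" "d \<in> M" "p \<in> cdom c" "p \<in> cdom d"
  shows "((cmap d \<circ> cinv c) has_derivative (\<lambda>w. \<chi> i. \<Sum>k\<in>UNIV. jac c d p i k * w $ k)) (at (cmap c p))"
proof -
  let ?D = "frechet_derivative (cmap d \<circ> cinv c) (at (cmap c p))"
  have d: "((cmap d \<circ> cinv c) has_derivative ?D) (at (cmap c p))"
    using smooth_on_has_derivative[OF transition_smooth[OF assms(1,2)]] assms(3,4) by auto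
  have l: "linear ?D" using has_derivative_linear[OF d] .
  have "?D w = (\<chi> i. \<Sum>k\<in>UNIV. jac c d p i k * w $ k)" for w
  proof -
    have "?D w = ?D (\<Sum>k\<in>UNIV. w $ k *\<^sub>R axis k 1)"
      using basis_expansion[of w] by (simp add: scalar_mult_eq_scaleR)
    also have "\<dots> = (\<Sum>k\<in>UNIV. w $ k *\<^sub>R ?D (axis k 1))"
      by (simp add: linear_sum[OF l] linear_scale[OF l])
    finally show ?thesis by (simp add: vec_eq_iff jac_def mult.commute)
  qed
  then have "?D = (\<lambda>w. \<chi> i. \<Sum>k\<in>UNIV. jac c d p i k * w $ k)" by blast
  with d show ?thesis by simp
qed

lemma jac_eqI:
  assumes "((cmap d \<circ> cinv c) has_derivative D) (at (cmap c p))"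
  shows "jac c d p i k = D (axis k 1) $ i"
  using frechet_derivative_at[OF assms] by (simp add: jac_def)

lemma jac_self:
  assumes "c \<in> M" "p \<in> cdom c"
  shows "jac c c p i k = (if i = k then 1 else 0)"
proof -
  note c = is_chartD[OF chart[OF assms(1)]]
  have "((cmap c \<circ> cinv c) has_derivative (\<lambda>w. w)) (at (cmap c p))"
    by (rule has_derivative_transform_within_open[OF has_derivative_ident c(2) c(5)[OF assms(2)]])
      (simp add: c)
  from jac_eqI[OF this] show ?thesis by (simp add: axis_def)
qed

lemma jac_chain:
  assumes "c \<in> M" "d \<in> M" "e \<in> M" "p \<in> cdom c" "p \<in> cdom d" "p \<in> cdom e"
  shows "(\<Sum>j\<in>UNIV. jac d e p i j * jac c d p j k) = jac c e p i k"
proof -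
  note c = is_chartD[OF chart[OF assms(1)]] and d = is_chartD[OF chart[OF assms(2)]]
  have "((cmap d \<circ> cinv c) has_derivative (\<lambda>w. \<chi> i. \<Sum>k\<in>UNIV. jac c d p i k * w $ k)) (at (cmap c p))"
    by (rule transition_has_derivative) (use assms in auto)
  moreover have "(cmap d \<circ> cinv c) (cmap c p) = cmap d p" using assms c by simp
  then have "((cmap e \<circ> cinv d) has_derivative (\<lambda>w. \<chi> i. \<Sum>k\<in>UNIV. jac d e p i k * w $ k))
      (at ((cmap d \<circ> cinv c) (cmap c p)))"
    using transition_has_derivative[of d e p] assms by simp
  ultimately have "((\<lambda>x. (cmap e \<circ> cinv d) ((cmap d \<circ> cinv c) x)) has_derivative
      (\<lambda>w. \<chi> i. \<Sum>j\<in>UNIV. jac d e p i j * (\<chi> i. \<Sum>k\<in>UNIV. jac c d p i k * w $ k) $ j)) (at (cmap c p))"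
    by (rule has_derivative_compose)
  then have "((cmap e \<circ> cinv c) has_derivative
      (\<lambda>w. \<chi> i. \<Sum>j\<in>UNIV. jac d e p i j * (\<chi> i. \<Sum>k\<in>UNIV. jac c d p i k * w $ k) $ j)) (at (cmap c p))"
    by (rule has_derivative_transform_within_open[OF _ open_overlap[of c d]])
      (use assms c d in \<open>auto\<close>)
  from jac_eqI[OF this] show ?thesis by (simp add: axis_def if_distrib cong: if_cong)
qed

lemma jac_inverse:
  assumes "c \<in> M" "d \<in> M" "p \<in> cdom c" "p \<in> cdom d"
  shows "(\<Sum>j\<in>UNIV. jac d c p i j * jac c d p j k) = (if i = k then 1 else 0)"
  using jac_chain[OF assms(1,2,1) assms(3,4,3)] jac_self[OF assms(1,3)] by simp

lemma jac_smooth_source: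
  assumes "c \<in> M" "d \<in> M"
  shows "smooth_on (cmap c ` (cdom c \<inter> cdom d)) (\<lambda>x. jac c d (cinv c x) i k)"
proof (rule smooth_on_cong[OF open_overlap[OF assms]])
  show "smooth_on (cmap c ` (cdom c \<inter> cdom d)) (\<lambda>x. frechet_derivative (cmap d \<circ> cinv c) (at x) (axis k 1) $ i)"
    by (rule smooth_on_bounded_linear_compose[OF bounded_linear_vec_nth open_overlap[OF assms]
          smooth_on_frechet_derivative[OF transition_smooth[OF assms]]])
qed (use is_chartD[OF chart[OF assms(1)]] in \<open>auto simp: jac_def\<close>)

lemma smooth_on_change_chart:
  fixes f :: "'m \<Rightarrow> real"
  assumes "c \<in> M" "d \<in> M" "smooth_on (cmap c ` (cdom c \<inter> cdom d)) (\<lambda>x. f (cinv c x))"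
  shows "smooth_on (cmap d ` (cdom c \<inter> cdom d)) (\<lambda>x. f (cinv d x))"
proof (rule smooth_on_cong)
  note c = is_chartD[OF chart[OF assms(1)]] and d = is_chartD[OF chart[OF assms(2)]]
  have o: "open (cmap d ` (cdom c \<inter> cdom d))"
    using open_overlap[OF assms(2,1)] by (simp add: Int_commute)
  show "open (cmap d ` (cdom c \<inter> cdom d))" by (rule o)
  show "smooth_on (cmap d ` (cdom c \<inter> cdom d)) (\<lambda>x. f (cinv c ((cmap c \<circ> cinv d) x)))"
  proof (rule smooth_on_compose[OF o open_overlap[OF assms(1,2)] _ assms(3)])
    show "smooth_on (cmap d ` (cdom c \<inter> cdom d)) (cmap c \<circ> cinv d)"
      using transition_smooth[OF assms(2,1)] by (simp add: Int_commute)
  qed (use d in auto)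
qed (use is_chartD[OF chart[OF assms(1)]] is_chartD[OF chart[OF assms(2)]] in auto)

lemma jac_smooth_target:
  assumes "c \<in> M" "d \<in> M"
  shows "smooth_on (cmap d ` (cdom c \<inter> cdom d)) (\<lambda>x. jac c d (cinv d x) i k)"
  using smooth_on_change_chart[OF assms jac_smooth_source[OF assms]] .

end

section \<open>Tensors\<close>

lemma sum_length_Suc:
  "(\<Sum>ks | length ks = Suc n. F ks) = (\<Sum>k\<in>UNIV. \<Sum>ks | length ks = n. F (k # ks :: 'n::finite list))"
proof -
  have "{ks::'n list. length ks = Suc n} = (\<lambda>(k, ks). k # ks) ` (UNIV \<times> {ks. length ks = n})"
    by (auto simp: length_Suc_conv image_iff)
  moreover have "inj_on (\<lambda>(k, ks). k # ks) (UNIV \<times> {ks::'n list. length ks = n})"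
    by (auto simp: inj_on_def)
  ultimately show ?thesis
    by (simp add: sum.reindex sum.cartesian_product case_prod_unfold)
qed

lemma sum_length_add:
  "(\<Sum>ks | length ks = m + n. F ks) = (\<Sum>ks | length ks = m. \<Sum>ls | length ls = n. F (ks @ ls :: 'n::finite list))"
proof (induction m arbitrary: F)
  case 0
  have "{ks::'n list. length ks = 0} = {[]}" by auto
  then show ?case by simp
next
  case (Suc m)
  then show ?case by (simp add: sum_length_Suc)
qed

lemma prod_lessThan_append:
  assumes "length is = length ks"
  shows "(\<Prod>a<length (is @ js). J ((is @ js) ! a) ((ks @ ls) ! a)) =
    (\<Prod>a<length is. J (is ! a) (ks ! a)) * (\<Prod>a<length js. J (js ! a) (ls ! a) :: real)"
proof -
  have "(\<Prod>a<m + n. f a) = (\<Prod>a<m. f a) * (\<Prod>a<n. f (m + a))" for m n :: nat and f :: "nat \<Rightarrow> real"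
    by (induction n) (simp_all add: mult_ac)
  then show ?thesis using assms by (simp add: nth_append)
qed

lemma tensorsD:
  assumes "\<tau> \<in> tensors M r s p"
  shows "\<not> (c \<in> M \<and> p \<in> cdom c \<and> length is = r \<and> length js = s) \<Longrightarrow> \<tau> c is js = 0"
    and "\<lbrakk>c \<in> M; d \<in> M; p \<in> cdom c; p \<in> cdom d; length is = r; length js = s\<rbrakk> \<Longrightarrow>
      \<tau> d is js = (\<Sum>ks | length ks = r. \<Sum>ls | length ls = s.
          (\<Prod>a<r. jac c d p (is ! a) (ks ! a)) * (\<Prod>b<s. jac d c p (ls ! b) (js ! b)) * \<tau> c ks ls)"
  using assms unfolding tensors_def mem_Collect_eq by blast+

lemma tensorsI:
  assumes "\<And>c is js. \<not> (c \<in> M \<and> p \<in> cdom c \<and> length is = r \<and> length js = s) \<Longrightarrow> \<tau> c is js = 0"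
    and "\<And>c d is js. \<lbrakk>c \<in> M; d \<in> M; p \<in> cdom c; p \<in> cdom d; length is = r; length js = s\<rbrakk> \<Longrightarrow>
      \<tau> d is js = (\<Sum>ks | length ks = r. \<Sum>ls | length ls = s.
          (\<Prod>a<r. jac c d p (is ! a) (ks ! a)) * (\<Prod>b<s. jac d c p (ls ! b) (js ! b)) * \<tau> c ks ls)"
  shows "\<tau> \<in> tensors M r s p"
  using assms unfolding tensors_def mem_Collect_eq by blast

lemma vectorD:
  assumes "\<xi> \<in> tensors M 1 0 p" "c \<in> M" "d \<in> M" "p \<in> cdom c" "p \<in> cdom d"
  shows "\<xi> d [i] [] = (\<Sum>k\<in>UNIV. jac c d p i k * \<xi> c [k] [])"
  using tensorsD(2)[OF assms, of "[i]" "[]"] by (simp add: sum_length_Suc)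

text \<open>Index lists of the product split into those of the factors, so both the Jacobian
  products and the sums in the transformation law factorise.\<close>

lemma tprod_in_tensors:
  fixes \<sigma> \<tau> :: "('m, 'n::finite) tensor"
  assumes \<sigma>: "\<sigma> \<in> tensors M r s p" and \<tau>: "\<tau> \<in> tensors M r' s' p"
  shows "tprod r s \<sigma> \<tau> \<in> tensors M (r + r') (s + s') p"
proof (rule tensorsI)
  fix c :: "('m, 'n) chart" and "is" js :: "'n list"
  assume n: "\<not> (c \<in> M \<and> p \<in> cdom c \<and> length is = r + r' \<and> length js = s + s')"
  \<comment> \<open>A list of the wrong length has an initial segment or a remainder of the wrong
    length, so one of the two factors is a normalised zero.\<close>
  have "\<not> (c \<in> M \<and> p \<in> cdom c \<and> length (take r is) = r \<and> length (take s js) = s) \<or>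
     \<not> (c \<in> M \<and> p \<in> cdom c \<and> length (drop r is) = r' \<and> length (drop s js) = s')"
    using n by (auto simp: min_def split: if_splits)
  then show "tprod r s \<sigma> \<tau> c is js = 0"
    unfolding tprod_def using tensorsD(1)[OF \<sigma>] tensorsD(1)[OF \<tau>] by (metis mult_eq_0_iff)
next
  fix c d :: "('m, 'n) chart" and "is" js :: "'n list"
  assume cd: "c \<in> M" "d \<in> M" "p \<in> cdom c" "p \<in> cdom d"
    and len: "length is = r + r'" "length js = s + s'"
  obtain is1 is2 where i: "is = is1 @ is2" "length is1 = r" "length is2 = r'"
    using len(1) by (metis append_take_drop_id length_append add_left_cancel length_take min.absorb2 le_add1)
  obtain js1 js2 where j: "js = js1 @ js2" "length js1 = s" "length js2 = s'"
    using len(2) by (metis append_take_drop_id length_append add_left_cancel length_take min.absorb2 le_add1)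
  have "(\<Sum>ks | length ks = r + r'. \<Sum>ls | length ls = s + s'.
          (\<Prod>a<r + r'. jac c d p (is ! a) (ks ! a)) * (\<Prod>b<s + s'. jac d c p (ls ! b) (js ! b)) * tprod r s \<sigma> \<tau> c ks ls)
     = (\<Sum>ks1 | length ks1 = r. \<Sum>ks2 | length ks2 = r'. \<Sum>ls1 | length ls1 = s. \<Sum>ls2 | length ls2 = s'.
          ((\<Prod>a<r. jac c d p (is1 ! a) (ks1 ! a)) * (\<Prod>b<s. jac d c p (ls1 ! b) (js1 ! b)) * \<sigma> c ks1 ls1) *
          ((\<Prod>a<r'. jac c d p (is2 ! a) (ks2 ! a)) * (\<Prod>b<s'. jac d c p (ls2 ! b) (js2 ! b)) * \<tau> c ks2 ls2))"
    unfolding sum_length_add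
  proof (intro sum.cong refl, unfold mem_Collect_eq)
    fix ks1 ks2 ls1 ls2 :: "'n list"
    assume l: "length ks1 = r" "length ks2 = r'" "length ls1 = s" "length ls2 = s'"
    have "(\<Prod>a<r + r'. jac c d p (is ! a) ((ks1 @ ks2) ! a)) =
      (\<Prod>a<r. jac c d p (is1 ! a) (ks1 ! a)) * (\<Prod>a<r'. jac c d p (is2 ! a) (ks2 ! a))"
      using prod_lessThan_append[of is1 ks1 "jac c d p" is2 ks2] i l by simp
    moreover have "(\<Prod>b<s + s'. jac d c p ((ls1 @ ls2) ! b) (js ! b)) =
      (\<Prod>b<s. jac d c p (ls1 ! b) (js1 ! b)) * (\<Prod>b<s'. jac d c p (ls2 ! b) (js2 ! b))"
      using prod_lessThan_append[of ls1 js1 "jac d c p" ls2 js2] j l by simp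
    ultimately show "(\<Prod>a<r + r'. jac c d p (is ! a) ((ks1 @ ks2) ! a)) *
        (\<Prod>b<s + s'. jac d c p ((ls1 @ ls2) ! b) (js ! b)) * tprod r s \<sigma> \<tau> c (ks1 @ ks2) (ls1 @ ls2) =
        (\<Prod>a<r. jac c d p (is1 ! a) (ks1 ! a)) * (\<Prod>b<s. jac d c p (ls1 ! b) (js1 ! b)) * \<sigma> c ks1 ls1 *
        ((\<Prod>a<r'. jac c d p (is2 ! a) (ks2 ! a)) * (\<Prod>b<s'. jac d c p (ls2 ! b) (js2 ! b)) * \<tau> c ks2 ls2)"
      using l by (simp add: tprod_def mult_ac)
  qed
  also have "\<dots> = (\<Sum>ks1 | length ks1 = r. \<Sum>ls1 | length ls1 = s. \<Sum>ks2 | length ks2 = r'. \<Sum>ls2 | length ls2 = s'.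
          ((\<Prod>a<r. jac c d p (is1 ! a) (ks1 ! a)) * (\<Prod>b<s. jac d c p (ls1 ! b) (js1 ! b)) * \<sigma> c ks1 ls1) *
          ((\<Prod>a<r'. jac c d p (is2 ! a) (ks2 ! a)) * (\<Prod>b<s'. jac d c p (ls2 ! b) (js2 ! b)) * \<tau> c ks2 ls2))"
    by (intro sum.cong refl sum.swap)
  also have "\<dots> = \<sigma> d is1 js1 * \<tau> d is2 js2"
    unfolding tensorsD(2)[OF \<sigma> cd i(2) j(2)] tensorsD(2)[OF \<tau> cd i(3) j(3)]
    by (simp only: sum_distrib_right, simp only: sum_distrib_left)
  finally show "tprod r s \<sigma> \<tau> d is js = (\<Sum>ks | length ks = r + r'. \<Sum>ls | length ls = s + s'.
          (\<Prod>a<r + r'. jac c d p (is ! a) (ks ! a)) * (\<Prod>b<s + s'. jac d c p (ls ! b) (js ! b)) * tprod r s \<sigma> \<tau> c ks ls)"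
    using i j by (simp add: tprod_def)
qed

lemma sum_delta_mult: "(\<Sum>l\<in>UNIV. (if l = k then 1 else 0) * g l) = (g k :: real)" for k :: "'n::finite"
  by (simp add: if_distrib[where f = "\<lambda>x. x * _"] cong: if_cong)

lemma sum_swap_innermost:
  "(\<Sum>i\<in>I. \<Sum>k\<in>A. \<Sum>l\<in>B. \<Sum>m\<in>C. \<Sum>n\<in>D. F i k l m n) = (\<Sum>k\<in>A. \<Sum>l\<in>B. \<Sum>m\<in>C. \<Sum>n\<in>D. \<Sum>i\<in>I. F i k l m n)"
  by (subst sum.swap, rule sum.cong[OF refl], subst sum.swap, rule sum.cong[OF refl],
      subst sum.swap, rule sum.cong[OF refl], subst sum.swap, rule refl)

text \<open>For the contracted pair of indices the Jacobian meets its inverse, which collapses their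
  two sums into one; the other indices are carried along in \<open>P\<close>.\<close>

lemma contract_in_tensors:
  fixes \<tau> :: "('m::{t2_space,second_countable_topology}, 'n::finite) tensor"
  assumes M: "oriented_smooth_structure M" and \<tau>: "\<tau> \<in> tensors M (Suc r) (Suc s) p"
  shows "contract 0 0 \<tau> \<in> tensors M r s p"
proof (rule tensorsI)
  fix c :: "('m, 'n) chart" and "is" js :: "'n list"
  assume n: "\<not> (c \<in> M \<and> p \<in> cdom c \<and> length is = r \<and> length js = s)"
  then show "contract 0 0 \<tau> c is js = 0"
    unfolding contract_def by (auto intro!: sum.neutral tensorsD(1)[OF \<tau>])
next
  fix c d :: "('m, 'n) chart" and "is" js :: "'n list"
  assume cd: "c \<in> M" "d \<in> M" "p \<in> cdom c" "p \<in> cdom d"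
    and len: "length is = r" "length js = s"
  define P where "P ks ls = (\<Prod>a<r. jac c d p (is ! a) (ks ! a)) * (\<Prod>b<s. jac d c p (ls ! b) (js ! b))" for ks ls
  have "contract 0 0 \<tau> d is js = (\<Sum>i\<in>UNIV. \<Sum>k\<in>UNIV. \<Sum>ks | length ks = r. \<Sum>l\<in>UNIV. \<Sum>ls | length ls = s.
      (jac d c p l i * jac c d p i k) * (P ks ls * \<tau> c (k # ks) (l # ls)))"
    unfolding contract_def P_def
    by (simp add: tensorsD(2)[OF \<tau> cd] len sum_length_Suc prod.lessThan_Suc_shift mult_ac
        del: prod.lessThan_Suc)
  also have "\<dots> = (\<Sum>k\<in>UNIV. \<Sum>ks | length ks = r. \<Sum>l\<in>UNIV. \<Sum>ls | length ls = s.
      (\<Sum>i\<in>UNIV. jac d c p l i * jac c d p i k) * (P ks ls * \<tau> c (k # ks) (l # ls)))"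
    unfolding sum_distrib_right by (rule sum_swap_innermost)
  also have "\<dots> = (\<Sum>k\<in>UNIV. \<Sum>ks | length ks = r. \<Sum>l\<in>UNIV. \<Sum>ls | length ls = s.
      (if l = k then 1 else 0) * (P ks ls * \<tau> c (k # ks) (l # ls)))"
    using jac_inverse[OF M cd] by simp
  also have "\<dots> = (\<Sum>k\<in>UNIV. \<Sum>ks | length ks = r. \<Sum>ls | length ls = s. P ks ls * \<tau> c (k # ks) (k # ls))"
    unfolding sum_distrib_left[symmetric] sum_delta_mult ..
  also have "\<dots> = (\<Sum>ks | length ks = r. \<Sum>ls | length ls = s. P ks ls * contract 0 0 \<tau> c ks ls)"
    unfolding contract_def sum_distrib_left
    by (subst sum.swap, rule sum.cong[OF refl], subst sum.swap) simp
  finally show "contract 0 0 \<tau> d is js = (\<Sum>ks | length ks = r. \<Sum>ls | length ls = s.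
          (\<Prod>a<r. jac c d p (is ! a) (ks ! a)) * (\<Prod>b<s. jac d c p (ls ! b) (js ! b)) * contract 0 0 \<tau> c ks ls)"
    by (simp add: P_def)
qed

text \<open>Interior products are thereby built from the two operations that a tensor derivation
  respects; their transformation law and their Leibniz rule both follow from this form.\<close>

lemma interior_product_eq_contract: "interior_product \<xi> \<omega> = contract 0 0 (tprod 1 0 \<xi> \<omega>)"
  by (simp add: interior_product_def contract_def tprod_def)

lemma interior_product_in_tensors:
  assumes "oriented_smooth_structure M" "\<xi> \<in> tensors M 1 0 p" "\<omega> \<in> tensors M r (Suc s) p"
  shows "interior_product \<xi> \<omega> \<in> tensors M r s p"
  using contract_in_tensors[OF assms(1), of _ r s] tprod_in_tensors[OF assms(2,3)]
  by (simp add: interior_product_eq_contract)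

lemma tapply_in_tensors:
  assumes "oriented_smooth_structure M" "\<tau> \<in> tensors M 1 1 p" "\<xi> \<in> tensors M 1 0 p"
  shows "tapply \<tau> \<xi> \<in> tensors M 1 0 p"
proof -
  have "tapply \<tau> \<xi> c is js = interior_product \<xi> \<tau> c is js" for c "is" js
  proof (cases "js = []")
    case True
    then show ?thesis by (simp add: tapply_def interior_product_def mult.commute)
  next
    \<comment> \<open>The two expressions attach \<open>js\<close> to different factors; for
      nonempty \<open>js\<close> each has a factor whose index list is too long, so both are
      zero.\<close>
    case False
    then have "\<xi> c [j] js = 0" "\<tau> c is (j # js) = 0" for j
      using tensorsD(1)[OF assms(3), of c "[j]" js] tensorsD(1)[OF assms(2), of c "is" "j # js"] by auto
    then show ?thesis by (simp add: tapply_def interior_product_def)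
  qed
  then have "tapply \<tau> \<xi> = interior_product \<xi> \<tau>" by blast
  then show ?thesis using interior_product_in_tensors[OF assms(1,3), of \<tau> 1 0] assms(2) by simp
qed

lemma tscale_in_tensors:
  assumes "\<tau> \<in> tensors M r s p"
  shows "tscale t \<tau> \<in> tensors M r s p"
proof (rule tensorsI)
  show "tscale t \<tau> d is js = (\<Sum>ks | length ks = r. \<Sum>ls | length ls = s.
          (\<Prod>a<r. jac c d p (is ! a) (ks ! a)) * (\<Prod>b<s. jac d c p (ls ! b) (js ! b)) * tscale t \<tau> c ks ls)"
    if "c \<in> M" "d \<in> M" "p \<in> cdom c" "p \<in> cdom d" "length is = r" "length js = s" for c d "is" js
    unfolding tscale_def tensorsD(2)[OF assms that] by (simp add: sum_distrib_left mult_ac)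
qed (use tensorsD(1)[OF assms] in \<open>auto simp: tscale_def\<close>)

lemma tzero_in_tensors: "tzero \<in> tensors M r s p"
  by (rule tensorsI) (simp_all add: tzero_def)

section \<open>Coordinates on the tangent bundle\<close>

text \<open>The vector with components \<open>y\<close> in the chart \<open>c\<close>, carried to
  all other charts by the Jacobian. It is the explicit fibre part of the inverse of
  \<open>tcoord c\<close>, which \<open>tinv\<close> provides only by choice; for \<open>p\<close>
  outside \<open>cdom c\<close> it has no meaning.\<close>

definition chart_vector ::
    "('m, 'n::finite) chart set \<Rightarrow> ('m, 'n) chart \<Rightarrow> 'm \<Rightarrow> real^'n \<Rightarrow> ('m, 'n) tensor" where
  "chart_vector M c p y = (\<lambda>d is js. if d \<in> M \<and> p \<in> cdom d \<and> length is = 1 \<and> js = []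
     then \<Sum>k\<in>UNIV. jac c d p (hd is) k * y $ k else 0)"

context
  fixes M :: "('m::{t2_space,second_countable_topology}, 'n::finite) chart set"
  assumes M: "oriented_smooth_structure M"
begin

lemma chart_vector_in_tensors:
  assumes "c \<in> M" "p \<in> cdom c"
  shows "chart_vector M c p y \<in> tensors M 1 0 p"
proof (rule tensorsI)
  fix d e :: "('m, 'n) chart" and "is" js :: "'n list"
  assume de: "d \<in> M" "e \<in> M" "p \<in> cdom d" "p \<in> cdom e" and len: "length is = 1" "length js = 0"
  obtain i where i: "is = [i]" using len by (auto simp: length_Suc_conv)
  have "(\<Sum>j\<in>UNIV. jac d e p i j * (\<Sum>k\<in>UNIV. jac c d p j k * y $ k))
      = (\<Sum>k\<in>UNIV. (\<Sum>j\<in>UNIV. jac d e p i j * jac c d p j k) * y $ k)"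
    unfolding sum_distrib_left sum_distrib_right by (subst sum.swap) (simp add: mult_ac)
  then show "chart_vector M c p y e is js = (\<Sum>ks | length ks = 1. \<Sum>ls | length ls = 0.
          (\<Prod>a<1. jac d e p (is ! a) (ks ! a)) * (\<Prod>b<0. jac e d p (ls ! b) (js ! b)) * chart_vector M c p y d ks ls)"
    using len de jac_chain[OF M assms(1) de(1,2) assms(2) de(3,4)]
    by (simp add: chart_vector_def i sum_length_Suc)
qed (auto simp: chart_vector_def)

lemma chart_vector_self:
  assumes "c \<in> M" "p \<in> cdom c"
  shows "chart_vector M c p y c [i] [] = y $ i"
  using assms by (simp add: chart_vector_def jac_self[OF M] if_distrib[where f = "\<lambda>x. x * _"] cong: if_cong)

lemma vector_eqI:
  assumes "\<xi> \<in> tensors M 1 0 p" "\<zeta> \<in> tensors M 1 0 p" "c \<in> M" "p \<in> cdom c"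
    and "\<And>i. \<xi> c [i] [] = \<zeta> c [i] []"
  shows "\<xi> = \<zeta>"
proof (intro ext)
  fix d "is" js
  show "\<xi> d is js = \<zeta> d is js"
  proof (cases "d \<in> M \<and> p \<in> cdom d \<and> length is = 1 \<and> length js = 0")
    case True
    then obtain i where "is = [i]" "js = []" by (auto simp: length_Suc_conv)
    then show ?thesis using True vectorD[OF assms(1,3) _ assms(4)] vectorD[OF assms(2,3) _ assms(4)] assms(5) by simp
  next
    case False
    then show ?thesis using tensorsD(1)[OF assms(1)] tensorsD(1)[OF assms(2)] by metis
  qed
qed

lemma inj_tcoord:
  assumes "c \<in> M"
  shows "inj_on (tcoord c) (tdom M c)"
proof (rule inj_onI)
  fix v w assume v: "v \<in> tdom M c" and w: "w \<in> tdom M c" and e: "tcoord c v = tcoord c w"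
  have "fst v = fst w"
    using e v w is_chartD(6)[OF chart[OF M assms]] unfolding tcoord_def tdom_def by (metis (lifting) mem_Collect_eq prod.inject)
  moreover have "snd v = snd w"
    by (rule vector_eqI[of _ "fst v" _ c])
      (use e v w assms calculation in \<open>auto simp: tcoord_def tdom_def TM_def vec_eq_iff\<close>)
  ultimately show "v = w" by (simp add: prod_eq_iff)
qed

lemma tinv_tcoord: "c \<in> M \<Longrightarrow> v \<in> tdom M c \<Longrightarrow> tinv M c (tcoord c v) = v"
  unfolding tinv_def by (rule inv_into_f_f[OF inj_tcoord])

text \<open>A tangent vector is determined by its base point and its components in one chart, so
  exhibiting one preimage under \<open>tcoord c\<close> identifies the chosen one.\<close>

lemma tinv_eq:
  assumes "c \<in> M" "x \<in> crange c"
  shows "tinv M c (x, y) = (cinv c x, chart_vector M c (cinv c x) y)"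
proof -
  note c = is_chartD[OF chart[OF M assms(1)]]
  let ?v = "(cinv c x, chart_vector M c (cinv c x) y)"
  have "?v \<in> tdom M c" using assms c by (auto simp: tdom_def TM_def chart_vector_in_tensors[unfolded One_nat_def])
  moreover have "tcoord c ?v = (x, y)"
    using assms c by (simp add: tcoord_def chart_vector_self)
  ultimately show ?thesis using tinv_tcoord[OF assms(1)] by metis
qed

lemma tinv_in_tdom: "c \<in> M \<Longrightarrow> fst z \<in> crange c \<Longrightarrow> tinv M c z \<in> tdom M c"
  using tinv_eq[of c "fst z" "snd z"] is_chartD[OF chart[OF M]]
  by (auto simp: tdom_def TM_def chart_vector_in_tensors[unfolded One_nat_def])

lemma tcoord_tinv: "c \<in> M \<Longrightarrow> fst z \<in> crange c \<Longrightarrow> tcoord c (tinv M c z) = z"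
  using tinv_eq[of c "fst z" "snd z"] is_chartD[OF chart[OF M]]
  by (simp add: tcoord_def chart_vector_self)

lemma fst_tcoord: "c \<in> M \<Longrightarrow> v \<in> tdom M c \<Longrightarrow> fst (tcoord c v) \<in> crange c"
  using is_chartD[OF chart[OF M]] by (simp add: tcoord_def tdom_def)

lemma tcoord_image_eq:
  assumes "c \<in> M"
  shows "tcoord c ` (A \<inter> tdom M c) = {z. fst z \<in> crange c \<and> tinv M c z \<in> A}"
proof (intro equalityI subsetI)
  fix z assume "z \<in> {z. fst z \<in> crange c \<and> tinv M c z \<in> A}"
  then show "z \<in> tcoord c ` (A \<inter> tdom M c)"
    using tcoord_tinv[OF assms] tinv_in_tdom[OF assms] by (intro image_eqI[of _ _ "tinv M c z"]) auto
qed (use tinv_tcoord[OF assms] fst_tcoord[OF assms] in auto)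

end

section \<open>Coordinate derivatives\<close>

lemma difference_quotient_tendsto:
  fixes F :: "'a::real_normed_vector \<Rightarrow> real"
  assumes "(F has_derivative F') (at z)"
  shows "((\<lambda>t. (F (z + t *\<^sub>R u) - F z) / t) \<longlongrightarrow> F' u) (at 0)"
proof -
  have "((\<lambda>t. z + t *\<^sub>R u) has_derivative (\<lambda>t. t *\<^sub>R u)) (at 0)"
    by (auto intro!: derivative_eq_intros)
  moreover have "(F has_derivative F') (at (z + 0 *\<^sub>R u))" using assms by simp
  ultimately have "((\<lambda>t. F (z + t *\<^sub>R u)) has_derivative (\<lambda>t. F' (t *\<^sub>R u))) (at 0)"
    by (rule has_derivative_compose)
  moreover have "F' (t *\<^sub>R u) = F' u * t" for t
    using linear_scale[OF has_derivative_linear[OF assms]] by simp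
  ultimately have "((\<lambda>t. F (z + t *\<^sub>R u)) has_real_derivative F' u) (at 0)"
    by (simp add: has_field_derivative_def)
  then show ?thesis by (simp add: DERIV_def)
qed

lemma frechet_derivative_mult:
  fixes f g :: "'a::real_normed_vector \<Rightarrow> real"
  assumes "f differentiable (at x)" "g differentiable (at x)"
  shows "frechet_derivative (\<lambda>x. f x * g x) (at x) w
    = f x * frechet_derivative g (at x) w + frechet_derivative f (at x) w * g x"
proof -
  have "((\<lambda>x. f x * g x) has_derivative
      (\<lambda>w. f x * frechet_derivative g (at x) w + frechet_derivative f (at x) w * g x)) (at x)"
    using assms by (intro has_derivative_mult) (auto simp: frechet_derivative_works)
  from frechet_derivative_at[OF this, symmetric] show ?thesis by simp
qed

lemma frechet_derivative_sum:
  assumes "\<And>i. i \<in> I \<Longrightarrow> f i differentiable (at x)"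
  shows "frechet_derivative (\<lambda>x. \<Sum>i\<in>I. f i x) (at x) w = (\<Sum>i\<in>I. frechet_derivative (f i) (at x) w)"
proof -
  have "((\<lambda>x. \<Sum>i\<in>I. f i x) has_derivative (\<lambda>w. \<Sum>i\<in>I. frechet_derivative (f i) (at x) w)) (at x)"
    using assms by (intro has_derivative_sum) (auto simp: frechet_derivative_works)
  from frechet_derivative_at[OF this, symmetric] show ?thesis by simp
qed

lemma frechet_derivative_cmult:
  fixes f :: "'a::real_normed_vector \<Rightarrow> real"
  assumes "f differentiable (at x)"
  shows "frechet_derivative (\<lambda>x. a * f x) (at x) w = a * frechet_derivative f (at x) w"
  using frechet_derivative_mult[of "\<lambda>x. a" x f w] assms by simp

lemma smooth_on_differentiable: "smooth_on S f \<Longrightarrow> x \<in> S \<Longrightarrow> f differentiable (at x)"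
  using smooth_on_has_derivative differentiableI by blast

lemma smooth_on_dy: "smooth_on S f \<Longrightarrow> smooth_on S (dy j f)"
  unfolding dy_def[abs_def] by (rule smooth_on_frechet_derivative)

lemma dy_commute:
  assumes "open S" "z \<in> S" "smooth_on S f"
  shows "dy i (dy j f) z = dy j (dy i f) z"
  unfolding dy_def[abs_def] by (rule second_derivative_symmetric[OF assms(1,2) smooth_onD[OF assms(3)]])

lemma dy_cong:
  assumes "open S" "z \<in> S" "\<And>z. z \<in> S \<Longrightarrow> f z = g z" "f differentiable (at z)"
  shows "dy j f z = dy j g z"
  using frechet_derivative_cong_open(2)[OF assms] by (simp add: dy_def)

text \<open>Used with two choices of \<open>w\<close>: minus a column of the nonlinear connection
  gives \<open>\<delta>\<close>, and the derivative of a section gives differentiation along that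
  section. The difference of the two directions is the covariant derivative of the section.\<close>

lemma frechet_derivative_horizontal:
  assumes "f differentiable (at z)"
  shows "frechet_derivative f (at z) (axis k 1, w) = dx k f z + (\<Sum>j\<in>UNIV. w $ j * dy j f z)"
proof -
  have l: "linear (frechet_derivative f (at z))"
    using assms linear_frechet_derivative by blast
  have "w = (\<Sum>j\<in>UNIV. w $ j *\<^sub>R axis j 1)"
    using basis_expansion[of w] by (simp add: scalar_mult_eq_scaleR)
  then have "(axis k 1, w) = (axis k 1, 0) + (\<Sum>j\<in>UNIV. w $ j *\<^sub>R (0, axis j 1))"
    by (simp add: prod_eq_iff fst_sum snd_sum)
  then have "frechet_derivative f (at z) (axis k 1, w) =
      frechet_derivative f (at z) ((axis k 1, 0) + (\<Sum>j\<in>UNIV. w $ j *\<^sub>R (0, axis j 1)))"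
    by (rule arg_cong)
  also have "\<dots> = dx k f z + (\<Sum>j\<in>UNIV. w $ j * dy j f z)"
    by (simp add: linear_add[OF l] linear_sum[OF l] linear_scale[OF l] dx_def dy_def del: scaleR_Pair)
  finally show ?thesis .
qed

text \<open>As a derivative in a single direction, \<open>\<delta>\<close> inherits the product
  rule, additivity and locality.\<close>

lemma \<delta>_eq_frechet_derivative:
  assumes "f differentiable (at z)"
  shows "\<delta> M L c k f z = frechet_derivative f (at z) (axis k 1, \<chi> j. - nonlin M L c j k z)"
  using frechet_derivative_horizontal[OF assms] by (simp add: \<delta>_def sum_negf)

lemma \<delta>_mult:
  assumes "f differentiable (at z)" "g differentiable (at z)"
  shows "\<delta> M L c k (\<lambda>z. f z * g z) z = f z * \<delta> M L c k g z + \<delta> M L c k f z * g z"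
  using assms by (simp add: \<delta>_eq_frechet_derivative frechet_derivative_mult)

lemma \<delta>_sum:
  assumes "\<And>i. i \<in> I \<Longrightarrow> f i differentiable (at z)"
  shows "\<delta> M L c k (\<lambda>z. \<Sum>i\<in>I. f i z) z = (\<Sum>i\<in>I. \<delta> M L c k (f i) z)"
proof -
  have "(\<lambda>z. \<Sum>i\<in>I. f i z) differentiable (at z)"
    using assms by (intro differentiableI[OF has_derivative_sum]) (auto simp: frechet_derivative_works)
  then show ?thesis
    using assms by (simp add: \<delta>_eq_frechet_derivative frechet_derivative_sum)
qed

lemma \<delta>_cong:
  assumes "open S" "z \<in> S" "\<And>z. z \<in> S \<Longrightarrow> f z = g z" "f differentiable (at z)"
  shows "\<delta> M L c k f z = \<delta> M L c k g z"
  using frechet_derivative_cong_open[OF assms] assms(4) by (simp add: \<delta>_eq_frechet_derivative)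

lemma \<delta>_zero: "\<delta> M L c k (\<lambda>z. 0) z = 0"
  by (simp add: \<delta>_def dx_def dy_def)

section \<open>Anisotropic tensor fields\<close>

locale conic_manifold =
  fixes M :: "('m::{t2_space,second_countable_topology}, 'n::finite) chart set"
    and A :: "('m, 'n) tpoint set"
  assumes M: "oriented_smooth_structure M" and A: "conic_domain M A"
begin

abbreviation "coords c \<equiv> tcoord c ` (A \<inter> tdom M c)"

lemma open_coords: "c \<in> M \<Longrightarrow> open (coords c)"
  using A by (simp add: conic_domain_def)

lemma coords_iff: "c \<in> M \<Longrightarrow> z \<in> coords c \<longleftrightarrow> fst z \<in> crange c \<and> tinv M c z \<in> A"
  using tcoord_image_eq[OF M] by simp

lemma aniso_tensorsD:
  assumes "T \<in> aniso_tensors M A r s"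
  shows "v \<in> A \<Longrightarrow> T v \<in> tensors M r s (fst v)" "v \<notin> A \<Longrightarrow> T v = tzero"
    "\<lbrakk>c \<in> M; length is = r; length js = s\<rbrakk> \<Longrightarrow> smooth_on (coords c) (\<lambda>z. T (tinv M c z) c is js)"
  using assms unfolding aniso_tensors_def by blast+

lemma aniso_tensorsI:
  assumes "\<And>v. v \<in> A \<Longrightarrow> T v \<in> tensors M r s (fst v)" "\<And>v. v \<notin> A \<Longrightarrow> T v = tzero"
    "\<And>c is js. \<lbrakk>c \<in> M; length is = r; length js = s\<rbrakk> \<Longrightarrow> smooth_on (coords c) (\<lambda>z. T (tinv M c z) c is js)"
  shows "T \<in> aniso_tensors M A r s"
  using assms unfolding aniso_tensors_def by blast

lemma aniso_tprod:
  assumes S: "S \<in> aniso_tensors M A r s" and T: "T \<in> aniso_tensors M A r' s'"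
  shows "(\<lambda>v. tprod r s (S v) (T v)) \<in> aniso_tensors M A (r + r') (s + s')"
proof (rule aniso_tensorsI)
  show "smooth_on (coords c) (\<lambda>z. tprod r s (S (tinv M c z)) (T (tinv M c z)) c is js)"
    if "c \<in> M" "length is = r + r'" "length js = s + s'" for c "is" js
    unfolding tprod_def using that
    by (intro smooth_on_mult open_coords aniso_tensorsD(3)[OF S] aniso_tensorsD(3)[OF T]) auto
qed (simp_all add: aniso_tensorsD[OF S] aniso_tensorsD[OF T] tprod_in_tensors, simp add: tprod_def tzero_def)

lemma aniso_contract:
  assumes T: "T \<in> aniso_tensors M A (Suc r) (Suc s)"
  shows "(\<lambda>v. contract 0 0 (T v)) \<in> aniso_tensors M A r s"
proof (rule aniso_tensorsI)
  show "smooth_on (coords c) (\<lambda>z. contract 0 0 (T (tinv M c z)) c is js)"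
    if "c \<in> M" "length is = r" "length js = s" for c "is" js
    unfolding contract_def using that by (intro smooth_on_sum open_coords aniso_tensorsD(3)[OF T]) auto
qed (simp_all add: aniso_tensorsD[OF T] contract_in_tensors[OF M], simp add: contract_def tzero_def)

lemma aniso_interior_product:
  assumes "E \<in> aniso_tensors M A 1 0" "\<omega> \<in> aniso_tensors M A r (Suc s)"
  shows "(\<lambda>v. interior_product (E v) (\<omega> v)) \<in> aniso_tensors M A r s"
  unfolding interior_product_eq_contract
  by (rule aniso_contract) (use aniso_tprod[OF assms] in simp)

lemma tensor_derivation_interior_product:
  assumes D: "tensor_derivation M A \<D>"
    and E: "E \<in> aniso_tensors M A 1 0" and \<omega>: "\<omega> \<in> aniso_tensors M A r (Suc s)"
  shows "\<D> (\<lambda>v. interior_product (E v) (\<omega> v)) =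
    (\<lambda>v. tadd (interior_product (\<D> E v) (\<omega> v)) (interior_product (E v) (\<D> \<omega> v)))"
proof -
  have mem: "(\<lambda>v. tprod 1 0 (E v) (\<omega> v)) \<in> aniso_tensors M A (Suc r) (Suc s)"
    using aniso_tprod[OF E \<omega>] by simp
  have pro: "\<forall>r s r' s'. \<forall>S\<in>aniso_tensors M A r s. \<forall>T\<in>aniso_tensors M A r' s'.
        \<D> (\<lambda>v. tprod r s (S v) (T v)) = (\<lambda>v. tadd (tprod r s (\<D> S v) (T v)) (tprod r s (S v) (\<D> T v)))"
    using D unfolding tensor_derivation_def by (elim conjE)
  have con: "\<forall>r s. \<forall>T\<in>aniso_tensors M A (Suc r) (Suc s). \<forall>a\<le>r. \<forall>b\<le>s.
        \<D> (\<lambda>v. contract a b (T v)) = (\<lambda>v. contract a b (\<D> T v))"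
    using D unfolding tensor_derivation_def by (elim conjE)
  have "\<D> (\<lambda>v. contract 0 0 (tprod 1 0 (E v) (\<omega> v))) = (\<lambda>v. contract 0 0 (\<D> (\<lambda>v. tprod 1 0 (E v) (\<omega> v)) v))"
    by (rule con[rule_format, OF mem]) simp_all
  also have "\<D> (\<lambda>v. tprod 1 0 (E v) (\<omega> v)) = (\<lambda>v. tadd (tprod 1 0 (\<D> E v) (\<omega> v)) (tprod 1 0 (E v) (\<D> \<omega> v)))"
    by (rule pro[rule_format, OF E \<omega>])
  finally show ?thesis
    by (simp add: interior_product_eq_contract contract_def tadd_def sum.distrib)
qed

text \<open>Anisotropic fields with prescribed value at a point exist by cutting off coordinate fields; this
  is what makes the abstract derivation computable in coordinates.\<close>

lemma cut_off_coordinate_fields: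
  assumes c: "c \<in> M" and p: "p \<in> cdom c"
  obtains f E where "smooth_on UNIV f" "f (cmap c p) \<noteq> 0" "\<And>a. E a \<in> aniso_tensors M A 1 0"
    "\<And>a w i. w \<in> A \<Longrightarrow> fst w \<in> cdom c \<Longrightarrow> E a w c [i] [] = (if i = a then f (cmap c (fst w)) else 0)"
proof -
  note ch = is_chartD[OF chart[OF M c]]
  obtain r where r: "r > 0" "cball (cmap c p) r \<subseteq> crange c"
    using ch(2) ch(5)[OF p] open_contains_cball by blast
  obtain f :: "real^'n \<Rightarrow> real" where f: "smooth_on UNIV f" "f (cmap c p) \<noteq> 0"
    "\<And>x. x \<notin> cball (cmap c p) r \<Longrightarrow> f x = 0"
    using smooth_bump[OF r(1)] by blast
  \<comment> \<open>\<open>K\<close> is compact, hence closed in the Hausdorff manifold. So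
    \<open>cdom c\<close> and the complement of \<open>K\<close> are open and cover the manifold,
    and the bump function extended by zero is smooth on each of them.\<close>
  define K where "K = cinv c ` cball (cmap c p) r"
  have "compact K" unfolding K_def
    by (rule compact_continuous_image[OF continuous_on_subset[OF ch(4) r(2)] compact_cball])
  then have K: "open (- K)" by (simp add: compact_imp_closed open_Compl)
  define \<phi> where "\<phi> q = (if q \<in> cdom c then f (cmap c q) else 0)" for q
  have \<phi>0: "\<phi> q = 0" if "q \<notin> K" for q
    using that f(3) ch(6) unfolding \<phi>_def K_def by (metis image_eqI)
  have \<phi>d: "q \<in> cdom c" if "q \<in> K" for q
    using that ch(7) r(2) unfolding K_def by blast
  \<comment> \<open>Off \<open>cdom c\<close> the factor \<open>\<phi>\<close> vanishes, which hides
    the meaningless values of \<open>chart_vector\<close> there. On \<open>A\<close> the field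
    depends on the base point only.\<close>
  define E where "E a w = (if w \<in> A then tscale (\<phi> (fst w)) (chart_vector M c (fst w) (axis a 1)) else tzero)" for a w
  have comp: "E a w d [i] [] = \<phi> (fst w) * jac c d (fst w) i a"
    if "w \<in> A" "d \<in> M" "fst w \<in> cdom d" for a w d i
    using that by (simp add: E_def tscale_def chart_vector_def axis_def if_distrib cong: if_cong)
  have "E a \<in> aniso_tensors M A 1 0" for a
  proof (rule aniso_tensorsI)
    fix v assume v: "v \<in> A"
    show "E a v \<in> tensors M 1 0 (fst v)"
    proof (cases "fst v \<in> cdom c")
      case True
      show ?thesis using v tscale_in_tensors[OF chart_vector_in_tensors[OF M c True]] by (simp add: E_def)
    next
      case False
      then have "E a v = tzero" using v by (simp add: E_def \<phi>_def tscale_def tzero_def)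
      then show ?thesis by (simp add: tzero_in_tensors)
    qed
  next
    fix d :: "('m, 'n) chart" and "is" js :: "'n list"
    assume d: "d \<in> M" and len: "length is = 1" "length js = 0"
    note dh = is_chartD[OF chart[OF M d]]
    obtain i where i: "is = [i]" "js = []" using len by (auto simp: length_Suc_conv)
    have E_eq: "E a (tinv M d z) d is js = \<phi> (cinv d (fst z)) * jac c d (cinv d (fst z)) i a" if "z \<in> coords d" for z
      using that comp[OF _ d] coords_iff[OF d] tinv_eq[OF M d, of "fst z" "snd z"] dh(7) by (simp add: i)
    have sub: "open (coords d \<inter> fst -` (cmap d ` (W \<inter> cdom d)))" if "open W" for W
      by (intro open_Int open_coords d open_vimage_fst open_cmap_image[OF chart[OF M d]] that)
    show "smooth_on (coords d) (\<lambda>z. E a (tinv M d z) d is js)"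
    proof (rule smooth_on_cong[OF open_coords[OF d] _ E_eq[symmetric]])
      show "smooth_on (coords d) (\<lambda>z. \<phi> (cinv d (fst z)) * jac c d (cinv d (fst z)) i a)" (is "smooth_on _ ?F")
      proof (rule smooth_on_local)
        fix z assume z: "z \<in> coords d"
        then have zx: "fst z \<in> crange d" using coords_iff[OF d] by blast
        show "\<exists>T. open T \<and> z \<in> T \<and> smooth_on T ?F"
        proof (cases "cinv d (fst z) \<in> K")
          case True
          define T where "T = coords d \<inter> fst -` (cmap d ` (cdom c \<inter> cdom d))"
          have T: "open T" unfolding T_def by (rule sub[OF ch(1)])
          have "z \<in> T" using z zx True dh \<phi>d unfolding T_def by (auto intro!: image_eqI[of _ _ "cinv d (fst z)"])
          have o: "open (cmap d ` (cdom c \<inter> cdom d))" by (rule open_cmap_image[OF chart[OF M d] ch(1)])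
          have "smooth_on (cmap c ` (cdom c \<inter> cdom d)) (\<lambda>x. \<phi> (cinv c x))"
            by (rule smooth_on_cong[OF open_overlap[OF M c d] smooth_on_subset[OF f(1)]]) (auto simp: \<phi>_def ch)
          then have s: "smooth_on (cmap d ` (cdom c \<inter> cdom d)) (\<lambda>x. \<phi> (cinv d x))"
            by (rule smooth_on_change_chart[OF M c d])
          have "smooth_on T ?F"
            by (rule smooth_on_mult[OF T smooth_on_compose[OF T o _ s] smooth_on_compose[OF T o _ jac_smooth_target[OF M c d]]])
              (auto simp: T_def intro!: smooth_on_bounded_linear bounded_linear_fst T[unfolded T_def])
          then show ?thesis using T \<open>z \<in> T\<close> by blast
        next
          case False
          define T where "T = coords d \<inter> fst -` (cmap d ` (- K \<inter> cdom d))"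
          have T: "open T" unfolding T_def by (rule sub[OF K])
          have "z \<in> T" using z zx False dh unfolding T_def by (auto intro!: image_eqI[of _ _ "cinv d (fst z)"])
          moreover have "smooth_on T ?F"
            by (rule smooth_on_cong[OF T smooth_on_const[of _ 0]]) (auto simp: T_def dh \<phi>0)
          ultimately show ?thesis using T by blast
        qed
      qed
    qed
  qed (simp add: E_def)
  moreover have "E a w c [i] [] = (if i = a then f (cmap c (fst w)) else 0)" if "w \<in> A" "fst w \<in> cdom c" for a w i
    using comp[OF that(1) c that(2)] that(2) by (simp add: jac_self[OF M c] \<phi>_def)
  ultimately show ?thesis using that f by blast
qed

end

section \<open>The fundamental tensor\<close>

locale pseudo_finsler_manifold = conic_manifold M A
  for M :: "('m::{t2_space,second_countable_topology}, 'n::finite) chart set" and A +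
  fixes L :: "('m, 'n) tpoint \<Rightarrow> real"
  assumes L: "pseudo_finsler M A L"
begin

abbreviation "g \<equiv> g_comp M L"

lemma L_smooth: "c \<in> M \<Longrightarrow> smooth_on (coords c) (\<lambda>z. L (tinv M c z))"
  using L unfolding pseudo_finsler_def by blast

lemma det_g_nonzero: "c \<in> M \<Longrightarrow> z \<in> coords c \<Longrightarrow> det (g_mat M L c z) \<noteq> 0"
  using L unfolding pseudo_finsler_def by blast

lemma g_smooth:
  assumes "c \<in> M"
  shows "smooth_on (coords c) (g c i j)"
  unfolding g_comp_def[abs_def]
  by (intro smooth_on_mult open_coords smooth_on_const smooth_on_dy L_smooth assms)

lemma g_differentiable: "c \<in> M \<Longrightarrow> z \<in> coords c \<Longrightarrow> g c i j differentiable (at z)"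
  by (rule smooth_on_differentiable[OF g_smooth])

lemma g_sym: "c \<in> M \<Longrightarrow> z \<in> coords c \<Longrightarrow> g c i j z = g c j i z"
  unfolding g_comp_def using dy_commute[OF open_coords _ L_smooth] by simp

lemma \<delta>_g_sym: "c \<in> M \<Longrightarrow> z \<in> coords c \<Longrightarrow> \<delta> M L c k (g c i j) z = \<delta> M L c k (g c j i) z"
  by (rule \<delta>_cong[OF open_coords _ g_sym g_differentiable])

lemma dy_g_sym: "c \<in> M \<Longrightarrow> z \<in> coords c \<Longrightarrow> dy k (g c i j) z = dy k (g c j i) z"
  by (rule dy_cong[OF open_coords _ g_sym g_differentiable])

text \<open>Total symmetry of the Cartan tensor: up to the factor 1/2 these are third vertical
  derivatives of \<open>L\<close>, and vertical derivatives commute.\<close>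

lemma dy_g_commute:
  assumes "c \<in> M" "z \<in> coords c"
  shows "dy k (g c i j) z = dy i (g c k j) z"
proof -
  have s: "smooth_on (coords c) (dy j (\<lambda>z. L (tinv M c z)))"
    by (intro smooth_on_dy L_smooth assms)
  have eq: "dy k (g c i j) z = 1/2 * dy k (dy i (dy j (\<lambda>z. L (tinv M c z)))) z" for i k
    unfolding g_comp_def[abs_def] dy_def[of k]
    by (rule frechet_derivative_cmult[OF smooth_on_differentiable[OF smooth_on_dy[OF s] assms(2)]])
  show ?thesis
    unfolding eq by (rule arg_cong[OF dy_commute[OF open_coords[OF assms(1)] assms(2) s]])
qed

text \<open>Over the fixed point \<open>p\<close> a change of chart acts on the fibre coordinates by
  the constant linear map \<open>J\<close>, so a vertical derivative transforms by the chain rule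
  with the Jacobian alone. Agreement of \<open>F\<close> and \<open>G\<close> is required over
  \<open>p\<close> only, which allows coefficients frozen at \<open>p\<close>.\<close>

lemma dy_change_chart:
  assumes c: "c \<in> M" "p \<in> cdom c" and d: "d \<in> M" "p \<in> cdom d"
    and F: "smooth_on (coords d) F" and G: "smooth_on (coords c) G"
    and FG: "\<And>\<xi>. (p, \<xi>) \<in> A \<Longrightarrow> F (tcoord d (p, \<xi>)) = G (tcoord c (p, \<xi>))"
    and v: "(p, \<xi>) \<in> A"
  shows "dy i F (tcoord d (p, \<xi>)) = (\<Sum>k\<in>UNIV. jac d c p k i * dy k G (tcoord c (p, \<xi>)))"
proof -
  note ch = is_chartD[OF chart[OF M c(1)]] and dh = is_chartD[OF chart[OF M d(1)]]
  have TM: "(p, \<xi>) \<in> tdom M c" "(p, \<xi>) \<in> tdom M d" if "(p, \<xi>) \<in> A" for \<xi>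
    using that A c d by (auto simp: conic_domain_def tdom_def)
  define x where "x = cmap d p"
  define x' where "x' = cmap c p"
  define J where "J w = (\<chi> k. \<Sum>l\<in>UNIV. jac d c p k l * w $ l)" for w :: "real^'n"
  define y where "y = (\<chi> i. \<xi> d [i] [])"
  have z: "tcoord d (p, \<xi>) = (x, y)" by (simp add: tcoord_def x_def y_def)
  have tc: "tcoord c (p, chart_vector M d p u) = (x', J u)" for u
    using c d by (simp add: tcoord_def x'_def J_def chart_vector_def)
  have td: "tcoord d (p, chart_vector M d p u) = (x, u)" for u
    using d by (simp add: tcoord_def x_def chart_vector_self[OF M])
  have ti: "tinv M d (x, u) = (p, chart_vector M d p u)" for u
    using tinv_eq[OF M d(1), of x u] dh d by (simp add: x_def)
  have v_eq: "(p, \<xi>) = (p, chart_vector M d p y)"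
    using tinv_tcoord[OF M d(1) TM(2)[OF v]] z ti by metis
  \<comment> \<open>The fibre coordinates over \<open>p\<close> that belong to \<open>A\<close>: an
    open neighbourhood of \<open>y\<close> on which \<open>F\<close> and \<open>G\<close> can be
    compared.\<close>
  define Y where "Y = {u. (x, u) \<in> coords d}"
  have Y_iff: "u \<in> Y \<longleftrightarrow> (p, chart_vector M d p u) \<in> A" for u
    using coords_iff[OF d(1), of "(x, u)"] ti dh(5)[OF d(2)] by (simp add: Y_def x_def)
  have "Y = (\<lambda>u. (x, u)) -` coords d" by (auto simp: Y_def)
  then have Y: "open Y" using open_coords[OF d(1)] by (auto intro!: continuous_open_vimage continuous_intros)
  have y: "y \<in> Y" using v v_eq Y_iff by metis
  have dc: "(x', J y) \<in> coords c" "(x, y) \<in> coords d"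
    using v TM[OF v] tc[of y] z v_eq by (metis IntI image_eqI)+
  have lJ: "(J has_derivative J) (at y)"
  proof -
    have "bounded_linear J"
      by (rule linear_conv_bounded_linear[THEN iffD1], rule linearI)
        (simp_all add: J_def vec_eq_iff sum.distrib algebra_simps sum_distrib_left)
    then show ?thesis by (rule bounded_linear_imp_has_derivative)
  qed
  have "((\<lambda>u. (x', J u)) has_derivative (\<lambda>w. (0, J w))) (at y)"
    by (intro has_derivative_Pair has_derivative_const lJ)
  moreover have "(G has_derivative frechet_derivative G (at (x', J y))) (at (x', J y))"
    by (rule smooth_on_has_derivative[OF G dc(1)])
  ultimately have "((\<lambda>u. G (x', J u)) has_derivative (\<lambda>w. frechet_derivative G (at (x', J y)) (0, J w))) (at y)"
    by (rule has_derivative_compose)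
  then have 1: "((\<lambda>u. F (x, u)) has_derivative (\<lambda>w. frechet_derivative G (at (x', J y)) (0, J w))) (at y)"
    by (rule has_derivative_transform_within_open[OF _ Y y]) (use FG Y_iff tc td in metis)
  have "((\<lambda>u. (x, u)) has_derivative (\<lambda>w. (0, w))) (at y)"
    by (intro has_derivative_Pair has_derivative_const has_derivative_ident)
  moreover have "(F has_derivative frechet_derivative F (at (x, y))) (at (x, y))"
    by (rule smooth_on_has_derivative[OF F dc(2)])
  ultimately have 2: "((\<lambda>u. F (x, u)) has_derivative (\<lambda>w. frechet_derivative F (at (x, y)) (0, w))) (at y)"
    by (rule has_derivative_compose)
  have lG: "linear (frechet_derivative G (at (x', J y)))"
    using smooth_on_differentiable[OF G dc(1)] linear_frechet_derivative by blast
  have "J (axis i 1) = (\<Sum>k\<in>UNIV. jac d c p k i *\<^sub>R axis k 1)"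
    by (simp add: J_def vec_eq_iff axis_def if_distrib cong: if_cong)
  then have "(0, J (axis i 1)) = (\<Sum>k\<in>UNIV. jac d c p k i *\<^sub>R (0 :: real^'n, axis k 1))"
    by (simp add: prod_eq_iff fst_sum snd_sum)
  moreover have "frechet_derivative F (at (x, y)) (0, axis i 1) = frechet_derivative G (at (x', J y)) (0, J (axis i 1))"
    using has_derivative_unique[OF 1 2] by metis
  ultimately have "dy i F (x, y) = (\<Sum>k\<in>UNIV. jac d c p k i * dy k G (x', J y))"
    by (simp add: dy_def linear_sum[OF lG] linear_scale[OF lG] del: scaleR_Pair)
  then show ?thesis using z tc[of y] v_eq by metis
qed

text \<open>Along the fibre the Jacobian entries are constants, so \<open>dy_change_chart\<close>
  applies a second time to the transformed first derivatives, and no second derivatives of the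
  transition map appear.\<close>

lemma g_change_chart:
  assumes c: "c \<in> M" "p \<in> cdom c" and d: "d \<in> M" "p \<in> cdom d" and v: "(p, \<xi>) \<in> A"
  shows "g d i j (tcoord d (p, \<xi>)) = (\<Sum>k\<in>UNIV. \<Sum>l\<in>UNIV. jac d c p k i * jac d c p l j * g c k l (tcoord c (p, \<xi>)))"
proof -
  have TM: "(p, \<xi>) \<in> tdom M c" "(p, \<xi>) \<in> tdom M d" if "(p, \<xi>) \<in> A" for \<xi>
    using that A c d by (auto simp: conic_domain_def tdom_def)
  let ?Lc = "\<lambda>z. L (tinv M c z)" and ?Ld = "\<lambda>z. L (tinv M d z)"
  have 1: "dy j ?Ld (tcoord d (p, \<xi>)) = (\<Sum>l\<in>UNIV. jac d c p l j * dy l ?Lc (tcoord c (p, \<xi>)))" if "(p, \<xi>) \<in> A" for \<xi>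
    by (rule dy_change_chart[OF c d L_smooth[OF d(1)] L_smooth[OF c(1)] _ that])
      (simp add: tinv_tcoord[OF M c(1) TM(1)] tinv_tcoord[OF M d(1) TM(2)])
  have s: "smooth_on (coords c) (\<lambda>z. jac d c p l j * dy l ?Lc z)" for l
    by (intro smooth_on_mult open_coords smooth_on_const smooth_on_dy L_smooth c)
  have dcz: "tcoord c (p, \<xi>) \<in> coords c" using v TM by blast
  have "dy i (dy j ?Ld) (tcoord d (p, \<xi>)) =
      (\<Sum>k\<in>UNIV. jac d c p k i * dy k (\<lambda>z. \<Sum>l\<in>UNIV. jac d c p l j * dy l ?Lc z) (tcoord c (p, \<xi>)))"
    by (rule dy_change_chart[OF c d smooth_on_dy[OF L_smooth[OF d(1)]] smooth_on_sum[OF open_coords[OF c(1)] s] 1 v])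
  also have "\<dots> = (\<Sum>k\<in>UNIV. jac d c p k i * (\<Sum>l\<in>UNIV. jac d c p l j * dy k (dy l ?Lc) (tcoord c (p, \<xi>))))"
  proof (intro sum.cong refl arg_cong[where f = "\<lambda>x. _ * x"])
    fix k
    show "dy k (\<lambda>z. \<Sum>l\<in>UNIV. jac d c p l j * dy l ?Lc z) (tcoord c (p, \<xi>))
        = (\<Sum>l\<in>UNIV. jac d c p l j * dy k (dy l ?Lc) (tcoord c (p, \<xi>)))"
      unfolding dy_def[of k] frechet_derivative_sum[OF smooth_on_differentiable[OF s dcz]]
      by (simp add: frechet_derivative_cmult[OF smooth_on_differentiable[OF smooth_on_dy[OF L_smooth[OF c(1)]] dcz]])
  qed
  finally show ?thesis by (simp add: g_comp_def sum_distrib_left mult_ac)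
qed

lemma fund_tensor_aniso: "fund_tensor M A L \<in> aniso_tensors M A 0 2"
proof (rule aniso_tensorsI)
  fix v assume v: "v \<in> A"
  show "fund_tensor M A L v \<in> tensors M 0 2 (fst v)"
  proof (rule tensorsI)
    fix c d :: "('m, 'n) chart" and "is" js :: "'n list"
    assume cd: "c \<in> M" "d \<in> M" "fst v \<in> cdom c" "fst v \<in> cdom d" and len: "length is = 0" "length js = 2"
    obtain i j where "js = [i, j]" using len(2) by (auto simp: numeral_2_eq_2 length_Suc_conv)
    then show "fund_tensor M A L v d is js = (\<Sum>ks | length ks = 0. \<Sum>ls | length ls = 2.
          (\<Prod>a<0. jac c d (fst v) (is ! a) (ks ! a)) * (\<Prod>b<2. jac d c (fst v) (ls ! b) (js ! b)) *
          fund_tensor M A L v c ks ls)"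
      using len v cd g_change_chart[OF cd(1,3,2,4), of "snd v" i j]
      by (simp add: numeral_2_eq_2 sum_length_Suc fund_tensor_def mult_ac)
  qed (auto simp: fund_tensor_def)
next
  fix c :: "('m, 'n) chart" and "is" js :: "'n list"
  assume c: "c \<in> M" and len: "length is = 0" "length js = 2"
  show "smooth_on (coords c) (\<lambda>z. fund_tensor M A L (tinv M c z) c is js)"
  proof (rule smooth_on_cong[OF open_coords[OF c] g_smooth[OF c]])
    show "g c (js ! 0) (js ! 1) z = fund_tensor M A L (tinv M c z) c is js" if "z \<in> coords c" for z
      using that len coords_iff[OF c] c tcoord_tinv[OF M c] tinv_in_tdom[OF M c]
      by (simp add: fund_tensor_def tdom_def)
  qed
qed (auto simp: fund_tensor_def tzero_def)

section \<open>The bracket derivative of the fundamental tensor in coordinates\<close>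

lemma sum_delta_minus_mult:
  "(\<Sum>i\<in>UNIV. ((if i = b then x else 0) - t * d i) * G i) = x * G b - t * (\<Sum>i\<in>UNIV. G i * d i)"
  for G d :: "'n \<Rightarrow> real"
proof -
  have "(\<Sum>i\<in>UNIV. ((if i = b then x else 0) - t * d i) * G i) =
      (\<Sum>i\<in>UNIV. (if i = b then x * G i else 0) - t * (G i * d i))"
    by (rule sum.cong) (auto simp: algebra_simps)
  then show ?thesis by (simp add: sum_subtractf sum_distrib_left)
qed

text \<open>The function g(E_a, E_b) of two cut-off coordinate fields is differentiated twice: by
  the rule for functions, and by the Leibniz rule with the known brackets of E_a and E_b. Comparison
  isolates the value on g.\<close>

lemma lie_bracket_fund_tensor:
  assumes X: "X \<in> aniso_tensors M A 1 0" and D: "is_lie_bracket M A L X \<D>"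
    and c: "c \<in> M" and v: "v \<in> A \<inter> tdom M c"
  defines "z \<equiv> tcoord c v"
  shows "\<D> (fund_tensor M A L) v c [] [a, b] =
    (\<Sum>k\<in>UNIV. X v c [k] [] * \<delta> M L c k (g c a b) z)
    + (\<Sum>k\<in>UNIV. g c k b z * \<delta> M L c a (\<lambda>z. X (tinv M c z) c [k] []) z)
    + (\<Sum>k\<in>UNIV. g c a k z * \<delta> M L c b (\<lambda>z. X (tinv M c z) c [k] []) z)"
proof -
  have p: "fst v \<in> cdom c" using v by (simp add: tdom_def)
  have z: "z \<in> coords c" using v by (simp add: z_def)
  obtain f E where f: "smooth_on UNIV f" "f (cmap c (fst v)) \<noteq> 0"
    and E: "\<And>a. E a \<in> aniso_tensors M A 1 0"
    and E_comp: "\<And>a w i. w \<in> A \<Longrightarrow> fst w \<in> cdom c \<Longrightarrow> E a w c [i] [] = (if i = a then f (cmap c (fst w)) else 0)"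
    using cut_off_coordinate_fields[OF c p] by blast
  let ?g = "fund_tensor M A L" and ?f = "\<lambda>z::(real^'n)\<times>(real^'n). f (fst z)"
  define xf where "xf = (\<Sum>k\<in>UNIV. X v c [k] [] * \<delta> M L c k ?f z)"
  define t where "t = f (cmap c (fst v))"
  have D': "tensor_derivation M A \<D>" using D unfolding is_lie_bracket_def by blast
  have g: "?g \<in> aniso_tensors M A 0 (Suc (Suc 0))" using fund_tensor_aniso by (simp add: numeral_2_eq_2)
  have ga: "(\<lambda>v. interior_product (E a v) (?g v)) \<in> aniso_tensors M A 0 (Suc 0)"
    by (rule aniso_interior_product[OF E g])
  \<comment> \<open>This is g(E_a, E_b), equal to f^2 g_ab in the coordinates of
    \<open>c\<close>.\<close>
  let ?h = "\<lambda>v. interior_product (E b v) (interior_product (E a v) (?g v))"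
  have h: "?h \<in> aniso_tensors M A 0 0" by (rule aniso_interior_product[OF E ga])
  have f_diff: "?f differentiable (at z)"
    by (rule smooth_on_differentiable[OF smooth_on_compose[OF open_UNIV open_UNIV _ f(1)
            smooth_on_bounded_linear[OF bounded_linear_fst open_UNIV]]]) auto
  have g_comp: "?g w c [] [i, j] = g c i j (tcoord c w)" if "w \<in> A" "fst w \<in> cdom c" for w i j
    using that c by (simp add: fund_tensor_def)
  have at: "w \<in> A \<and> fst w \<in> cdom c \<and> tcoord c w = z' \<and> cmap c (fst w) = fst z'"
    if "z' \<in> coords c" "w = tinv M c z'" for w z'
    using that coords_iff[OF c] tcoord_tinv[OF M c] tinv_in_tdom[OF M c]
    by (metis (no_types, lifting) fst_conv mem_Collect_eq tcoord_def tdom_def)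
  have h_coord: "?f z' * (?f z' * g c a b z') = ?h (tinv M c z') c [] []" if "z' \<in> coords c" for z'
  proof -
    note w = at[OF that refl]
    show ?thesis using w
      by (simp add: interior_product_def E_comp g_comp if_distrib[where f = "\<lambda>x. x * _"] cong: if_cong)
  qed
  have E_coord: "(if i = a' then ?f z' else 0) = E a' (tinv M c z') c [i] []" if "z' \<in> coords c" for z' a' i
    using at[OF that refl] by (simp add: E_comp)
  \<comment> \<open>The bracket of \<open>X\<close> with \<open>f\<close> times a coordinate field:
    \<open>xf\<close> is the horizontal derivative of \<open>f\<close> along \<open>X\<close>, and
    the second term differentiates the components of \<open>X\<close>.\<close>
  have DE: "\<D> (E a') v c [i] [] = (if i = a' then xf else 0) - t * \<delta> M L c a' (\<lambda>z. X (tinv M c z) c [i] []) z" for a' i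
  proof -
    have "\<D> (E a') v c [i] [] = (\<Sum>j\<in>UNIV.
          X v c [j] [] * \<delta> M L c j (\<lambda>z. E a' (tinv M c z) c [i] []) z
          - E a' v c [j] [] * \<delta> M L c j (\<lambda>z. X (tinv M c z) c [i] []) z)"
      using D E c v unfolding is_lie_bracket_def z_def by blast
    moreover have dE: "\<delta> M L c j (\<lambda>z. E a' (tinv M c z) c [i] []) z = (if i = a' then \<delta> M L c j ?f z else 0)" for j
    proof -
      have "\<delta> M L c j (\<lambda>z. if i = a' then ?f z else 0) z = \<delta> M L c j (\<lambda>z. E a' (tinv M c z) c [i] []) z"
      proof (rule \<delta>_cong[OF open_coords[OF c] z E_coord])
        show "(\<lambda>z. if i = a' then ?f z else 0) differentiable (at z)"
          using f_diff by (cases "i = a'") simp_all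
      qed
      then show ?thesis by (cases "i = a'") (simp_all add: \<delta>_zero)
    qed
    ultimately show ?thesis
      using v p by (simp add: dE E_comp sum_subtractf xf_def t_def if_distrib[where f = "\<lambda>x. x * _"] cong: if_cong)
  qed
  have "\<D> ?h v c [] [] = (\<Sum>k\<in>UNIV. X v c [k] [] * \<delta> M L c k (\<lambda>z. ?h (tinv M c z) c [] []) z)"
    using D h c v unfolding is_lie_bracket_def z_def by blast
  also have "\<dots> = (\<Sum>k\<in>UNIV. X v c [k] [] * (t * (t * \<delta> M L c k (g c a b) z) + 2 * t * g c a b z * \<delta> M L c k ?f z))"
  proof (intro sum.cong refl arg_cong[where f = "\<lambda>x. _ * x"])
    fix k
    have gd: "g c a b differentiable (at z)" by (rule g_differentiable[OF c z])
    have ft: "f (fst z) = t" by (simp add: z_def t_def tcoord_def)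
    have "\<delta> M L c k (\<lambda>z. ?h (tinv M c z) c [] []) z = \<delta> M L c k (\<lambda>z. ?f z * (?f z * g c a b z)) z"
      by (rule \<delta>_cong[OF open_coords[OF c] z h_coord, symmetric]) (use f_diff gd in \<open>auto intro!: differentiable_mult\<close>)
    also have "\<dots> = t * (t * \<delta> M L c k (g c a b) z + \<delta> M L c k ?f z * g c a b z) + \<delta> M L c k ?f z * (t * g c a b z)"
      using f_diff gd by (subst \<delta>_mult, simp, simp add: differentiable_mult, subst \<delta>_mult) (simp_all add: ft)
    finally show "\<delta> M L c k (\<lambda>z. ?h (tinv M c z) c [] []) z =
        t * (t * \<delta> M L c k (g c a b) z) + 2 * t * g c a b z * \<delta> M L c k ?f z"
      by (simp add: algebra_simps)
  qed
  also have "\<dots> = t * t * (\<Sum>k\<in>UNIV. X v c [k] [] * \<delta> M L c k (g c a b) z) + 2 * t * g c a b z * xf"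
    by (simp add: xf_def sum.distrib sum_distrib_left algebra_simps)
  finally have 1: "\<D> ?h v c [] [] = \<dots>" .
  have "\<D> ?h v c [] [] = (\<Sum>i\<in>UNIV. \<D> (E b) v c [i] [] * (t * g c a i z))
      + t * ((\<Sum>i\<in>UNIV. \<D> (E a) v c [i] [] * g c i b z) + t * \<D> ?g v c [] [a, b])"
    unfolding tensor_derivation_interior_product[OF D' E ga] tensor_derivation_interior_product[OF D' E g]
    using v p
    by (simp add: tadd_def interior_product_def E_comp g_comp t_def[symmetric] z_def[symmetric]
        if_distrib[where f = "\<lambda>x. x * _"] cong: if_cong)
  also have "(\<Sum>i\<in>UNIV. \<D> (E b) v c [i] [] * (t * g c a i z)) =
      t * g c a b z * xf - t * t * (\<Sum>i\<in>UNIV. g c a i z * \<delta> M L c b (\<lambda>z. X (tinv M c z) c [i] []) z)"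
    unfolding DE sum_delta_minus_mult by (simp add: sum_distrib_left mult_ac)
  also have "(\<Sum>i\<in>UNIV. \<D> (E a) v c [i] [] * g c i b z) =
      g c a b z * xf - t * (\<Sum>i\<in>UNIV. g c i b z * \<delta> M L c a (\<lambda>z. X (tinv M c z) c [i] []) z)"
    unfolding DE sum_delta_minus_mult by (simp add: mult_ac)
  \<comment> \<open>The derivative of the bump function contributes
    \<open>2 * t * g c a b z * xf\<close> to both evaluations and cancels; \<open>t\<close> is its
    value at the point, nonzero by choice.\<close>
  finally have "t * t * \<D> ?g v c [] [a, b] = t * t * ((\<Sum>k\<in>UNIV. X v c [k] [] * \<delta> M L c k (g c a b) z)
    + (\<Sum>k\<in>UNIV. g c k b z * \<delta> M L c a (\<lambda>z. X (tinv M c z) c [k] []) z)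
    + (\<Sum>k\<in>UNIV. g c a k z * \<delta> M L c b (\<lambda>z. X (tinv M c z) c [k] []) z))"
    using 1 by (simp add: algebra_simps)
  then show ?thesis using f(2) by (simp add: t_def)
qed

end

section \<open>The divergence formula\<close>

lemma sum_delta_mult_right: "(\<Sum>l\<in>UNIV. g l * (if l = k then 1 else 0)) = (g k :: real)" for k :: "'n::finite"
  using sum_delta_mult[of k g] by (simp add: mult.commute)

lemma sum_delta_mult': "(\<Sum>l\<in>UNIV. (if k = l then 1 else 0) * g l) = (g k :: real)" for k :: "'n::finite"
  using sum_delta_mult[of k g] by (simp add: eq_commute)

lemma sum_symmetric_antisymmetric:
  fixes S W :: "'n::finite \<Rightarrow> 'n \<Rightarrow> real"
  assumes "\<And>i j. S i j = S j i" "\<And>i j. W i j = - W j i"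
  shows "(\<Sum>i\<in>UNIV. \<Sum>j\<in>UNIV. S i j * W i j) = 0"
proof -
  have "(\<Sum>i\<in>UNIV. \<Sum>j\<in>UNIV. S i j * W i j) = (\<Sum>j\<in>UNIV. \<Sum>i\<in>UNIV. S i j * W i j)"
    by (rule sum.swap)
  also have "\<dots> = (\<Sum>j\<in>UNIV. \<Sum>i\<in>UNIV. - (S j i * W j i))"
    by (intro sum.cong refl) (metis assms mult_minus_right)
  also have "\<dots> = - (\<Sum>i\<in>UNIV. \<Sum>j\<in>UNIV. S i j * W i j)"
    by (simp add: sum_negf)
  finally show ?thesis by simp
qed

text \<open>Here \<open>G\<close> is the metric, \<open>Gi\<close> its inverse, and
  \<open>K i j\<close> stands for \<open>\<nabla>_i X^j\<close>. The antisymmetric array is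
  contracted with the symmetric \<open>Gi\<close>; then \<open>Gi\<close> cancels \<open>G\<close>
  and the trace is left.\<close>

lemma trace_zero_of_antisymmetric:
  fixes G Gi T K :: "'n::finite \<Rightarrow> 'n \<Rightarrow> real"
  assumes inv: "\<And>i k. (\<Sum>j\<in>UNIV. Gi i j * G j k) = (if i = k then 1 else 0)"
    and sym: "\<And>i j. Gi i j = Gi j i"
    and anti: "\<And>i j. (\<Sum>l\<in>UNIV. (\<Sum>k\<in>UNIV. G i k * T k l) * K j l) = - (\<Sum>l\<in>UNIV. (\<Sum>k\<in>UNIV. G j k * T k l) * K i l)"
  shows "(\<Sum>i\<in>UNIV. \<Sum>j\<in>UNIV. T i j * K i j) = 0"
proof -
  have "(\<Sum>i\<in>UNIV. \<Sum>j\<in>UNIV. Gi i j * (\<Sum>l\<in>UNIV. (\<Sum>k\<in>UNIV. G i k * T k l) * K j l)) = 0"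
    by (rule sum_symmetric_antisymmetric[OF sym anti])
  also have "(\<Sum>i\<in>UNIV. \<Sum>j\<in>UNIV. Gi i j * (\<Sum>l\<in>UNIV. (\<Sum>k\<in>UNIV. G i k * T k l) * K j l))
      = (\<Sum>j\<in>UNIV. \<Sum>l\<in>UNIV. (\<Sum>k\<in>UNIV. (\<Sum>i\<in>UNIV. Gi j i * G i k) * T k l) * K j l)"
  proof (subst sum.swap, rule sum.cong[OF refl])
    fix j
    have "(\<Sum>i\<in>UNIV. Gi i j * (\<Sum>l\<in>UNIV. (\<Sum>k\<in>UNIV. G i k * T k l) * K j l))
        = (\<Sum>i\<in>UNIV. \<Sum>l\<in>UNIV. \<Sum>k\<in>UNIV. Gi j i * G i k * T k l * K j l)"
      by (simp add: sum_distrib_left sum_distrib_right mult_ac sym[of _ j])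
    also have "\<dots> = (\<Sum>l\<in>UNIV. \<Sum>k\<in>UNIV. \<Sum>i\<in>UNIV. Gi j i * G i k * T k l * K j l)"
      by (subst sum.swap, rule sum.cong[OF refl], subst sum.swap) simp
    finally show "(\<Sum>i\<in>UNIV. Gi i j * (\<Sum>l\<in>UNIV. (\<Sum>k\<in>UNIV. G i k * T k l) * K j l))
        = (\<Sum>l\<in>UNIV. (\<Sum>k\<in>UNIV. (\<Sum>i\<in>UNIV. Gi j i * G i k) * T k l) * K j l)"
      by (simp add: sum_distrib_right)
  qed
  finally show ?thesis unfolding inv sum_delta_mult' .
qed

text \<open>Raising both indices of the symmetric \<open>G T\<close> and lowering the free index of \<open>K\<close> turns the trace into
  the contraction of a symmetric with an antisymmetric array.\<close>

lemma trace_zero_of_symmetric: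
  fixes G Gi T K :: "'n::finite \<Rightarrow> 'n \<Rightarrow> real"
  assumes inv: "\<And>i k. (\<Sum>j\<in>UNIV. Gi i j * G j k) = (if i = k then 1 else 0)"
    and sym: "\<And>i j. Gi i j = Gi j i"
    and T: "\<And>i j. (\<Sum>k\<in>UNIV. G i k * T k j) = (\<Sum>k\<in>UNIV. G j k * T k i)"
    and K: "\<And>i j. (\<Sum>m\<in>UNIV. G j m * K i m) = - (\<Sum>m\<in>UNIV. G i m * K j m)"
  shows "(\<Sum>i\<in>UNIV. \<Sum>j\<in>UNIV. T i j * K i j) = 0"
proof -
  define S where "S i j = (\<Sum>k\<in>UNIV. G i k * T k j)" for i j
  define W where "W i j = (\<Sum>m\<in>UNIV. G j m * K i m)" for i j
  define R where "R i b = (\<Sum>j\<in>UNIV. Gi j b * (\<Sum>a\<in>UNIV. Gi i a * S a j))" for i b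
  have contr: "(\<Sum>a\<in>UNIV. Gi i a * (\<Sum>k\<in>UNIV. G a k * F k)) = F i" for i F
  proof -
    have "(\<Sum>a\<in>UNIV. Gi i a * (\<Sum>k\<in>UNIV. G a k * F k)) = (\<Sum>k\<in>UNIV. (\<Sum>a\<in>UNIV. Gi i a * G a k) * F k)"
      unfolding sum_distrib_left sum_distrib_right by (subst sum.swap) (simp add: mult_ac)
    then show ?thesis unfolding inv sum_delta_mult' .
  qed
  have "R i b = R b i" for i b
  proof -
    have "R i b = (\<Sum>j\<in>UNIV. \<Sum>a\<in>UNIV. Gi j b * (Gi i a * S a j))"
      by (simp add: R_def sum_distrib_left)
    also have "\<dots> = (\<Sum>a\<in>UNIV. \<Sum>j\<in>UNIV. Gi a i * (Gi b j * S j a))"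
    proof (subst sum.swap, intro sum.cong refl)
      fix a j
      have "S a j = S j a" unfolding S_def by (rule T)
      then show "Gi j b * (Gi i a * S a j) = Gi a i * (Gi b j * S j a)"
        using sym[of j b] sym[of i a] by simp
    qed
    also have "\<dots> = R b i" by (simp add: R_def sum_distrib_left)
    finally show ?thesis .
  qed
  moreover have "W i b = - W b i" for i b unfolding W_def by (rule K)
  ultimately have "(\<Sum>i\<in>UNIV. \<Sum>b\<in>UNIV. R i b * W i b) = 0" by (rule sum_symmetric_antisymmetric)
  moreover have "(\<Sum>b\<in>UNIV. R i b * W i b) = (\<Sum>j\<in>UNIV. T i j * K i j)" for i
  proof -
    have R: "R i b = (\<Sum>j\<in>UNIV. Gi j b * T i j)" for b
      by (simp add: R_def S_def contr)
    have "(\<Sum>b\<in>UNIV. R i b * W i b) = (\<Sum>j\<in>UNIV. T i j * (\<Sum>b\<in>UNIV. Gi j b * W i b))"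
      unfolding R sum_distrib_left sum_distrib_right by (subst sum.swap) (simp add: mult_ac)
    then show ?thesis by (simp add: W_def contr)
  qed
  ultimately show ?thesis by simp
qed

text \<open>The Christoffel term for the lower index of \<open>T\<close> cancels against the
  Christoffel term of the derivative of \<open>X\<close>, since both have the direction of
  differentiation in the same slot; the rest is the product rule.\<close>

lemma divergence_of_contraction:
  fixes \<Gamma> :: "'n::finite \<Rightarrow> 'n \<Rightarrow> 'n \<Rightarrow> real" and T dT dX :: "'n \<Rightarrow> 'n \<Rightarrow> real" and X :: "'n \<Rightarrow> real"
  shows "(\<Sum>i\<in>UNIV. \<Sum>j\<in>UNIV. T i j * dX i j + dT i j * X j) + (\<Sum>i\<in>UNIV. \<Sum>l\<in>UNIV. \<Gamma> i i l * (\<Sum>j\<in>UNIV. T l j * X j))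
    = (\<Sum>j\<in>UNIV. (\<Sum>i\<in>UNIV. dT i j + (\<Sum>l\<in>UNIV. \<Gamma> i i l * T l j) - (\<Sum>l\<in>UNIV. \<Gamma> l i j * T i l)) * X j)
      + (\<Sum>i\<in>UNIV. \<Sum>j\<in>UNIV. T i j * (dX i j + (\<Sum>l\<in>UNIV. \<Gamma> j i l * X l)))"
proof -
  have a: "(\<Sum>j\<in>UNIV. (\<Sum>i\<in>UNIV. dT i j + (\<Sum>l\<in>UNIV. \<Gamma> i i l * T l j) - (\<Sum>l\<in>UNIV. \<Gamma> l i j * T i l)) * X j)
    = (\<Sum>i\<in>UNIV. \<Sum>j\<in>UNIV. dT i j * X j) + (\<Sum>i\<in>UNIV. \<Sum>l\<in>UNIV. \<Sum>j\<in>UNIV. \<Gamma> i i l * T l j * X j)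
      - (\<Sum>i\<in>UNIV. \<Sum>j\<in>UNIV. \<Sum>l\<in>UNIV. \<Gamma> l i j * T i l * X j)"
  proof -
    have "(\<Sum>j\<in>UNIV. (\<Sum>i\<in>UNIV. dT i j + (\<Sum>l\<in>UNIV. \<Gamma> i i l * T l j) - (\<Sum>l\<in>UNIV. \<Gamma> l i j * T i l)) * X j)
      = (\<Sum>i\<in>UNIV. \<Sum>j\<in>UNIV. (dT i j + (\<Sum>l\<in>UNIV. \<Gamma> i i l * T l j) - (\<Sum>l\<in>UNIV. \<Gamma> l i j * T i l)) * X j)"
      unfolding sum_distrib_right by (rule sum.swap)
    also have "\<dots> = (\<Sum>i\<in>UNIV. (\<Sum>j\<in>UNIV. dT i j * X j) + (\<Sum>j\<in>UNIV. \<Sum>l\<in>UNIV. \<Gamma> i i l * T l j * X j)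
      - (\<Sum>j\<in>UNIV. \<Sum>l\<in>UNIV. \<Gamma> l i j * T i l * X j))"
      by (simp add: algebra_simps sum.distrib sum_subtractf sum_distrib_left)
    also have "\<dots> = (\<Sum>i\<in>UNIV. (\<Sum>j\<in>UNIV. dT i j * X j) + (\<Sum>l\<in>UNIV. \<Sum>j\<in>UNIV. \<Gamma> i i l * T l j * X j)
      - (\<Sum>j\<in>UNIV. \<Sum>l\<in>UNIV. \<Gamma> l i j * T i l * X j))"
      by (subst sum.swap[of "\<lambda>j l. \<Gamma> _ _ l * T l j * X j"]) (rule refl)
    finally show ?thesis by (simp add: sum.distrib sum_subtractf)
  qed
  have "(\<Sum>j\<in>UNIV. T i j * (\<Sum>l\<in>UNIV. \<Gamma> j i l * X l)) = (\<Sum>j\<in>UNIV. \<Sum>l\<in>UNIV. \<Gamma> l i j * T i l * X j)" for i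
    unfolding sum_distrib_left by (subst sum.swap) (simp add: mult_ac)
  then have b: "(\<Sum>i\<in>UNIV. \<Sum>j\<in>UNIV. T i j * (dX i j + (\<Sum>l\<in>UNIV. \<Gamma> j i l * X l)))
    = (\<Sum>i\<in>UNIV. \<Sum>j\<in>UNIV. T i j * dX i j) + (\<Sum>i\<in>UNIV. \<Sum>j\<in>UNIV. \<Sum>l\<in>UNIV. \<Gamma> l i j * T i l * X j)"
    by (simp add: distrib_left sum.distrib)
  have "(\<Sum>i\<in>UNIV. \<Sum>l\<in>UNIV. \<Gamma> i i l * (\<Sum>j\<in>UNIV. T l j * X j)) = (\<Sum>i\<in>UNIV. \<Sum>l\<in>UNIV. \<Sum>j\<in>UNIV. \<Gamma> i i l * T l j * X j)"
    by (simp add: sum_distrib_left mult_ac)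
  then show ?thesis unfolding a b by (simp add: sum.distrib)
qed

section \<open>Chern connection and mean Cartan tensor in coordinates\<close>

context pseudo_finsler_manifold
begin

context
  fixes c z
  assumes c: "c \<in> M" and z: "z \<in> coords c"
begin

lemma g_inv_left: "(\<Sum>j\<in>UNIV. g_inv M L c i j z * g c j k z) = (if i = k then 1 else 0)"
  using matrix_inv(1)[OF det_g_nonzero[OF c z]]
  by (simp add: vec_eq_iff matrix_matrix_mult_def mat_def g_inv_def g_mat_def[symmetric]) (simp add: g_mat_def)

lemma g_inv_right: "(\<Sum>j\<in>UNIV. g c i j z * g_inv M L c j k z) = (if i = k then 1 else 0)"
  using matrix_inv(2)[OF det_g_nonzero[OF c z]]
  by (simp add: vec_eq_iff matrix_matrix_mult_def mat_def g_inv_def g_mat_def[symmetric]) (simp add: g_mat_def)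

lemma g_inv_sym: "g_inv M L c i j z = g_inv M L c j i z"
proof -
  let ?h = "\<lambda>i j. g_inv M L c i j z"
  have "?h i j = (\<Sum>k\<in>UNIV. ?h i k * (\<Sum>l\<in>UNIV. ?h j l * g c l k z))"
    unfolding g_inv_left by (simp add: eq_commute[of j] sum_delta_mult_right)
  also have "\<dots> = (\<Sum>l\<in>UNIV. (\<Sum>k\<in>UNIV. ?h i k * g c k l z) * ?h j l)"
    unfolding sum_distrib_left sum_distrib_right
    by (subst sum.swap) (simp add: mult_ac g_sym[OF c z, of k l for k l])
  also have "\<dots> = ?h j i" unfolding g_inv_left sum_delta_mult' ..
  finally show ?thesis .
qed

text \<open>Since \<open>g_inv\<close> is symmetric, the last two terms of the Christoffel symbol
  cancel after an exchange of summation indices. What remains is the horizontal logarithmic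
  derivative of sqrt |det g|.\<close>

lemma chern_trace:
  "(\<Sum>i\<in>UNIV. chern M L c i i l z) = 1/2 * (\<Sum>a\<in>UNIV. \<Sum>b\<in>UNIV. g_inv M L c b a z * \<delta> M L c l (g c a b) z)"
proof -
  let ?h = "\<lambda>i j. g_inv M L c i j z"
  have "(\<Sum>i\<in>UNIV. \<Sum>m\<in>UNIV. ?h i m * \<delta> M L c m (g c i l) z) = (\<Sum>i\<in>UNIV. \<Sum>m\<in>UNIV. ?h m i * \<delta> M L c i (g c m l) z)"
    by (rule sum.swap)
  then have "(\<Sum>i\<in>UNIV. \<Sum>m\<in>UNIV. ?h i m * \<delta> M L c m (g c i l) z) = (\<Sum>i\<in>UNIV. \<Sum>m\<in>UNIV. ?h i m * \<delta> M L c i (g c m l) z)"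
    using g_inv_sym by simp
  moreover have "(\<Sum>i\<in>UNIV. chern M L c i i l z) = 1/2 * ((\<Sum>i\<in>UNIV. \<Sum>m\<in>UNIV. ?h i m * \<delta> M L c l (g c m i) z)
      + (\<Sum>i\<in>UNIV. \<Sum>m\<in>UNIV. ?h i m * \<delta> M L c i (g c m l) z) - (\<Sum>i\<in>UNIV. \<Sum>m\<in>UNIV. ?h i m * \<delta> M L c m (g c i l) z))"
    by (simp add: chern_def sum_distrib_left algebra_simps sum.distrib sum_subtractf sum_divide_distrib[symmetric])
  moreover have "(\<Sum>i\<in>UNIV. \<Sum>m\<in>UNIV. ?h i m * \<delta> M L c l (g c m i) z) = (\<Sum>a\<in>UNIV. \<Sum>b\<in>UNIV. ?h b a * \<delta> M L c l (g c a b) z)"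
    by (rule sum.swap)
  ultimately show ?thesis by simp
qed

lemma chern_lower:
  "(\<Sum>m\<in>UNIV. g c b m z * chern M L c m j k z) =
    1/2 * (\<delta> M L c k (g c b j) z + \<delta> M L c j (g c b k) z - \<delta> M L c b (g c j k) z)"
proof -
  let ?F = "\<lambda>l. \<delta> M L c k (g c l j) z + \<delta> M L c j (g c l k) z - \<delta> M L c l (g c j k) z"
  have "(\<Sum>m\<in>UNIV. g c b m z * chern M L c m j k z) =
      1/2 * (\<Sum>l\<in>UNIV. (\<Sum>m\<in>UNIV. g c b m z * g_inv M L c m l z) * ?F l)"
    unfolding chern_def sum_distrib_left sum_distrib_right by (subst sum.swap) (simp add: mult_ac)
  then show ?thesis unfolding g_inv_right sum_delta_mult' .
qed

text \<open>The vertical counterpart of \<open>chern_trace\<close>: total symmetry of the Cartan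
  tensor moves the differentiation to the index \<open>k\<close>, which exhibits the vertical
  logarithmic derivative of sqrt |det g|.\<close>

lemma mean_cartan_eq:
  "mean_cartan M L c k z = 1/2 * (\<Sum>a\<in>UNIV. \<Sum>b\<in>UNIV. g_inv M L c b a z * dy k (g c a b) z)"
proof -
  have "dy b (g c a k) z = dy k (g c a b) z" for a b
    using dy_g_commute[OF c z, of b k a] dy_g_sym[OF c z] by metis
  then show ?thesis
    using g_inv_sym by (simp add: mean_cartan_def cartan_def sum_distrib_left sum_divide_distrib)
qed

text \<open>By \<open>chern_lower\<close>, the lowered Christoffel terms for (i,j) and (j,i) add up
  to \<open>\<delta>_k g_ij\<close>, the other derivatives of g cancelling in pairs. So the
  symmetrised covariant derivative of \<open>X\<close> is the expression assumed to vanish.\<close>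

lemma covd_killing:
  assumes "(\<Sum>k\<in>UNIV. X (tinv M c z) c [k] [] * \<delta> M L c k (g c i j) z)
    + (\<Sum>k\<in>UNIV. g c k j z * \<delta> M L c i (\<lambda>z. X (tinv M c z) c [k] []) z)
    + (\<Sum>k\<in>UNIV. g c i k z * \<delta> M L c j (\<lambda>z. X (tinv M c z) c [k] []) z) = 0"
  shows "(\<Sum>m\<in>UNIV. g c j m z * covd M L c i X [m] [] z) = - (\<Sum>m\<in>UNIV. g c i m z * covd M L c j X [m] [] z)"
proof -
  let ?X = "\<lambda>k. X (tinv M c z) c [k] []" and ?dX = "\<lambda>i k. \<delta> M L c i (\<lambda>z. X (tinv M c z) c [k] []) z"
  have low: "(\<Sum>m\<in>UNIV. g c b m z * covd M L c a X [m] [] z) = (\<Sum>m\<in>UNIV. g c b m z * ?dX a m)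
      + (\<Sum>k\<in>UNIV. 1/2 * (\<delta> M L c k (g c b a) z + \<delta> M L c a (g c b k) z - \<delta> M L c b (g c a k) z) * ?X k)" for a b
  proof -
    have "(\<Sum>m\<in>UNIV. g c b m z * covd M L c a X [m] [] z) = (\<Sum>m\<in>UNIV. g c b m z * ?dX a m)
      + (\<Sum>m\<in>UNIV. g c b m z * (\<Sum>k\<in>UNIV. chern M L c m a k z * ?X k))"
      by (simp add: covd_def distrib_left sum.distrib)
    also have "(\<Sum>m\<in>UNIV. g c b m z * (\<Sum>k\<in>UNIV. chern M L c m a k z * ?X k))
        = (\<Sum>k\<in>UNIV. (\<Sum>m\<in>UNIV. g c b m z * chern M L c m a k z) * ?X k)"
      unfolding sum_distrib_left sum_distrib_right by (subst sum.swap) (simp add: mult_ac)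
    finally show ?thesis unfolding chern_lower .
  qed
  have "(\<Sum>k\<in>UNIV. 1/2 * (\<delta> M L c k (g c j i) z + \<delta> M L c i (g c j k) z - \<delta> M L c j (g c i k) z) * ?X k)
    + (\<Sum>k\<in>UNIV. 1/2 * (\<delta> M L c k (g c i j) z + \<delta> M L c j (g c i k) z - \<delta> M L c i (g c j k) z) * ?X k)
    = (\<Sum>k\<in>UNIV. ?X k * \<delta> M L c k (g c i j) z)"
    unfolding sum.distrib[symmetric] \<delta>_g_sym[OF c z, of _ j i]
    by (intro sum.cong refl) (simp add: field_simps)
  moreover have "(\<Sum>k\<in>UNIV. g c k j z * ?dX i k) = (\<Sum>k\<in>UNIV. g c j k z * ?dX i k)"
    using g_sym[OF c z] by simp
  ultimately show ?thesis using assms unfolding low by simp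
qed

text \<open>The left side is \<open>\<nabla>_i Z^i\<close> for Z = T(X), with the Christoffel trace
  isolated in the form in which \<open>divergence_coordinates\<close> produces it.\<close>

lemma divergence_tapply:
  assumes T: "T \<in> aniso_tensors M A 1 1" and X: "X \<in> aniso_tensors M A 1 0"
  shows "(\<Sum>i\<in>UNIV. \<delta> M L c i (\<lambda>z. tapply (T (tinv M c z)) (X (tinv M c z)) c [i] []) z)
      + (\<Sum>l\<in>UNIV. (\<Sum>i\<in>UNIV. chern M L c i i l z) * tapply (T (tinv M c z)) (X (tinv M c z)) c [l] [])
    = (\<Sum>j\<in>UNIV. div_comp M L c T j z * X (tinv M c z) c [j] [])
      + (\<Sum>i\<in>UNIV. \<Sum>j\<in>UNIV. T (tinv M c z) c [i] [j] * covd M L c i X [j] [] z)"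
proof -
  have dT: "(\<lambda>z. T (tinv M c z) c [i] [j]) differentiable (at z)" for i j
    by (rule smooth_on_differentiable[OF aniso_tensorsD(3)[OF T c] z]) simp_all
  have dX: "(\<lambda>z. X (tinv M c z) c [j] []) differentiable (at z)" for j
    by (rule smooth_on_differentiable[OF aniso_tensorsD(3)[OF X c] z]) simp_all
  have "\<delta> M L c i (\<lambda>z. tapply (T (tinv M c z)) (X (tinv M c z)) c [i] []) z =
      (\<Sum>j\<in>UNIV. T (tinv M c z) c [i] [j] * \<delta> M L c i (\<lambda>z. X (tinv M c z) c [j] []) z
        + \<delta> M L c i (\<lambda>z. T (tinv M c z) c [i] [j]) z * X (tinv M c z) c [j] [])" for i
    unfolding tapply_def by (simp add: \<delta>_sum \<delta>_mult dT dX differentiable_mult)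
  moreover have "(\<Sum>l\<in>UNIV. (\<Sum>i\<in>UNIV. chern M L c i i l z) * Z l) = (\<Sum>i\<in>UNIV. \<Sum>l\<in>UNIV. chern M L c i i l z * Z l)"
    for Z :: "'n \<Rightarrow> real"
    unfolding sum_distrib_right by (rule sum.swap)
  ultimately show ?thesis
    using divergence_of_contraction[where \<Gamma> = "\<lambda>i j k. chern M L c i j k z" and T = "\<lambda>i j. T (tinv M c z) c [i] [j]"
        and dX = "\<lambda>i j. \<delta> M L c i (\<lambda>z. X (tinv M c z) c [j] []) z"
        and dT = "\<lambda>i j. \<delta> M L c i (\<lambda>z. T (tinv M c z) c [i] [j]) z"
        and X = "\<lambda>j. X (tinv M c z) c [j] []"]
    by (simp add: div_comp_def covd_def tapply_def)
qed

end

end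

section \<open>Differentiation along the section \<open>V\<close>\<close>

definition section_coord :: "('m \<Rightarrow> ('m, 'n::finite) tensor) \<Rightarrow> ('m, 'n) chart \<Rightarrow> real^'n \<Rightarrow> (real^'n) \<times> (real^'n)" where
  "section_coord V c x = (x, \<chi> i. V (cinv c x) c [i] [])"

context pseudo_finsler_manifold
begin

lemma aniso_tapply:
  assumes T: "T \<in> aniso_tensors M A 1 1" and X: "X \<in> aniso_tensors M A 1 0"
  shows "(\<lambda>v. tapply (T v) (X v)) \<in> aniso_tensors M A 1 0"
proof (rule aniso_tensorsI)
  show "smooth_on (coords c) (\<lambda>z. tapply (T (tinv M c z)) (X (tinv M c z)) c is js)"
    if "c \<in> M" "length is = 1" "length js = 0" for c "is" js
    unfolding tapply_def using that
    by (intro smooth_on_sum smooth_on_mult open_coords aniso_tensorsD(3)[OF T] aniso_tensorsD(3)[OF X]) auto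
  show "tapply (T v) (X v) = tzero" if "v \<notin> A" for v
    using aniso_tensorsD(2)[OF T that] by (simp add: tapply_def tzero_def)
qed (rule tapply_in_tensors[OF M aniso_tensorsD(1)[OF T] aniso_tensorsD(1)[OF X]])

context
  fixes c U V
  assumes c: "c \<in> M" and U: "open U" and V: "V \<in> admissible_fields M A U"
begin

abbreviation "chart_image \<equiv> cmap c ` (U \<inter> cdom c)"

lemma open_chart_image: "open chart_image"
  by (rule open_cmap_image[OF chart[OF M c] U])

lemma V_in_tdom: "p \<in> U \<Longrightarrow> p \<in> cdom c \<Longrightarrow> (p, V p) \<in> A \<inter> tdom M c"
  using V A unfolding admissible_fields_def conic_domain_def tdom_def by auto

lemma section_coord_cmap: "p \<in> cdom c \<Longrightarrow> section_coord V c (cmap c p) = tcoord c (p, V p)"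
  using is_chartD(6)[OF chart[OF M c]] by (simp add: section_coord_def tcoord_def)

lemma section_coord_in_coords: "x \<in> chart_image \<Longrightarrow> section_coord V c x \<in> coords c"
  using section_coord_cmap V_in_tdom by auto

lemma tinv_section_coord: "x \<in> chart_image \<Longrightarrow> tinv M c (section_coord V c x) = (cinv c x, V (cinv c x))"
  using section_coord_cmap V_in_tdom tinv_tcoord[OF M c] is_chartD(6)[OF chart[OF M c]] by auto

lemma V_comp_smooth: "smooth_on chart_image (\<lambda>x. V (cinv c x) c [i] [])"
  using V c unfolding admissible_fields_def tensor_field_on_def by simp

lemma section_coord_smooth: "smooth_on chart_image (section_coord V c)"
  unfolding section_coord_def[abs_def]
  by (rule smooth_on_Pair[OF open_chart_image _ smooth_on_vec[OF open_chart_image]])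
    (use V_comp_smooth in \<open>simp_all add: smooth_on_def C_on_ident open_chart_image\<close>)

lemma smooth_on_section:
  assumes "smooth_on (coords c) F"
  shows "smooth_on chart_image (\<lambda>x. F (section_coord V c x))"
  by (rule smooth_on_compose[OF open_chart_image open_coords[OF c] section_coord_in_coords assms section_coord_smooth])

context
  fixes p
  assumes p: "p \<in> U" "p \<in> cdom c"
begin

abbreviation "base \<equiv> tcoord c (p, V p)"

text \<open>\<open>DV i j\<close> is the \<open>i\<close>-th component of the nonlinear covariant derivative of \<open>V\<close> along \<open>\<partial>\<^sub>j\<close> at \<open>p\<close>.\<close>

definition DV :: "'n \<Rightarrow> 'n \<Rightarrow> real" where
  "DV i j = frechet_derivative (\<lambda>x. V (cinv c x) c [i] []) (at (cmap c p)) (axis j 1) + nonlin M L c i j base"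

lemma base_in_coords: "base \<in> coords c" "cmap c p \<in> chart_image"
  using V_in_tdom p by auto

lemma section_has_derivative:
  "(section_coord V c has_derivative
    (\<lambda>w. (w, \<chi> i. frechet_derivative (\<lambda>x. V (cinv c x) c [i] []) (at (cmap c p)) w))) (at (cmap c p))"
proof -
  have "((\<lambda>x. \<chi> i. V (cinv c x) c [i] []) has_derivative
      (\<lambda>w. \<chi> i. frechet_derivative (\<lambda>x. V (cinv c x) c [i] []) (at (cmap c p)) w)) (at (cmap c p))"
    by (subst has_derivative_componentwise_within)
      (auto simp: Basis_vec_def inner_axis intro!: smooth_on_has_derivative[OF V_comp_smooth base_in_coords(2)])
  then show ?thesis
    unfolding section_coord_def[abs_def] by (intro has_derivative_Pair has_derivative_ident)
qed

text \<open>The vertical component of the derivative of the section is \<open>DV\<close> minus the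
  connection coefficient; the latter completes the x-derivative to \<open>\<delta>\<close>, and
  \<open>DV\<close> is left as the vertical direction.\<close>

lemma frechet_derivative_section:
  assumes F: "smooth_on (coords c) F"
  defines "D \<equiv> \<lambda>w. frechet_derivative F (at base) (w, \<chi> i. frechet_derivative (\<lambda>x. V (cinv c x) c [i] []) (at (cmap c p)) w)"
  shows "((\<lambda>x. F (section_coord V c x)) has_derivative D) (at (cmap c p))"
    and "D (axis i 1) = \<delta> M L c i F base + (\<Sum>k\<in>UNIV. DV k i * dy k F base)"
proof -
  have "(F has_derivative frechet_derivative F (at base)) (at (section_coord V c (cmap c p)))"
    using smooth_on_has_derivative[OF F base_in_coords(1)] section_coord_cmap[OF p(2)] by simp
  then show "((\<lambda>x. F (section_coord V c x)) has_derivative D) (at (cmap c p))"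
    unfolding D_def by (rule has_derivative_compose[OF section_has_derivative])
  have d: "F differentiable (at base)" by (rule smooth_on_differentiable[OF F base_in_coords(1)])
  show "D (axis i 1) = \<delta> M L c i F base + (\<Sum>k\<in>UNIV. DV k i * dy k F base)"
    unfolding D_def frechet_derivative_horizontal[OF d]
    by (simp add: \<delta>_def DV_def distrib_right sum.distrib)
qed

lemma nonlin_covd_comp: "nonlin_covd M L c Y V p c [i] [] = (\<Sum>j\<in>UNIV. Y c [j] [] * DV i j)"
  using tinv_eq[OF M c] is_chartD(5,6)[OF chart[OF M c]] p(2)
  by (simp add: nonlin_covd_def DV_def chart_vector_self[OF M c])

lemma coord_vector_comp: "coord_vector M c i p c [j] [] = (if j = i then 1 else 0)"
  using tinv_eq[OF M c] is_chartD(5,6)[OF chart[OF M c]] p(2)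
  by (simp add: coord_vector_def chart_vector_self[OF M c] axis_def)

lemma nonlin_covd_in_tensors: "nonlin_covd M L c Y V p \<in> tensors M 1 0 p"
  using tinv_eq[OF M c] is_chartD(5,6)[OF chart[OF M c]] p(2)
  by (simp only: nonlin_covd_def) (simp add: chart_vector_in_tensors[OF M c, unfolded One_nat_def])

lemma vertical_deriv_comp:
  assumes Z: "Z \<in> aniso_tensors M A 1 0" and w: "w \<in> tensors M 1 0 p"
  shows "vertical_deriv Z (p, V p) w c [i] [] = (\<Sum>k\<in>UNIV. w c [k] [] * dy k (\<lambda>z. Z (tinv M c z) c [i] []) base)"
proof -
  let ?F = "\<lambda>z. Z (tinv M c z) c [i] []"
  let ?u = "(0, \<chi> k. w c [k] []) :: (real^'n) \<times> (real^'n)"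
  have s: "smooth_on (coords c) ?F" by (rule aniso_tensorsD(3)[OF Z c]) simp_all
  \<comment> \<open>This holds for every \<open>t\<close>, even if the vector leaves
    \<open>A\<close>: \<open>tinv\<close> inverts \<open>tcoord\<close> on the whole tangent bundle
    over the chart, and the shifted vector is still tangent at \<open>p\<close>.\<close>
  have "tinv M c (base + t *\<^sub>R ?u) = (p, tadd (V p) (tscale t w))" for t
  proof -
    have Vp: "V p \<in> tensors M 1 0 p" using V p unfolding admissible_fields_def tensor_field_on_def by blast
    have "base + t *\<^sub>R ?u = tcoord c (p, tadd (V p) (tscale t w))"
      by (simp add: tcoord_def tadd_def tscale_def vec_eq_iff)
    moreover have "tadd (V p) (tscale t w) \<in> tensors M 1 0 p"
    proof (rule tensorsI)
      fix d e :: "('m, 'n) chart" and "is" js :: "'n list"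
      assume de: "d \<in> M" "e \<in> M" "p \<in> cdom d" "p \<in> cdom e" "length is = 1" "length js = 0"
      show "tadd (V p) (tscale t w) e is js = (\<Sum>ks | length ks = 1. \<Sum>ls | length ls = 0.
          (\<Prod>a<1. jac d e p (is ! a) (ks ! a)) * (\<Prod>b<0. jac e d p (ls ! b) (js ! b)) * tadd (V p) (tscale t w) d ks ls)"
        unfolding tadd_def tensorsD(2)[OF Vp de] tensorsD(2)[OF tscale_in_tensors[OF w] de]
        by (simp add: distrib_left sum.distrib)
    qed (use tensorsD(1)[OF Vp] tensorsD(1)[OF tscale_in_tensors[OF w]] in \<open>simp add: tadd_def\<close>)
    then have "(p, tadd (V p) (tscale t w)) \<in> tdom M c" using p by (simp add: tdom_def TM_def)
    ultimately show ?thesis using tinv_tcoord[OF M c] by simp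
  qed
  moreover from this[of 0] have "tinv M c base = (p, V p)"
    by (simp add: tadd_def tscale_def zero_prod_def[symmetric])
  ultimately have "((\<lambda>t. (Z (p, tadd (V p) (tscale t w)) c [i] [] - Z (p, V p) c [i] []) / t) \<longlongrightarrow>
      frechet_derivative ?F (at base) ?u) (at 0)"
    using difference_quotient_tendsto[OF smooth_on_has_derivative[OF s base_in_coords(1)], of ?u] by simp
  then have "vertical_deriv Z (p, V p) w c [i] [] = frechet_derivative ?F (at base) ?u"
    unfolding vertical_deriv_def by (simp add: tendsto_Lim)
  also have l: "linear (frechet_derivative ?F (at base))"
    using smooth_on_differentiable[OF s base_in_coords(1)] linear_frechet_derivative by blast
  have "?u = (\<Sum>k\<in>UNIV. w c [k] [] *\<^sub>R (0, axis k 1))"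
    by (simp add: prod_eq_iff fst_sum snd_sum vec_eq_iff axis_def if_distrib cong: if_cong)
  then have "frechet_derivative ?F (at base) ?u = (\<Sum>k\<in>UNIV. w c [k] [] * dy k ?F base)"
    by (simp add: linear_sum[OF l] linear_scale[OF l] dy_def del: scaleR_Pair)
  finally show ?thesis .
qed

lemma vertical_term_eq:
  assumes Z: "Z \<in> aniso_tensors M A 1 0"
  shows "vertical_term M L c Z V p =
    (\<Sum>i\<in>UNIV. \<Sum>k\<in>UNIV. Z (p, V p) c [i] [] * DV k i * mean_cartan M L c k base)
    + (\<Sum>i\<in>UNIV. \<Sum>k\<in>UNIV. DV k i * dy k (\<lambda>z. Z (tinv M c z) c [i] []) base)"
proof -
  have "(\<Sum>j\<in>UNIV. mean_cartan M L c j base * nonlin_covd M L c (along Z V p) V p c [j] []) =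
      (\<Sum>i\<in>UNIV. \<Sum>k\<in>UNIV. Z (p, V p) c [i] [] * DV k i * mean_cartan M L c k base)"
    unfolding nonlin_covd_comp sum_distrib_left along_def by (subst sum.swap) (simp add: mult_ac)
  then show ?thesis
    by (simp add: vertical_term_def vertical_deriv_comp[OF Z nonlin_covd_in_tensors] nonlin_covd_comp
        coord_vector_comp sum_delta_mult)
qed

lemma divergence_coordinates:
  assumes Z: "Z \<in> aniso_tensors M A 1 0"
  shows "(\<lambda>x. Z (cinv c x, V (cinv c x)) c [i] [] * sqrt \<bar>det (g_mat M L c (section_coord V c x))\<bar>)
      differentiable (at (cmap c p))"
    and "(\<Sum>i\<in>UNIV. frechet_derivative
        (\<lambda>x. Z (cinv c x, V (cinv c x)) c [i] [] * sqrt \<bar>det (g_mat M L c (section_coord V c x))\<bar>)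
        (at (cmap c p)) (axis i 1))
      = sqrt \<bar>det (g_mat M L c base)\<bar> * ((\<Sum>i\<in>UNIV. \<delta> M L c i (\<lambda>z. Z (tinv M c z) c [i] []) base)
        + (\<Sum>l\<in>UNIV. (\<Sum>i\<in>UNIV. chern M L c i i l base) * Z (p, V p) c [l] []) + vertical_term M L c Z V p)"
proof -
  let ?Z = "\<lambda>i z. Z (tinv M c z) c [i] []"
  let ?D = "\<lambda>F w. frechet_derivative F (at base) (w, \<chi> i. frechet_derivative (\<lambda>x. V (cinv c x) c [i] []) (at (cmap c p)) w)"
  let ?s = "sqrt \<bar>det (g_mat M L c base)\<bar>"
  let ?S = "\<lambda>w. ?s * (1/2 * (\<Sum>a\<in>UNIV. \<Sum>b\<in>UNIV. g_inv M L c b a base * ?D (g c a b) w))"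
  have sZ: "smooth_on (coords c) (?Z i)" for i by (rule aniso_tensorsD(3)[OF Z c]) simp_all
  have dS: "((\<lambda>x. sqrt \<bar>det (g_mat M L c (section_coord V c x))\<bar>) has_derivative ?S) (at (cmap c p))"
  proof -
    have "((\<lambda>x. g_mat M L c (section_coord V c x) $ a $ b) has_derivative ?D (g c a b)) (at (cmap c p))" for a b
      using frechet_derivative_section(1)[OF g_smooth[OF c]] by (simp add: g_mat_def)
    from has_derivative_sqrt_abs_det[OF this] show ?thesis
      using det_g_nonzero[OF c base_in_coords(1)] section_coord_cmap[OF p(2)] by (simp add: g_inv_def)
  qed
  have Zp: "?Z i base = Z (p, V p) c [i] []" for i
    using tinv_tcoord[OF M c] V_in_tdom[OF p] by simp
  have d: "((\<lambda>x. Z (cinv c x, V (cinv c x)) c [i] [] * sqrt \<bar>det (g_mat M L c (section_coord V c x))\<bar>)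
      has_derivative (\<lambda>w. Z (p, V p) c [i] [] * ?S w + ?D (?Z i) w * ?s)) (at (cmap c p))" for i
  proof (rule has_derivative_transform_within_open[OF _ open_chart_image base_in_coords(2)])
    show "((\<lambda>x. ?Z i (section_coord V c x) * sqrt \<bar>det (g_mat M L c (section_coord V c x))\<bar>)
      has_derivative (\<lambda>w. Z (p, V p) c [i] [] * ?S w + ?D (?Z i) w * ?s)) (at (cmap c p))"
      using has_derivative_mult[OF frechet_derivative_section(1)[OF sZ] dS, of i]
      unfolding section_coord_cmap[OF p(2)] Zp .
  qed (simp add: tinv_section_coord)
  then show "(\<lambda>x. Z (cinv c x, V (cinv c x)) c [i] [] * sqrt \<bar>det (g_mat M L c (section_coord V c x))\<bar>)
      differentiable (at (cmap c p))" by (rule differentiableI)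
  \<comment> \<open>The logarithmic derivative of sqrt |det g| along the section: the horizontal
    part is the Christoffel trace, the vertical part the mean Cartan tensor of
    \<open>D_i V\<close>.\<close>
  have S: "?S (axis i 1) = ?s * ((\<Sum>a\<in>UNIV. chern M L c a a i base) + (\<Sum>k\<in>UNIV. DV k i * mean_cartan M L c k base))" for i
  proof -
    have "(\<Sum>a\<in>UNIV. \<Sum>b\<in>UNIV. g_inv M L c b a base * ?D (g c a b) (axis i 1))
      = (\<Sum>a\<in>UNIV. \<Sum>b\<in>UNIV. g_inv M L c b a base * \<delta> M L c i (g c a b) base)
      + (\<Sum>a\<in>UNIV. \<Sum>b\<in>UNIV. \<Sum>k\<in>UNIV. DV k i * (g_inv M L c b a base * dy k (g c a b) base))"
      unfolding frechet_derivative_section(2)[OF g_smooth[OF c]]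
      by (simp add: distrib_left sum.distrib sum_distrib_left mult_ac)
    also have "(\<Sum>a\<in>UNIV. \<Sum>b\<in>UNIV. \<Sum>k\<in>UNIV. DV k i * (g_inv M L c b a base * dy k (g c a b) base))
      = (\<Sum>k\<in>UNIV. \<Sum>a\<in>UNIV. \<Sum>b\<in>UNIV. DV k i * (g_inv M L c b a base * dy k (g c a b) base))"
      by (subst (2) sum.swap, subst sum.swap) (rule refl)
    finally show ?thesis
      unfolding chern_trace[OF c base_in_coords(1)] mean_cartan_eq[OF c base_in_coords(1)]
      by (simp add: sum_distrib_left mult_ac distrib_left sum_divide_distrib)
  qed
  have "(\<Sum>i\<in>UNIV. frechet_derivative
        (\<lambda>x. Z (cinv c x, V (cinv c x)) c [i] [] * sqrt \<bar>det (g_mat M L c (section_coord V c x))\<bar>)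
        (at (cmap c p)) (axis i 1))
      = (\<Sum>i\<in>UNIV. Z (p, V p) c [i] [] * ?S (axis i 1) + ?D (?Z i) (axis i 1) * ?s)"
    by (simp only: frechet_derivative_at[OF d, symmetric])
  also have "\<dots> = (\<Sum>i\<in>UNIV. ?s * (\<delta> M L c i (?Z i) base + (\<Sum>a\<in>UNIV. chern M L c a a i base) * Z (p, V p) c [i] []
      + (\<Sum>k\<in>UNIV. Z (p, V p) c [i] [] * DV k i * mean_cartan M L c k base) + (\<Sum>k\<in>UNIV. DV k i * dy k (?Z i) base)))"
    unfolding S frechet_derivative_section(2)[OF sZ]
    by (intro sum.cong refl) (simp add: algebra_simps sum_distrib_left sum_distrib_right)
  also have "\<dots> = ?s * ((\<Sum>i\<in>UNIV. \<delta> M L c i (?Z i) base)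
        + (\<Sum>l\<in>UNIV. (\<Sum>i\<in>UNIV. chern M L c i i l base) * Z (p, V p) c [l] []) + vertical_term M L c Z V p)"
    unfolding vertical_term_eq[OF Z] by (simp only: sum_distrib_left[symmetric] sum.distrib add.assoc)
  finally show "(\<Sum>i\<in>UNIV. frechet_derivative
        (\<lambda>x. Z (cinv c x, V (cinv c x)) c [i] [] * sqrt \<bar>det (g_mat M L c (section_coord V c x))\<bar>)
        (at (cmap c p)) (axis i 1))
      = ?s * ((\<Sum>i\<in>UNIV. \<delta> M L c i (?Z i) base)
        + (\<Sum>l\<in>UNIV. (\<Sum>i\<in>UNIV. chern M L c i i l base) * Z (p, V p) c [l] []) + vertical_term M L c Z V p)" .
qed

end

end

end

section \<open>The metric volume form\<close>

lemma length_indices: "length (indices :: 'n::{finite,linorder} list) = CARD('n)"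
  by (simp add: indices_def)

lemma set_indices: "set (indices :: 'n::{finite,linorder} list) = UNIV"
  by (simp add: indices_def)

text \<open>Identifies the position used in \<open>coord_volume\<close> with the position in
  \<open>indices\<close>: the list is strictly increasing, so the entries below its a-th one are
  exactly the a preceding ones.\<close>

lemma card_lessThan_indices:
  assumes "a < CARD('n)"
  shows "card {..<(indices ! a :: 'n::{finite,linorder})} = a"
proof -
  let ?l = "indices :: 'n list"
  have sorted: "sorted_wrt (<) ?l" and dist: "distinct ?l"
    by (simp_all add: indices_def)
  have less: "?l ! b < ?l ! b' \<longleftrightarrow> b < b'" if "b < CARD('n)" "b' < CARD('n)" for b b'
    using sorted_wrt_nth_less[OF sorted] that length_indices[where 'n = 'n]
    by (metis linorder_neqE_nat order_less_asym order_less_irrefl)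
  have "{..<?l ! a} = (!) ?l ` {..<a}"
  proof (intro equalityI subsetI)
    fix i assume i: "i \<in> {..<?l ! a}"
    obtain b where "b < CARD('n)" "i = ?l ! b"
      using set_indices[where 'n = 'n] length_indices[where 'n = 'n] by (metis UNIV_I in_set_conv_nth)
    then show "i \<in> (!) ?l ` {..<a}" using i less assms by auto
  qed (use less assms in auto)
  moreover have "inj_on ((!) ?l) {..<a}"
    using dist assms length_indices[where 'n = 'n] by (auto intro!: inj_on_nth)
  ultimately show ?thesis by (simp add: card_image)
qed

lemma bij_betw_indices: "bij_betw ((!) indices) {..<CARD('n)} (UNIV :: 'n::{finite,linorder} set)"
  using bij_betw_nth[of "indices :: 'n list" "{..<CARD('n)}" UNIV]
  by (simp add: length_indices set_indices) (simp add: indices_def)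

lemma indices_nth_card: "indices ! card {..<j} = (j :: 'n::{finite,linorder})"
  and card_lessThan_less: "card {..<j} < CARD('n)"
proof -
  obtain a where "a < CARD('n)" "j = indices ! a"
    using set_indices[where 'n = 'n] length_indices[where 'n = 'n] by (metis UNIV_I in_set_conv_nth)
  then show "indices ! card {..<j} = j" "card {..<j} < CARD('n)"
    using card_lessThan_indices[of a, where 'n = 'n] by auto
qed

lemma map_indices_nth: "map f indices ! card {..<j} = f (j :: 'n::{finite,linorder})"
  using card_lessThan_less[of j] by (simp add: length_indices indices_nth_card)

lemma coord_volume_indices: "coord_volume (indices :: 'n::{finite,linorder} list) = 1"
proof -
  have "(\<chi> i j. if i = indices ! card {..<j} then 1 else 0) = (mat 1 :: ((real, 'n) vec, 'n) vec)"
    by (simp add: indices_nth_card mat_def)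
  then show ?thesis unfolding coord_volume_def by (metis det_I)
qed

text \<open>Exchanging two list entries permutes the columns of the determinant by a transposition,
  of sign -1.\<close>

lemma coord_volume_swap:
  fixes js :: "'n::{finite,linorder} list"
  assumes "length js = CARD('n)" "a < b" "b < CARD('n)"
  shows "coord_volume (js[a := js ! b, b := js ! a]) = - coord_volume js"
proof -
  define q where "q = Transposition.transpose (indices ! a :: 'n) (indices ! b)"
  have pos: "card {..<(indices ! a :: 'n)} = a" "card {..<(indices ! b :: 'n)} = b"
    using assms by (auto intro!: card_lessThan_indices)
  have "js[a := js ! b, b := js ! a] ! card {..<j} = js ! card {..<q j}" for j
  proof -
    consider "j = indices ! a" | "j = indices ! b" | "j \<noteq> indices ! a" "j \<noteq> indices ! b" by blast
    then show ?thesis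
    proof cases
      case 3
      then have "card {..<j} \<noteq> a" "card {..<j} \<noteq> b" using indices_nth_card by metis+
      then show ?thesis using 3 by (simp add: q_def)
    qed (use assms pos in \<open>simp_all add: q_def\<close>)
  qed
  then have "coord_volume (js[a := js ! b, b := js ! a]) =
      det (\<chi> i j. (\<chi> i j. if i = js ! card {..<j} then 1 else 0) $ i $ q j)"
    by (simp add: coord_volume_def)
  also have "\<dots> = of_int (sign q) * coord_volume js"
    unfolding coord_volume_def by (rule det_permute_columns) (simp add: q_def permutes_swap_id)
  also have "sign q = - 1"
    using pos assms by (auto simp: q_def sign_swap_id)
  finally show ?thesis by simp
qed

lemma coord_volume_repeated:
  fixes js :: "'n::{finite,linorder} list"
  assumes "length js = CARD('n)" "a < b" "b < CARD('n)" "js ! a = js ! b"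
  shows "coord_volume js = 0"
proof -
  have "js[a := js ! b, b := js ! a] = js" using assms(4) by (metis list_update_id)
  then show ?thesis using coord_volume_swap[OF assms(1-3)] by simp
qed

text \<open>Each entry of \<open>us\<close> that \<open>x\<close> passes costs one swap of
  neighbours.\<close>

lemma coord_volume_move_to_front:
  fixes us ws :: "'n::{finite,linorder} list"
  assumes "length (us @ x # ws) = CARD('n)"
  shows "coord_volume (x # us @ ws) = (- 1) ^ length us * coord_volume (us @ x # ws)"
  using assms
proof (induction us arbitrary: ws rule: rev_induct)
  case (snoc y us)
  let ?js = "us @ y # x # ws" and ?a = "length us"
  have "?js[?a := ?js ! Suc ?a, Suc ?a := ?js ! ?a] = us @ x # y # ws"
    by (simp add: nth_append list_update_append)
  then have "coord_volume (us @ x # y # ws) = - coord_volume ?js"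
    using coord_volume_swap[of ?js ?a "Suc ?a"] snoc.prems by simp
  then show ?case using snoc.IH[of "y # ws"] snoc.prems by simp
qed simp

text \<open>Unless \<open>i\<close> is the omitted index, it occurs twice and the determinant
  vanishes. Moving the omitted index back to its place costs the sign, which is the one in the
  exterior derivative.\<close>

lemma coord_volume_omit:
  fixes i :: "'n::{finite,linorder}"
  assumes "a < CARD('n)"
  shows "coord_volume (i # take a indices @ drop (Suc a) indices) = (if i = indices ! a then (- 1) ^ a else 0)"
proof -
  let ?l = "indices :: 'n list"
  have l: "take a ?l @ ?l ! a # drop (Suc a) ?l = ?l"
    using assms length_indices[where 'n = 'n] by (simp add: id_take_nth_drop[symmetric])
  show ?thesis
  proof (cases "i = ?l ! a")
    case True
    then show ?thesis
      using coord_volume_move_to_front[of "take a ?l" "?l ! a" "drop (Suc a) ?l"] assms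
      by (simp add: l length_indices coord_volume_indices)
  next
    case False
    let ?r = "take a ?l @ drop (Suc a) ?l"
    have "i \<in> set (take a ?l @ ?l ! a # drop (Suc a) ?l)" unfolding l by (simp add: set_indices)
    then have "i \<in> set ?r" using False by auto
    then obtain k where "k < length ?r" "?r ! k = i" by (metis in_set_conv_nth)
    moreover have "length ?r = CARD('n) - 1" using assms by (simp add: length_indices)
    ultimately show ?thesis
      using False coord_volume_repeated[of "i # ?r" 0 "Suc k"] assms by simp
  qed
qed

text \<open>The sum over index lists is the multilinear expansion of the determinant of a matrix
  product; the matrices are transposed because the expansion is carried out in the rows.\<close>

lemma coord_volume_transform:
  fixes js :: "'n::{finite,linorder} list" and J :: "'n \<Rightarrow> 'n \<Rightarrow> real"
  assumes "length js = CARD('n)"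
  shows "(\<Sum>ls | length ls = CARD('n). (\<Prod>b<CARD('n). J (ls ! b) (js ! b)) * coord_volume ls)
    = det (\<chi> i k. J i k) * coord_volume js"
proof -
  define m where "m j = js ! card {..<j}" for j :: 'n
  \<comment> \<open>Index lists of full length are the same as self-maps of the index type, listed
    in the order of \<open>indices\<close>.\<close>
  have bij: "bij_betw (\<lambda>f. map f indices) (UNIV :: ('n \<Rightarrow> 'n) set) {ls. length ls = CARD('n)}"
  proof (rule bij_betwI[where g = "\<lambda>ls j. ls ! card {..<j}"])
    show "map (\<lambda>j. ls ! card {..<j}) (indices :: 'n list) = ls" if "ls \<in> {ls. length ls = CARD('n)}" for ls :: "'n list"
      using that by (intro nth_equalityI) (simp_all add: length_indices card_lessThan_indices)
  qed (auto simp: map_indices_nth length_indices)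
  have "(\<Sum>ls | length ls = CARD('n). (\<Prod>b<CARD('n). J (ls ! b) (js ! b)) * coord_volume ls)
      = (\<Sum>f\<in>(UNIV :: ('n \<Rightarrow> 'n) set). (\<Prod>b<CARD('n). J (map f indices ! b) (js ! b)) * coord_volume (map f indices))"
    by (rule sum.reindex_bij_betw[OF bij, symmetric])
  also have "\<dots> = (\<Sum>f\<in>UNIV. det (\<chi> j. J (f j) (m j) *s (axis (f j) 1 :: (real, 'n) vec)))"
  proof (intro sum.cong refl)
    fix f :: "'n \<Rightarrow> 'n"
    have "(\<Prod>b<CARD('n). J (map f indices ! b) (js ! b)) = (\<Prod>b<CARD('n). J (f (indices ! b)) (m (indices ! b)))"
      by (intro prod.cong) (simp_all add: m_def card_lessThan_indices length_indices)
    also have "\<dots> = (\<Prod>j\<in>UNIV. J (f j) (m j))"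
      by (rule prod.reindex_bij_betw[OF bij_betw_indices, of "\<lambda>j. J (f j) (m j)"])
    finally have "(\<Prod>b<CARD('n). J (map f indices ! b) (js ! b)) = (\<Prod>j\<in>UNIV. J (f j) (m j))" .
    moreover have "coord_volume (map f indices) = det (\<chi> j. (axis (f j) 1 :: (real, 'n) vec))"
      unfolding coord_volume_def map_indices_nth
      by (subst det_transpose[symmetric]) (simp add: transpose_def axis_def eq_commute)
    ultimately show "(\<Prod>b<CARD('n). J (map f indices ! b) (js ! b)) * coord_volume (map f indices)
        = det (\<chi> j. J (f j) (m j) *s (axis (f j) 1 :: (real, 'n) vec))"
      by (simp add: det_rows_mul)
  qed
  also have "\<dots> = det (\<chi> j. \<Sum>k\<in>UNIV. J k (m j) *s (axis k 1 :: (real, 'n) vec))"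
    using det_linear_rows_sum[of UNIV "\<lambda>j k. J k (m j) *s (axis k 1 :: (real, 'n) vec)"] by simp
  also have "\<dots> = det (transpose ((\<chi> i k. J i k) ** (\<chi> i j. if i = m j then 1 else 0)))"
    by (rule arg_cong[where f = det])
      (simp add: vec_eq_iff transpose_def matrix_matrix_mult_def axis_def if_distrib sum_component cong: if_cong)
  also have "\<dots> = det (\<chi> i k. J i k) * coord_volume js"
    by (simp add: det_mul coord_volume_def m_def)
  finally show ?thesis .
qed

section \<open>The volume form as a tensor, and the flux form\<close>

locale pseudo_finsler_oriented = pseudo_finsler_manifold M A L
  for M :: "('m::{t2_space,second_countable_topology}, 'n::{finite,linorder}) chart set" and A L
begin

text \<open>The metric matrix changes by congruence with the Jacobian, so the root of |det g|
  acquires the factor |det J|. Orientation makes this det J, the factor by which a top-degree form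
  changes.\<close>

lemma metric_volume_in_tensors:
  assumes v: "(p, \<xi>) \<in> A"
  shows "metric_volume M A L (p, \<xi>) \<in> tensors M 0 CARD('n) p"
proof (rule tensorsI)
  fix c d :: "('m, 'n) chart" and "is" js :: "'n list"
  assume cd: "c \<in> M" "d \<in> M" "p \<in> cdom c" "p \<in> cdom d" and len: "length is = 0" "length js = CARD('n)"
  let ?J = "\<chi> i k. jac d c p i k" and ?gc = "g_mat M L c (tcoord c (p, \<xi>))" and ?gd = "g_mat M L d (tcoord d (p, \<xi>))"
  have "?gd = transpose ?J ** (?gc ** ?J)"
    by (simp add: vec_eq_iff transpose_def matrix_matrix_mult_def g_mat_def g_change_chart[OF cd(1,3,2,4) v]
        sum_distrib_left mult_ac)
  then have "det ?gd = (det ?J)\<^sup>2 * det ?gc" by (simp add: det_mul power2_eq_square)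
  then have "sqrt \<bar>det ?gd\<bar> = det ?J * sqrt \<bar>det ?gc\<bar>"
    using det_jac_pos[OF M cd(2,1,4,3)] by (simp add: abs_mult real_sqrt_mult)
  then have "metric_volume M A L (p, \<xi>) d is js = sqrt \<bar>det ?gc\<bar> * (det ?J * coord_volume js)"
    using v cd len by (simp add: metric_volume_def)
  also have "\<dots> = (\<Sum>ls | length ls = CARD('n). (\<Prod>b<CARD('n). jac d c p (ls ! b) (js ! b)) * metric_volume M A L (p, \<xi>) c [] ls)"
    unfolding coord_volume_transform[OF len(2), symmetric] sum_distrib_left
    using v cd len by (intro sum.cong refl) (simp add: metric_volume_def)
  finally show "metric_volume M A L (p, \<xi>) d is js = (\<Sum>ks | length ks = 0. \<Sum>ls | length ls = CARD('n).
          (\<Prod>a<0. jac c d p (is ! a) (ks ! a)) * (\<Prod>b<CARD('n). jac d c p (ls ! b) (js ! b)) * metric_volume M A L (p, \<xi>) c ks ls)"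
    by simp
qed (auto simp: metric_volume_def)

context
  fixes Z :: "('m, 'n) tpoint \<Rightarrow> ('m, 'n) tensor" and V :: "'m \<Rightarrow> ('m, 'n) tensor" and U :: "'m set"
  assumes Z: "Z \<in> aniso_tensors M A 1 0" and U: "open U" and V: "V \<in> admissible_fields M A U"
begin

definition flux :: "'m \<Rightarrow> ('m, 'n) tensor" where
  "flux p = interior_product (along Z V p) (along (metric_volume M A L) V p)"

lemma flux_comp:
  assumes "c \<in> M" "p \<in> U" "p \<in> cdom c" "length js = CARD('n) - 1"
  shows "flux p c [] js = (\<Sum>i\<in>UNIV. Z (p, V p) c [i] [] * sqrt \<bar>det (g_mat M L c (tcoord c (p, V p)))\<bar> * coord_volume (i # js))"
  using assms V_in_tdom[OF assms(1) U V assms(2,3)]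
  by (simp add: flux_def interior_product_def along_def metric_volume_def mult.assoc)

lemma flux_form: "form_on M (CARD('n) - 1) U flux"
  unfolding form_on_def tensor_field_on_def
proof (intro conjI ballI allI impI)
  fix p assume p: "p \<in> U"
  then have v: "(p, V p) \<in> A" using V unfolding admissible_fields_def by blast
  show "flux p \<in> tensors M 0 (CARD('n) - 1) p"
    unfolding flux_def along_def
    by (rule interior_product_in_tensors[OF M]) (use aniso_tensorsD(1)[OF Z v] metric_volume_in_tensors[OF v] in simp_all)
next
  fix c "is" js assume c: "c \<in> M" and len: "length (is :: 'n list) = 0 \<and> length (js :: 'n list) = CARD('n) - 1"
  note ch = open_chart_image[OF c U V]
  show "smooth_on (cmap c ` (U \<inter> cdom c)) (\<lambda>x. flux (cinv c x) c is js)"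
  proof (rule smooth_on_cong[OF ch])
    show "smooth_on (cmap c ` (U \<inter> cdom c)) (\<lambda>x. \<Sum>i\<in>UNIV. Z (tinv M c (section_coord V c x)) c [i] [] *
        sqrt \<bar>det (g_mat M L c (section_coord V c x))\<bar> * coord_volume (i # js))"
    proof (intro smooth_on_sum smooth_on_mult smooth_on_const ch)
      show "smooth_on (cmap c ` (U \<inter> cdom c)) (\<lambda>x. Z (tinv M c (section_coord V c x)) c [i] [])" for i
        by (rule smooth_on_section[OF c U V aniso_tensorsD(3)[OF Z c]]) simp_all
      have "smooth_on (coords c) (\<lambda>z. sqrt \<bar>det (g_mat M L c z)\<bar>)"
        by (rule smooth_on_sqrt_abs_det[OF open_coords[OF c] _ det_g_nonzero[OF c]])
          (simp add: g_mat_def g_smooth[OF c])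
      then show "smooth_on (cmap c ` (U \<inter> cdom c)) (\<lambda>x. sqrt \<bar>det (g_mat M L c (section_coord V c x))\<bar>)"
        by (rule smooth_on_section[OF c U V])
    qed
    fix x assume x: "x \<in> cmap c ` (U \<inter> cdom c)"
    then obtain p where p: "p \<in> U" "p \<in> cdom c" "x = cmap c p" by blast
    then have "cinv c x = p" using is_chartD(6)[OF chart[OF M c]] by simp
    then show "(\<Sum>i\<in>UNIV. Z (tinv M c (section_coord V c x)) c [i] [] *
        sqrt \<bar>det (g_mat M L c (section_coord V c x))\<bar> * coord_volume (i # js)) = flux (cinv c x) c is js"
      using flux_comp[OF c p(1,2), of js] len tinv_section_coord[OF c U V x] section_coord_cmap[OF c U V p(2)] p(3)
      by simp
  qed
next
  fix p c js a b assume "length (js :: 'n list) = CARD('n) - 1 \<and> a < b \<and> b < CARD('n) - 1"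
  \<comment> \<open>The contracted index \<open>i\<close> stands in front, so the swapped positions
    move up by one.\<close>
  then have "coord_volume (i # js[a := js ! b, b := js ! a]) = - coord_volume (i # js)" for i
    using coord_volume_swap[of "i # js" "Suc a" "Suc b"] Suc_pred[OF zero_less_card_finite[where 'a = 'n]] by simp
  then show "flux p c [] (js[a := js ! b, b := js ! a]) = - flux p c [] js"
    by (simp add: flux_def interior_product_def along_def metric_volume_def if_distrib sum_negf[symmetric] cong: if_cong)
qed

text \<open>With the a-th index omitted, only the a-th component of the vector contributes, with
  sign (-1)^a; this cancels the sign in the exterior derivative and a plain divergence is
  left.\<close>

lemma ext_deriv_flux:
  assumes c: "c \<in> M" and p: "p \<in> U" "p \<in> cdom c"
  shows "ext_deriv M flux p c [] indices = (\<Sum>i\<in>UNIV. frechet_derivative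
        (\<lambda>x. Z (cinv c x, V (cinv c x)) c [i] [] * sqrt \<bar>det (g_mat M L c (section_coord V c x))\<bar>)
        (at (cmap c p)) (axis i 1))"
proof -
  let ?F = "\<lambda>i x. Z (cinv c x, V (cinv c x)) c [i] [] * sqrt \<bar>det (g_mat M L c (section_coord V c x))\<bar>"
  let ?l = "indices :: 'n list"
  have d: "?F i differentiable (at (cmap c p))" for i
    by (rule divergence_coordinates(1)[OF c U V p Z])
  have "frechet_derivative (\<lambda>x. flux (cinv c x) c [] (take a ?l @ drop (Suc a) ?l)) (at (cmap c p)) w
      = (- 1) ^ a * frechet_derivative (?F (?l ! a)) (at (cmap c p)) w" if a: "a < CARD('n)" for a w
  proof -
    have "(- 1) ^ a * ?F (?l ! a) x = flux (cinv c x) c [] (take a ?l @ drop (Suc a) ?l)"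
      if x: "x \<in> cmap c ` (U \<inter> cdom c)" for x
    proof -
      obtain q where q: "q \<in> U" "q \<in> cdom c" "x = cmap c q" using x by blast
      then have "cinv c x = q" using is_chartD(6)[OF chart[OF M c]] by simp
      then show ?thesis
        using flux_comp[OF c q(1,2), of "take a ?l @ drop (Suc a) ?l"] a section_coord_cmap[OF c U V q(2)] q(3)
        by (simp add: length_indices coord_volume_omit if_distrib[where f = "\<lambda>x. _ * x"] cong: if_cong)
    qed
    then have "frechet_derivative (\<lambda>x. flux (cinv c x) c [] (take a ?l @ drop (Suc a) ?l)) (at (cmap c p))
        = frechet_derivative (\<lambda>x. (- 1) ^ a * ?F (?l ! a) x) (at (cmap c p))"
      by (rule frechet_derivative_cong_open(2)[OF open_chart_image[OF c U V] base_in_coords(2)[OF c U V p]])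
        (use d in \<open>auto intro!: differentiable_mult\<close>)
    then show ?thesis using frechet_derivative_cmult[OF d] by simp
  qed
  then have "ext_deriv M flux p c [] ?l = (\<Sum>a<CARD('n). frechet_derivative (?F (?l ! a)) (at (cmap c p)) (axis (?l ! a) 1))"
    using c p unfolding ext_deriv_def
    by (simp add: length_indices power_mult_distrib[symmetric] mult.assoc[symmetric])
  also have "\<dots> = (\<Sum>i\<in>UNIV. frechet_derivative (?F i) (at (cmap c p)) (axis i 1))"
    by (rule sum.reindex_bij_betw[OF bij_betw_indices])
  finally show ?thesis .
qed

end

end

section \<open>Vanishing of the boundary integral\<close>

lemma has_form_integral_zero:
  assumes "has_form_integral M \<omega> S I" and "\<And>p c. p \<in> S \<Longrightarrow> c \<in> M \<Longrightarrow> p \<in> cdom c \<Longrightarrow> \<omega> p c [] indices = 0"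
    and "\<And>c. c \<in> M \<Longrightarrow> is_chart c"
  shows "I = 0"
proof -
  obtain B \<kappa> where B: "(\<Union>k. B k) = S" "\<And>k. \<kappa> k \<in> M \<and> B k \<subseteq> cdom (\<kappa> k)"
    and I: "(\<lambda>k. LINT x:cmap (\<kappa> k) ` B k|lborel. \<omega> (cinv (\<kappa> k) x) (\<kappa> k) [] indices) sums I"
    using assms(1) unfolding has_form_integral_def by blast
  have "(LINT x:cmap (\<kappa> k) ` B k|lborel. \<omega> (cinv (\<kappa> k) x) (\<kappa> k) [] indices) = 0" for k
  proof -
    have "\<omega> (cinv (\<kappa> k) x) (\<kappa> k) [] indices = 0" if x: "x \<in> cmap (\<kappa> k) ` B k" for x
    proof -
      obtain q where q: "q \<in> B k" "x = cmap (\<kappa> k) q" using x by blast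
      then have "q \<in> S" "\<kappa> k \<in> M" "q \<in> cdom (\<kappa> k)" using B by blast+
      then show ?thesis using assms(2)[of q "\<kappa> k"] is_chartD(6)[OF assms(3)] q by simp
    qed
    then have "(\<lambda>x. indicator (cmap (\<kappa> k) ` B k) x *\<^sub>R \<omega> (cinv (\<kappa> k) x) (\<kappa> k) [] indices) = (\<lambda>x. 0)"
      by (auto simp: indicator_def)
    then show ?thesis unfolding set_lebesgue_integral_def by simp
  qed
  then have "(\<lambda>k. 0) sums I" using I by simp
  then show ?thesis using sums_unique2 sums_zero by blast
qed

theorem corollary5p9:
  fixes M :: "('m::{t2_space,second_countable_topology}, 'n::{finite,linorder}) chart set"
    and A :: "('m, 'n) tpoint set"
    and L :: "('m, 'n) tpoint \<Rightarrow> real"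
    and X T :: "('m, 'n) tpoint \<Rightarrow> ('m, 'n) tensor"
    and V :: "'m \<Rightarrow> ('m, 'n) tensor"
    and U Dbar :: "'m set"
  assumes manifold: "oriented_smooth_structure M" "connected (UNIV :: 'm set)" "CARD('n) \<ge> 2"
    and A: "conic_domain M A"
    and L: "pseudo_finsler M A L"
    and X: "X \<in> aniso_tensors M A 1 0"
    and U: "open U"
    and V: "V \<in> admissible_fields M A U"
    and T: "T \<in> aniso_tensors M A 1 1"
    and domain: "is_domain Dbar" "Dbar \<subseteq> U"
    and boundary: "zero_dim_measure M (CARD('n) - 1) (frontier Dbar - smooth_boundary_part M Dbar)"
    and stokes: "stokes_applicable M U Dbar"
    and supp: "compact (supp_on U (along X V) \<inter> Dbar)"
    and i: "\<forall>p\<in>U. \<forall>c\<in>M. p \<in> cdom c \<longrightarrow>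
        (\<forall>j. div_comp M L c T j (tcoord c (p, V p)) = 0)"
    and ii: "(\<forall>p\<in>U. \<forall>c\<in>M. p \<in> cdom c \<longrightarrow> (\<forall>i j.
          flat_covd_comp M L c T X i j (tcoord c (p, V p))
            = - flat_covd_comp M L c T X j i (tcoord c (p, V p))))
      \<or> (\<forall>p\<in>U. \<forall>c\<in>M. p \<in> cdom c \<longrightarrow> (\<forall>i j.
          flat_comp M L c T i j (tcoord c (p, V p)) = flat_comp M L c T j i (tcoord c (p, V p))))
        \<and> (\<exists>\<ll>. is_lie_bracket M A L X \<ll> \<and> (\<forall>p\<in>U. along (\<ll> (fund_tensor M A L)) V p = tzero))"
    and iii: "\<forall>p\<in>U. \<forall>c\<in>M. p \<in> cdom c \<longrightarrow>
        vertical_term M L c (\<lambda>v. tapply (T v) (X v)) V p = 0"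
  shows "has_boundary_integral M
      (\<lambda>p. interior_product (tapply (along T V p) (along X V p)) (along (metric_volume M A L) V p))
      Dbar 0"
proof -
  interpret pseudo_finsler_oriented M A L
    by unfold_locales (fact manifold(1) A L)+
  define Z where "Z = (\<lambda>v. tapply (T v) (X v))"
  have Z: "Z \<in> aniso_tensors M A 1 0" unfolding Z_def by (rule aniso_tapply[OF T X])
  let ?\<eta> = "flux Z V"
  have \<eta>: "?\<eta> = (\<lambda>p. interior_product (tapply (along T V p) (along X V p)) (along (metric_volume M A L) V p))"
    unfolding flux_def[OF Z U V] by (simp add: Z_def along_def)
  have trace: "(\<Sum>i\<in>UNIV. \<Sum>j\<in>UNIV. T (p, V p) c [i] [j] * covd M L c i X [j] [] (tcoord c (p, V p))) = 0"
    if c: "c \<in> M" and p: "p \<in> U" "p \<in> cdom c" for p c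
  proof -
    let ?z = "tcoord c (p, V p)"
    have v: "(p, V p) \<in> A \<inter> tdom M c" by (rule V_in_tdom[OF c U V p])
    have z: "?z \<in> coords c" using v by blast
    have tz: "tinv M c ?z = (p, V p)" using tinv_tcoord[OF M c] v by simp
    from ii show ?thesis
    proof (elim disjE conjE exE)
      assume "\<forall>p\<in>U. \<forall>c\<in>M. p \<in> cdom c \<longrightarrow> (\<forall>i j.
          flat_covd_comp M L c T X i j (tcoord c (p, V p)) = - flat_covd_comp M L c T X j i (tcoord c (p, V p)))"
      then have a: "flat_covd_comp M L c T X i j ?z = - flat_covd_comp M L c T X j i ?z" for i j
        using c p by blast
      show ?thesis
        by (rule trace_zero_of_antisymmetric[OF g_inv_left[OF c z] g_inv_sym[OF c z]])
          (rule a[unfolded flat_covd_comp_def flat_comp_def tz])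
    next
      fix \<ll> assume lie: "is_lie_bracket M A L X \<ll>" "\<forall>p\<in>U. along (\<ll> (fund_tensor M A L)) V p = tzero"
        and "\<forall>p\<in>U. \<forall>c\<in>M. p \<in> cdom c \<longrightarrow> (\<forall>i j.
          flat_comp M L c T i j (tcoord c (p, V p)) = flat_comp M L c T j i (tcoord c (p, V p)))"
      then have s: "flat_comp M L c T i j ?z = flat_comp M L c T j i ?z" for i j
        using c p by blast
      have "\<ll> (fund_tensor M A L) (p, V p) c [] [i, j] = 0" for i j
        using lie(2) p by (simp add: along_def tzero_def)
      \<comment> \<open>Only the value of the bracket derivative at \<open>V\<close> is known to
        vanish, and \<open>covd_killing\<close> is likewise a statement at the single point
        \<open>?z\<close>.\<close>
      then have k: "(\<Sum>m\<in>UNIV. g c j m ?z * covd M L c i X [m] [] ?z) = - (\<Sum>m\<in>UNIV. g c i m ?z * covd M L c j X [m] [] ?z)" for i j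
        using lie_bracket_fund_tensor[OF X lie(1) c v, of i j] by (intro covd_killing[OF c z]) (simp add: tz)
      show ?thesis
        by (rule trace_zero_of_symmetric[OF g_inv_left[OF c z] g_inv_sym[OF c z] _ k])
          (rule s[unfolded flat_comp_def tz])
    qed
  qed
  have closed: "ext_deriv M ?\<eta> p c [] indices = 0" if c: "c \<in> M" and p: "p \<in> U" "p \<in> cdom c" for p c
  proof -
    let ?z = "tcoord c (p, V p)"
    have v: "(p, V p) \<in> A \<inter> tdom M c" by (rule V_in_tdom[OF c U V p])
    have tz: "tinv M c ?z = (p, V p)" using tinv_tcoord[OF M c] v by simp
    have "(\<Sum>i\<in>UNIV. \<delta> M L c i (\<lambda>z. Z (tinv M c z) c [i] []) ?z)
      + (\<Sum>l\<in>UNIV. (\<Sum>i\<in>UNIV. chern M L c i i l ?z) * Z (p, V p) c [l] []) = 0"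
      using divergence_tapply[OF c base_in_coords(1)[OF c U V p] T X] trace[OF c p] i c p
      by (simp add: tz Z_def)
    moreover have "vertical_term M L c Z V p = 0" using iii c p by (simp add: Z_def)
    ultimately show ?thesis
      unfolding ext_deriv_flux[OF Z U V c p] divergence_coordinates(2)[OF c U V p Z] by simp
  qed
  \<comment> \<open>The form vanishes wherever \<open>X\<close> along \<open>V\<close> does, so its
    support is cut out of the compact set in \<open>supp\<close> by a closed set.\<close>
  have "compact (supp_on U ?\<eta> \<inter> Dbar)"
  proof -
    have "along X V p = tzero \<Longrightarrow> ?\<eta> p = tzero" for p
      by (simp add: \<eta> interior_product_def tapply_def tzero_def)
    then have "closure {p \<in> U. ?\<eta> p \<noteq> tzero} \<subseteq> closure {p \<in> U. along X V p \<noteq> tzero}"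
      by (intro closure_mono) blast
    then have "supp_on U ?\<eta> \<inter> Dbar = (supp_on U (along X V) \<inter> Dbar) \<inter> closure {p \<in> U. ?\<eta> p \<noteq> tzero}"
      by (auto simp: supp_on_def)
    then show ?thesis using compact_Int_closed[OF supp closed_closure] by simp
  qed
  then obtain I where I: "has_form_integral M (ext_deriv M ?\<eta>) (interior Dbar) I" "has_boundary_integral M ?\<eta> Dbar I"
    using stokes flux_form[OF Z U V] unfolding stokes_applicable_def by blast
  \<comment> \<open>Stokes' theorem gives both integrals the same value \<open>I\<close>. The one
    over the interior is computed from the component at \<open>indices\<close> alone, which is zero
    in every chart because the interior lies in \<open>U\<close>.\<close>
  have "I = 0"
  proof (rule has_form_integral_zero[OF I(1) _ chart[OF M]])
    show "ext_deriv M ?\<eta> p c [] indices = 0" if "p \<in> interior Dbar" "c \<in> M" "p \<in> cdom c" for p c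
      using closed[OF that(2) _ that(3)] that(1) interior_subset domain(2) by blast
  qed
  then show ?thesis using I(2) \<eta> by simp
qed

end
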